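(* Let $R$ be a Noetherian universally catenary, locally equidimensional ring whose maximal ideals all have the same height. Let $M$ be a finitely generated $R$-module such that the symmetric algebra $\operatorname{Sym}(M)$ is equidimensional. Let $$F_1 \stackrel{\varphi}{\longrightarrow} F_0 \longrightarrow M \rightarrow 0$$ be a free presentation of $M$, where $F_0$ is free of finite rank $n$, and let $b: F_0\longrightarrow R$ be any $R$-linear map. If $P$ is a minimal prime of the generalized row ideal $\operatorname{image}(b\varphi)\subset R$, then $$\operatorname{ht} P \leq n+\operatorname{ht} Q -\mu_Q(M)$$ for any prime $Q\subset P$.
   Context: All rings are commutative with $1$. $\operatorname{Sym}(M)$ is the symmetric algebra of $M$ over $R$. For a prime $Q\subset R$, $\mu_Q(M)$ denotes the minimal number of generators of the $R_Q$-module $M_Q$. A ring $A$ is equidimensional if $\dim A/\mathfrak q=\dim A$ for every minimal prime $\mathfrak q$ of $A$; a ring is locally equidimensional if all its localizations at prime ideals are equidimensional. $\operatorname{ht}$ denotes height. The ideal $\operatorname{image}(b\varphi)$ is the image of the composition $b\varphi:F_1\to R$, called the generalized row ideal of $\varphi$ corresponding to $b$. *)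

theory Defs
  imports "HOL-Algebra.Algebra" "HOL-Library.Extended_Nat"
begin

section \<open>Chains of primes, height, dimension\<close>

definition prime_chain :: "('a, 'r) ring_scheme \<Rightarrow> nat \<Rightarrow> (nat \<Rightarrow> 'a set) \<Rightarrow> bool"
  where "prime_chain A n p \<longleftrightarrow>
    (\<forall>i\<le>n. primeideal (p i) A) \<and> (\<forall>i<n. p i \<subset> p (Suc i))"

definition height :: "('a, 'r) ring_scheme \<Rightarrow> 'a set \<Rightarrow> enat"
  where "height A P = Sup {enat n | n p. prime_chain A n p \<and> p n = P}"

text \<open>The zero ring gets dimension 0 here; it has no primes, so this value is irrelevant to
  equidimensionality.\<close>

definition krull_dim :: "('a, 'r) ring_scheme \<Rightarrow> enat"
  where "krull_dim A = Sup {enat n | n p. prime_chain A n p}"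

definition minimal_prime_over :: "('a, 'r) ring_scheme \<Rightarrow> 'a set \<Rightarrow> 'a set \<Rightarrow> bool"
  where "minimal_prime_over A I P \<longleftrightarrow>
    primeideal P A \<and> I \<subseteq> P \<and> (\<forall>P'. primeideal P' A \<longrightarrow> I \<subseteq> P' \<longrightarrow> P' \<subseteq> P \<longrightarrow> P' = P)"

definition equidimensional :: "('a, 'r) ring_scheme \<Rightarrow> bool"
  where "equidimensional A \<longleftrightarrow>
    (\<forall>P. minimal_prime_over A {\<zero>\<^bsub>A\<^esub>} P \<longrightarrow> krull_dim (A Quot P) = krull_dim A)"

definition saturated_prime_chain :: "('a, 'r) ring_scheme \<Rightarrow> nat \<Rightarrow> (nat \<Rightarrow> 'a set) \<Rightarrow> bool"
  where "saturated_prime_chain A n p \<longleftrightarrow>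
    prime_chain A n p \<and> (\<forall>i<n. \<nexists>P. primeideal P A \<and> p i \<subset> P \<and> P \<subset> p (Suc i))"

definition catenary :: "('a, 'r) ring_scheme \<Rightarrow> bool"
  where "catenary A \<longleftrightarrow>
    (\<forall>P Q. primeideal P A \<longrightarrow> primeideal Q A \<longrightarrow> P \<subseteq> Q \<longrightarrow>
      (\<exists>N. \<forall>n p. prime_chain A n p \<longrightarrow> p 0 = P \<longrightarrow> p n = Q \<longrightarrow> n \<le> N) \<and>
      (\<forall>m n p q. saturated_prime_chain A m p \<longrightarrow> p 0 = P \<longrightarrow> p m = Q \<longrightarrow>
        saturated_prime_chain A n q \<longrightarrow> q 0 = P \<longrightarrow> q n = Q \<longrightarrow> m = n))"


section \<open>Polynomial rings in a set of variables\<close>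

definition mpoly_ring :: "('a, 'r) ring_scheme \<Rightarrow> 'v set \<Rightarrow> ('v multiset \<Rightarrow> 'a) ring"
  where "mpoly_ring R V =
    \<lparr>carrier = ring.indexed_pset R V (carrier R),
     monoid.mult = (\<lambda>p q m. \<Oplus>\<^bsub>R\<^esub>k \<in> {k. k \<subseteq># m}. p k \<otimes>\<^bsub>R\<^esub> q (m - k)),
     one = ring.indexed_const R \<one>\<^bsub>R\<^esub>,
     ring.zero = ring.indexed_const R \<zero>\<^bsub>R\<^esub>,
     ring.add = ring.indexed_padd R\<rparr>"

text \<open>Every finitely generated \<open>R\<close>-algebra is catenary; up to isomorphism, these algebras are the
  quotients of the rings \<open>R[X\<^sub>0, \<dots>, X\<^sub>n\<^sub>-\<^sub>1]\<close> by ideals.\<close>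

definition universally_catenary :: "('a, 'r) ring_scheme \<Rightarrow> bool"
  where "universally_catenary R \<longleftrightarrow>
    (\<forall>n::nat. \<forall>I. ideal I (mpoly_ring R {..<n}) \<longrightarrow> catenary (mpoly_ring R {..<n} Quot I))"


section \<open>Modules\<close>

definition ring_as_module :: "('a, 'r) ring_scheme \<Rightarrow> ('a, 'a) module"
  where "ring_as_module R =
    \<lparr>carrier = carrier R, monoid.mult = monoid.mult R, one = \<one>\<^bsub>R\<^esub>, ring.zero = \<zero>\<^bsub>R\<^esub>,
     ring.add = ring.add R, smult = monoid.mult R\<rparr>"

definition linear_maps ::
  "('a, 'r) ring_scheme \<Rightarrow> ('a, 'm, 's) module_scheme \<Rightarrow> ('a, 'n, 't) module_scheme \<Rightarrow> ('m \<Rightarrow> 'n) set"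
  where "linear_maps R M N = {f \<in> carrier M \<rightarrow> carrier N.
    (\<forall>x\<in>carrier M. \<forall>y\<in>carrier M. f (x \<oplus>\<^bsub>M\<^esub> y) = f x \<oplus>\<^bsub>N\<^esub> f y) \<and>
    (\<forall>r\<in>carrier R. \<forall>x\<in>carrier M. f (r \<odot>\<^bsub>M\<^esub> x) = r \<odot>\<^bsub>N\<^esub> f x)}"

definition generated_submodule ::
  "('a, 'r) ring_scheme \<Rightarrow> ('a, 'm, 's) module_scheme \<Rightarrow> 'm set \<Rightarrow> 'm set"
  where "generated_submodule R M G = \<Inter>{N. submodule N R M \<and> G \<subseteq> N}"

definition generates :: "('a, 'r) ring_scheme \<Rightarrow> ('a, 'm, 's) module_scheme \<Rightarrow> 'm set \<Rightarrow> bool"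
  where "generates R M G \<longleftrightarrow> G \<subseteq> carrier M \<and> generated_submodule R M G = carrier M"

definition finitely_generated :: "('a, 'r) ring_scheme \<Rightarrow> ('a, 'm, 's) module_scheme \<Rightarrow> bool"
  where "finitely_generated R M \<longleftrightarrow> (\<exists>G. finite G \<and> generates R M G)"

text \<open>The value is \<open>\<infinity>\<close> if \<open>M\<close> is not finitely generated.\<close>

definition min_generators :: "('a, 'r) ring_scheme \<Rightarrow> ('a, 'm, 's) module_scheme \<Rightarrow> enat"
  where "min_generators R M = Inf {enat (card G) | G. finite G \<and> generates R M G}"

definition module_basis :: "('a, 'r) ring_scheme \<Rightarrow> ('a, 'm, 's) module_scheme \<Rightarrow> 'm set \<Rightarrow> bool"
  where "module_basis R F B \<longleftrightarrow> B \<subseteq> carrier F \<and>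
    (\<forall>x\<in>carrier F. \<exists>!c. c \<in> B \<rightarrow> carrier R \<and> (\<forall>e. e \<notin> B \<longrightarrow> c e = \<zero>\<^bsub>R\<^esub>) \<and>
      finite {e. c e \<noteq> \<zero>\<^bsub>R\<^esub>} \<and> x = (\<Oplus>\<^bsub>F\<^esub>e \<in> {e. c e \<noteq> \<zero>\<^bsub>R\<^esub>}. c e \<odot>\<^bsub>F\<^esub> e))"

definition free_module :: "('a, 'r) ring_scheme \<Rightarrow> ('a, 'm, 's) module_scheme \<Rightarrow> bool"
  where "free_module R F \<longleftrightarrow> module R F \<and> (\<exists>B. module_basis R F B)"

definition free_module_of_rank ::
  "('a, 'r) ring_scheme \<Rightarrow> ('a, 'm, 's) module_scheme \<Rightarrow> nat \<Rightarrow> bool"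
  where "free_module_of_rank R F n \<longleftrightarrow>
    module R F \<and> (\<exists>B. module_basis R F B \<and> finite B \<and> card B = n)"

text \<open>Exactness of \<open>F1 \<rightarrow> F0 \<rightarrow> M \<rightarrow> 0\<close> with \<open>F1\<close> free of arbitrary rank and \<open>F0\<close> free of rank \<open>n\<close>;
  the maps are \<open>f\<close> and \<open>g\<close>.\<close>

definition free_presentation ::
  "('a, 'r) ring_scheme \<Rightarrow> ('a, 'x, 's) module_scheme \<Rightarrow> ('a, 'y, 't) module_scheme \<Rightarrow> nat \<Rightarrow>
   ('a, 'm, 'u) module_scheme \<Rightarrow> ('x \<Rightarrow> 'y) \<Rightarrow> ('y \<Rightarrow> 'm) \<Rightarrow> bool"
  where "free_presentation R F1 F0 n M f g \<longleftrightarrow>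
    free_module R F1 \<and> free_module_of_rank R F0 n \<and> module R M \<and>
    f \<in> linear_maps R F1 F0 \<and> g \<in> linear_maps R F0 M \<and>
    f ` carrier F1 = {y \<in> carrier F0. g y = \<zero>\<^bsub>M\<^esub>} \<and> g ` carrier F0 = carrier M"


section \<open>Localization\<close>

text \<open>\<open>(m, s)\<close> stands for the fraction \<open>m/s\<close>.\<close>

definition frac_rel ::
  "('a, 'r) ring_scheme \<Rightarrow> 'a set \<Rightarrow> ('a, 'm, 's) module_scheme \<Rightarrow> (('m \<times> 'a) \<times> ('m \<times> 'a)) set"
  where "frac_rel R S M = {((m, s), (m', s')).
    m \<in> carrier M \<and> s \<in> S \<and> m' \<in> carrier M \<and> s' \<in> S \<and>
    (\<exists>u\<in>S. u \<odot>\<^bsub>M\<^esub> (s' \<odot>\<^bsub>M\<^esub> m) = u \<odot>\<^bsub>M\<^esub> (s \<odot>\<^bsub>M\<^esub> m'))}"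

definition frac ::
  "('a, 'r) ring_scheme \<Rightarrow> 'a set \<Rightarrow> ('a, 'm, 's) module_scheme \<Rightarrow> 'm \<Rightarrow> 'a \<Rightarrow> ('m \<times> 'a) set"
  where "frac R S M m s = frac_rel R S M `` {(m, s)}"

definition ring_of_fractions :: "('a, 'r) ring_scheme \<Rightarrow> 'a set \<Rightarrow> (('a \<times> 'a) set) ring"
  where "ring_of_fractions R S = (let fr = frac R S (ring_as_module R) in
    \<lparr>carrier = (carrier R \<times> S) // frac_rel R S (ring_as_module R),
     monoid.mult = (\<lambda>U V. \<Union>(a, s)\<in>U. \<Union>(b, t)\<in>V. fr (a \<otimes>\<^bsub>R\<^esub> b) (s \<otimes>\<^bsub>R\<^esub> t)),
     one = fr \<one>\<^bsub>R\<^esub> \<one>\<^bsub>R\<^esub>,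
     ring.zero = fr \<zero>\<^bsub>R\<^esub> \<one>\<^bsub>R\<^esub>,
     ring.add = (\<lambda>U V. \<Union>(a, s)\<in>U. \<Union>(b, t)\<in>V. fr ((t \<otimes>\<^bsub>R\<^esub> a) \<oplus>\<^bsub>R\<^esub> (s \<otimes>\<^bsub>R\<^esub> b)) (s \<otimes>\<^bsub>R\<^esub> t))\<rparr>)"

text \<open>The ring operations \<open>mult\<close> and \<open>one\<close> of the record play no role for modules.\<close>

definition module_of_fractions ::
  "('a, 'r) ring_scheme \<Rightarrow> 'a set \<Rightarrow> ('a, 'm, 's) module_scheme \<Rightarrow>
   (('a \<times> 'a) set, ('m \<times> 'a) set) module"
  where "module_of_fractions R S M = (let fr = frac R S M in
    \<lparr>carrier = (carrier M \<times> S) // frac_rel R S M,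
     monoid.mult = undefined,
     one = undefined,
     ring.zero = fr \<zero>\<^bsub>M\<^esub> \<one>\<^bsub>R\<^esub>,
     ring.add = (\<lambda>U V. \<Union>(x, s)\<in>U. \<Union>(y, t)\<in>V. fr ((t \<odot>\<^bsub>M\<^esub> x) \<oplus>\<^bsub>M\<^esub> (s \<odot>\<^bsub>M\<^esub> y)) (s \<otimes>\<^bsub>R\<^esub> t)),
     smult = (\<lambda>U V. \<Union>(a, s)\<in>U. \<Union>(y, t)\<in>V. fr (a \<odot>\<^bsub>M\<^esub> y) (s \<otimes>\<^bsub>R\<^esub> t))\<rparr>)"

definition localization_at :: "('a, 'r) ring_scheme \<Rightarrow> 'a set \<Rightarrow> (('a \<times> 'a) set) ring"
  where "localization_at R P = ring_of_fractions R (carrier R - P)"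

definition module_localization_at ::
  "('a, 'r) ring_scheme \<Rightarrow> 'a set \<Rightarrow> ('a, 'm, 's) module_scheme \<Rightarrow>
   (('a \<times> 'a) set, ('m \<times> 'a) set) module"
  where "module_localization_at R P M = module_of_fractions R (carrier R - P) M"

definition locally_equidimensional :: "('a, 'r) ring_scheme \<Rightarrow> bool"
  where "locally_equidimensional R \<longleftrightarrow>
    (\<forall>P. primeideal P R \<longrightarrow> equidimensional (localization_at R P))"

definition local_min_generators ::
  "('a, 'r) ring_scheme \<Rightarrow> 'a set \<Rightarrow> ('a, 'm, 's) module_scheme \<Rightarrow> enat"
  where "local_min_generators R Q M =
    min_generators (localization_at R Q) (module_localization_at R Q M)"


section \<open>The symmetric algebra\<close>

text \<open>The free commutative \<open>R\<close>-algebra on the underlying set of \<open>M\<close>, with variables \<open>X\<^sub>x\<close> for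
  \<open>x \<in> M\<close>, modulo the relations \<open>X\<^sub>x\<^sub>+\<^sub>y = X\<^sub>x + X\<^sub>y\<close> and \<open>X\<^sub>r\<^sub>x = r X\<^sub>x\<close> that make
  \<open>x \<mapsto> X\<^sub>x\<close> \<open>R\<close>-linear.\<close>

definition sym_relations ::
  "('a, 'r) ring_scheme \<Rightarrow> ('a, 'm, 's) module_scheme \<Rightarrow> ('m multiset \<Rightarrow> 'a) set"
  where "sym_relations R M = (let A = mpoly_ring R (carrier M); v = ring.indexed_var R in
    {v (x \<oplus>\<^bsub>M\<^esub> y) \<ominus>\<^bsub>A\<^esub> (v x \<oplus>\<^bsub>A\<^esub> v y) | x y. x \<in> carrier M \<and> y \<in> carrier M} \<union>
    {v (r \<odot>\<^bsub>M\<^esub> x) \<ominus>\<^bsub>A\<^esub> (ring.indexed_const R r \<otimes>\<^bsub>A\<^esub> v x) | r x. r \<in> carrier R \<and> x \<in> carrier M})"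

definition sym_algebra ::
  "('a, 'r) ring_scheme \<Rightarrow> ('a, 'm, 's) module_scheme \<Rightarrow> (('m multiset \<Rightarrow> 'a) set) ring"
  where "sym_algebra R M =
    mpoly_ring R (carrier M) Quot (Idl\<^bsub>mpoly_ring R (carrier M)\<^esub> (sym_relations R M))"

end

theory Submission
  imports Defs "HOL-Library.Multiset_Order"
begin

text \<open>Write \<open>S = R[X\<^sub>0, \<dots>, X\<^sub>n\<^sub>-\<^sub>1]\<close>, so that \<open>Sym(M) = S/J\<close> with \<open>J\<close> generated by the linear forms of the
  relations of \<open>M\<close>. The prime \<open>P' = P + (X\<^sub>i - b\<^sub>i)\<close> of \<open>S\<close> is minimal over \<open>J + (X\<^sub>i - b\<^sub>i)\<close>. Let \<open>q \<subseteq> P'\<close>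
  be a minimal prime of \<open>J\<close>; by Krull's height theorem \<open>ht(P'/q) \<le> n\<close>. Since \<open>S\<close> is catenary and
  \<open>R\<close> is locally equidimensional, \<open>ht q + ht(P'/q) \<ge> ht P + n\<close>, hence \<open>ht q \<ge> ht P\<close>. Passing from the
  generic point of the fibre of \<open>Sym(M)\<close> over \<open>Q\<close> to \<open>Q + (X)\<close> and on to \<open>I + (X)\<close>, with \<open>I \<supseteq> Q\<close>
  maximal, gives a chain of length \<open>\<mu>\<^sub>Q(M) + dim R - ht Q\<close> of primes above \<open>J\<close>. As \<open>Sym(M)\<close> is equidimensional,
  there is an equally long chain starting at \<open>q\<close>, and \<open>dim S \<le> dim R + n\<close> yields
  \<open>ht q + \<mu>\<^sub>Q(M) + dim R - ht Q \<le> dim R + n\<close>.\<close>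

section \<open>Primes and chains of primes\<close>

text \<open>Catenarity adds lengths only between fixed primes. Hence one minimal prime of
  \<open>R\<close> is fixed below \<open>q\<close> and another below \<open>Q\<close>; local
  equidimensionality guarantees that chains starting there are long enough to measure the full
  heights of \<open>P\<close> and of the maximal ideal \<open>I\<close>. The difference
  \<open>dim R - ht Q\<close> is never formed: the length \<open>h\<close> of a chain from
  \<open>Q + (X)\<close> to \<open>I + (X)\<close> stands for it and is cancelled among natural
  numbers, so an infinite dimension causes no trouble. The chain that equidimensionality provides
  above \<open>q\<close> ends at a prime unrelated to \<open>Q\<close>; the equal heights of the
  maximal ideals make it comparable with \<open>I\<close>. Two devices keep the commutative algebra
  elementary. Ideals of a local ring are represented by ideals saturated with respect to a prime,
  and division over a residue field by pseudo-division. The primes of \<open>S\<close> that are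
  written down explicitly are preimages of some \<open>Q[X]\<close> under a substitution of the
  variables, which makes primality automatic and reduces inclusions to compositions of
  substitutions.\<close>

lemma primeideal_subset: "primeideal P A \<Longrightarrow> P \<subseteq> carrier A"
  by (meson additive_subgroup.a_subset ideal.axioms(1) primeideal.axioms(1))

lemma primeideal_multD:
  "primeideal P A \<Longrightarrow> x \<in> carrier A \<Longrightarrow> y \<in> carrier A \<Longrightarrow> x \<otimes>\<^bsub>A\<^esub> y \<in> P \<Longrightarrow> x \<in> P \<or> y \<in> P"
  by (rule primeideal.I_prime)

lemma primeideal_one_notin: "primeideal P A \<Longrightarrow> \<one>\<^bsub>A\<^esub> \<notin> P"
  using ideal.one_imp_carrier primeideal.I_notcarr primeideal.axioms(1) by blast

lemma idealD:
  assumes "ideal I A"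
  shows "I \<subseteq> carrier A" "\<zero>\<^bsub>A\<^esub> \<in> I" "x \<in> I \<Longrightarrow> y \<in> I \<Longrightarrow> x \<oplus>\<^bsub>A\<^esub> y \<in> I"
    "x \<in> I \<Longrightarrow> \<ominus>\<^bsub>A\<^esub> x \<in> I" "x \<in> I \<Longrightarrow> y \<in> I \<Longrightarrow> x \<ominus>\<^bsub>A\<^esub> y \<in> I"
    "r \<in> carrier A \<Longrightarrow> x \<in> I \<Longrightarrow> r \<otimes>\<^bsub>A\<^esub> x \<in> I" "r \<in> carrier A \<Longrightarrow> x \<in> I \<Longrightarrow> x \<otimes>\<^bsub>A\<^esub> r \<in> I"
proof -
  interpret ideal I A by fact
  show "I \<subseteq> carrier A" "\<zero>\<^bsub>A\<^esub> \<in> I" by auto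
  show "x \<in> I \<Longrightarrow> y \<in> I \<Longrightarrow> x \<oplus>\<^bsub>A\<^esub> y \<in> I" by auto
  show inv: "x \<in> I \<Longrightarrow> \<ominus>\<^bsub>A\<^esub> x \<in> I" for x by auto
  show "x \<in> I \<Longrightarrow> y \<in> I \<Longrightarrow> x \<ominus>\<^bsub>A\<^esub> y \<in> I"
    unfolding a_minus_def using inv by auto
  show "r \<in> carrier A \<Longrightarrow> x \<in> I \<Longrightarrow> r \<otimes>\<^bsub>A\<^esub> x \<in> I" "r \<in> carrier A \<Longrightarrow> x \<in> I \<Longrightarrow> x \<otimes>\<^bsub>A\<^esub> r \<in> I"
    by (auto simp: I_l_closed I_r_closed)
qed

lemmas primeD = idealD[OF primeideal.axioms(1)]

lemma (in cring) idealI':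
  assumes "I \<subseteq> carrier R" "\<zero> \<in> I" "\<And>x y. x \<in> I \<Longrightarrow> y \<in> I \<Longrightarrow> x \<oplus> y \<in> I"
    "\<And>r x. r \<in> carrier R \<Longrightarrow> x \<in> I \<Longrightarrow> r \<otimes> x \<in> I"
  shows "ideal I R"
proof (rule idealI)
  show "ring R" by (rule ring_axioms)
  show "subgroup I (add_monoid R)"
  proof (rule subgroup.intro)
    fix x assume x: "x \<in> I"
    then have "(\<ominus> \<one>) \<otimes> x \<in> I" using assms(4) by simp
    moreover have "(\<ominus> \<one>) \<otimes> x = \<ominus> x" using x assms(1) by (simp add: l_minus subset_iff)
    ultimately show "inv\<^bsub>add_monoid R\<^esub> x \<in> I" by (simp add: a_inv_def)
  qed (use assms in auto)
  show "x \<otimes> a \<in> I" "a \<otimes> x \<in> I" if "a \<in> I" "x \<in> carrier R" for a x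
    using assms(4)[OF that(2,1)] that m_comm[of a x] assms(1) by auto
qed

lemma (in cring) primeidealI':
  assumes "ideal I R" "\<one> \<notin> I"
    "\<And>x y. x \<in> carrier R \<Longrightarrow> y \<in> carrier R \<Longrightarrow> x \<otimes> y \<in> I \<Longrightarrow> x \<in> I \<or> y \<in> I"
  shows "primeideal I R"
  using assms by (intro primeidealI) (auto simp: is_cring)

text \<open>If neither \<open>x\<close> nor \<open>y\<close> lies in the intersection, each is
  missed by some member of the chain. The smaller of these two members misses both but contains the
  product.\<close>

lemma (in cring) Inter_chain_prime:
  assumes "C \<noteq> {}" and "\<And>p. p \<in> C \<Longrightarrow> primeideal p R"
    and "\<And>p q. p \<in> C \<Longrightarrow> q \<in> C \<Longrightarrow> p \<subseteq> q \<or> q \<subseteq> p"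
  shows "primeideal (\<Inter>C) R"
proof (rule primeidealI')
  show "ideal (\<Inter>C) R"
    by (rule i_Intersect) (use assms(1,2) primeideal.axioms(1) in blast)+
  show "\<one> \<notin> \<Inter>C"
    using assms(1,2) primeideal_one_notin by blast
  fix x y assume xy: "x \<in> carrier R" "y \<in> carrier R" "x \<otimes> y \<in> \<Inter>C"
  show "x \<in> \<Inter>C \<or> y \<in> \<Inter>C"
  proof (rule ccontr)
    assume "\<not> ?thesis"
    then obtain p q where pq: "p \<in> C" "x \<notin> p" "q \<in> C" "y \<notin> q" by auto
    with assms(3) have "p \<subseteq> q \<or> q \<subseteq> p" by blast
    then show False
    proof
      assume "p \<subseteq> q"
      then have "y \<notin> p" using pq by auto
      then show False using primeideal_multD[OF assms(2)[OF pq(1)] xy(1,2)] pq xy(3) by auto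
    next
      assume "q \<subseteq> p"
      then have "x \<notin> q" using pq by auto
      then show False using primeideal_multD[OF assms(2)[OF pq(3)] xy(1,2)] pq xy(3) by auto
    qed
  qed
qed

lemma (in cring) minimal_prime_exists:
  assumes "primeideal P R" "I \<subseteq> P"
  obtains p where "minimal_prime_over R I p" "p \<subseteq> P"
proof -
  \<comment> \<open>Zorn's lemma yields maximal sets, so primes are replaced by their complements;
    the union of a chain of complements is the complement of the intersection.\<close>
  define F where "F = (\<lambda>p. - p) ` {p. primeideal p R \<and> I \<subseteq> p \<and> p \<subseteq> P}"
  have "\<exists>m\<in>F. \<forall>U\<in>F. m \<subseteq> U \<longrightarrow> U = m"
  proof (rule subset_Zorn_nonempty)
    show "F \<noteq> {}" using assms by (auto simp: F_def)
    fix C assume C: "C \<noteq> {}" "subset.chain F C"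
    then have CA: "C \<subseteq> F" and Cc: "\<And>U Y. U \<in> C \<Longrightarrow> Y \<in> C \<Longrightarrow> U \<subseteq> Y \<or> Y \<subseteq> U"
      by (auto simp: subset_chain_def)
    define D where "D = (\<lambda>p. - p) ` C"
    have D: "primeideal p R \<and> I \<subseteq> p \<and> p \<subseteq> P" if "p \<in> D" for p
      using that CA by (force simp: D_def F_def)
    have "primeideal (\<Inter>D) R"
      proof (rule Inter_chain_prime)
      show "D \<noteq> {}" using C(1) by (simp add: D_def)
      show "primeideal p R" if "p \<in> D" for p using D[OF that] by blast
      show "p \<subseteq> q \<or> q \<subseteq> p" if "p \<in> D" "q \<in> D" for p q
        using that Cc unfolding D_def by blast
    qed
    moreover have "I \<subseteq> \<Inter>D" "\<Inter>D \<subseteq> P" using D C(1) by (auto simp: D_def)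
    moreover have "\<Union>C = - \<Inter>D" by (auto simp: D_def)
    ultimately show "\<Union>C \<in> F" unfolding F_def by blast
  qed
  then obtain p where "primeideal p R" "I \<subseteq> p" "p \<subseteq> P"
    and "\<forall>q. primeideal q R \<and> I \<subseteq> q \<and> q \<subseteq> P \<longrightarrow> - p \<subseteq> - q \<longrightarrow> - q = - p"
    by (auto simp: F_def)
  then have "minimal_prime_over R I p" unfolding minimal_prime_over_def by blast
  then show thesis using that \<open>p \<subseteq> P\<close> by blast
qed

text \<open>An inductive counterpart of \<open>prime_chain\<close> that records length and endpoints
  only. The recursion strips the smallest prime, so inductions vary the lower endpoint and keep the
  upper one.\<close>

inductive prime_path :: "('a, 'r) ring_scheme \<Rightarrow> nat \<Rightarrow> 'a set \<Rightarrow> 'a set \<Rightarrow> bool"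
  for A where
  prime_path_0: "primeideal U A \<Longrightarrow> prime_path A 0 U U"
| prime_path_Suc: "primeideal U A \<Longrightarrow> U \<subset> Y \<Longrightarrow> prime_path A k Y Z \<Longrightarrow> prime_path A (Suc k) U Z"

lemma prime_path_primes: "prime_path A k U Z \<Longrightarrow> primeideal U A \<and> primeideal Z A \<and> U \<subseteq> Z"
  by (induction rule: prime_path.induct) auto

lemma prime_path_trans:
  "prime_path A k U Y \<Longrightarrow> prime_path A l Y Z \<Longrightarrow> prime_path A (k + l) U Z"
  by (induction rule: prime_path.induct) (auto intro: prime_path.intros)

lemma prime_path_1: "primeideal U A \<Longrightarrow> primeideal Y A \<Longrightarrow> U \<subset> Y \<Longrightarrow> prime_path A 1 U Y"
  using prime_path_Suc[OF _ _ prime_path_0] by simp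

lemma prime_path_le_1:
  assumes "primeideal U A" "primeideal Y A" "U \<subseteq> Y"
  shows "\<exists>k. prime_path A k U Y"
  using assms prime_path_1[of U A Y] prime_path_0[of U A] by (cases "U = Y") auto

lemma prime_path_widen:
  assumes "prime_path A k U Y" "primeideal U' A" "U' \<subseteq> U" "primeideal Y' A" "Y \<subseteq> Y'"
  obtains k' where "k' \<ge> k" "prime_path A k' U' Y'"
proof -
  from assms obtain i j where "prime_path A i U' U" "prime_path A j Y Y'"
    using prime_path_le_1 prime_path_primes by metis
  then have "prime_path A (i + (k + j)) U' Y'" using assms(1) prime_path_trans by metis
  then show thesis by (intro that[of "i + (k + j)"]) auto
qed

lemma prime_path_refl_length: "prime_path A k U Y \<Longrightarrow> U = Y \<Longrightarrow> k = 0"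
  by (induction rule: prime_path.induct) (auto dest!: prime_path_primes)

text \<open>The first prime is replaced and the length is kept. A path of length 0 becomes the
  single prime \<open>U'\<close>, which is why the upper endpoint is left existential.\<close>

lemma prime_path_shrink_start:
  assumes "prime_path A k U Y" "primeideal U' A" "U' \<subseteq> U"
  shows "\<exists>Y'. prime_path A k U' Y'"
  using assms
proof (cases rule: prime_path.cases)
  case prime_path_0
  then show ?thesis using assms prime_path.prime_path_0 by blast
next
  case (prime_path_Suc Y' k')
  then show ?thesis using assms prime_path.prime_path_Suc[of U' A Y' k' Y] by blast
qed

lemma prime_chain_imp_path:
  "prime_chain A k p \<Longrightarrow> prime_path A k (p 0) (p k)"
proof (induction k arbitrary: p)
  case 0
  then show ?case by (auto simp: prime_chain_def intro: prime_path_0)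
next
  case (Suc k)
  have "prime_chain A k (\<lambda>i. p (Suc i))" using Suc.prems by (auto simp: prime_chain_def)
  then have "prime_path A k (p 1) (p (Suc k))" using Suc.IH by fastforce
  moreover have "primeideal (p 0) A" "p 0 \<subset> p 1" using Suc.prems by (auto simp: prime_chain_def)
  ultimately show ?case by (rule prime_path_Suc[rotated 2])
qed

lemma prime_path_imp_chain:
  "prime_path A k U Y \<Longrightarrow> \<exists>p. prime_chain A k p \<and> p 0 = U \<and> p k = Y"
proof (induction rule: prime_path.induct)
  case (prime_path_0 U)
  then show ?case by (intro exI[of _ "\<lambda>_. U"]) (auto simp: prime_chain_def)
next
  case (prime_path_Suc U Y k Z)
  then obtain p where "prime_chain A k p" "p 0 = Y" "p k = Z" by blast
  with prime_path_Suc show ?case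
    by (intro exI[of _ "case_nat U p"])
      (auto simp: prime_chain_def less_Suc_eq_0_disj le_Suc_eq split: nat.splits)
qed

lemma height_path_le: "prime_path A k U P \<Longrightarrow> enat k \<le> height A P"
  unfolding height_def by (rule Sup_upper) (auto dest: prime_path_imp_chain)

lemma height_le: "(\<And>k U. prime_path A k U P \<Longrightarrow> enat k \<le> c) \<Longrightarrow> height A P \<le> c"
  unfolding height_def by (rule Sup_least) (auto dest: prime_chain_imp_path)

lemma krull_dim_path_le: "prime_path A k U Y \<Longrightarrow> enat k \<le> krull_dim A"
  unfolding krull_dim_def by (rule Sup_upper) (auto dest: prime_path_imp_chain)

text \<open>The bound is positive on purpose: a ring without primes also has
  \<open>krull_dim\<close> 0, as a supremum over the empty set, and there no path exists.\<close>

lemma krull_dim_path_exists: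
  assumes "enat (Suc k) \<le> krull_dim A"
  shows "\<exists>l U Y. Suc k \<le> l \<and> prime_path A l U Y"
proof (rule ccontr)
  assume *: "\<not> ?thesis"
  have "krull_dim A \<le> enat k" unfolding krull_dim_def
    by (rule Sup_least) (use * prime_chain_imp_path not_less_eq_eq in fastforce)
  then show False using assms by (meson enat_ord_simps(1) not_less_eq_eq order_trans order_refl)
qed

section \<open>Krull's height theorem\<close>

definition adjoin :: "('a, 'r) ring_scheme \<Rightarrow> 'a set \<Rightarrow> 'a \<Rightarrow> 'a set"
  where "adjoin A I a = {y \<oplus>\<^bsub>A\<^esub> r \<otimes>\<^bsub>A\<^esub> a | y r. y \<in> I \<and> r \<in> carrier A}"

text \<open>The preimage in \<open>A\<close> of the extension of \<open>I\<close> to the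
  localization at \<open>P\<close>. Saturated ideals thus stand for the ideals of the local ring,
  and local arguments can be carried out inside \<open>A\<close>.\<close>

definition saturation :: "('a, 'r) ring_scheme \<Rightarrow> 'a set \<Rightarrow> 'a set \<Rightarrow> 'a set"
  where "saturation A P I = {x \<in> carrier A. \<exists>s \<in> carrier A - P. s \<otimes>\<^bsub>A\<^esub> x \<in> I}"

definition saturated :: "('a, 'r) ring_scheme \<Rightarrow> 'a set \<Rightarrow> 'a set \<Rightarrow> bool"
  where "saturated A P I \<longleftrightarrow> ideal I A \<and>
    (\<forall>s \<in> carrier A - P. \<forall>x \<in> carrier A. s \<otimes>\<^bsub>A\<^esub> x \<in> I \<longrightarrow> x \<in> I)"

context cring
begin

lemma adjoin_ideal:
  assumes I: "ideal I R" and a: "a \<in> carrier R"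
  shows "ideal (adjoin R I a) R" "I \<subseteq> adjoin R I a" "a \<in> adjoin R I a"
proof -
  note Ic = idealD(1)[OF I, THEN subsetD]
  show "ideal (adjoin R I a) R"
  proof (rule idealI')
    show "adjoin R I a \<subseteq> carrier R" using a Ic by (auto simp: adjoin_def)
    show "\<zero> \<in> adjoin R I a"
      using idealD(2)[OF I] a unfolding adjoin_def
      by (intro CollectI exI[of _ \<zero>]) auto
    fix x y assume "x \<in> adjoin R I a" "y \<in> adjoin R I a"
    then obtain u r v t where *: "u \<in> I" "r \<in> carrier R" "x = u \<oplus> r \<otimes> a"
       "v \<in> I" "t \<in> carrier R" "y = v \<oplus> t \<otimes> a" unfolding adjoin_def by blast
    then have uv: "u \<in> carrier R" "v \<in> carrier R" using Ic by auto
    have "x \<oplus> y = (u \<oplus> v) \<oplus> (r \<oplus> t) \<otimes> a" using * uv a by algebra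
    then show "x \<oplus> y \<in> adjoin R I a" using * idealD(3)[OF I] unfolding adjoin_def by blast
  next
    fix s x assume s: "s \<in> carrier R" and "x \<in> adjoin R I a"
    then obtain u r where *: "u \<in> I" "r \<in> carrier R" "x = u \<oplus> r \<otimes> a" unfolding adjoin_def by blast
    then have u: "u \<in> carrier R" using Ic by auto
    have "s \<otimes> x = s \<otimes> u \<oplus> (s \<otimes> r) \<otimes> a" using * u a s by algebra
    then show "s \<otimes> x \<in> adjoin R I a" using * s idealD(6)[OF I s] unfolding adjoin_def by blast
  qed
  show "I \<subseteq> adjoin R I a"
  proof
    fix x assume "x \<in> I"
    moreover then have "x = x \<oplus> \<zero> \<otimes> a" using a Ic by simp
    ultimately show "x \<in> adjoin R I a" unfolding adjoin_def by blast
  qed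
  have "a = \<zero> \<oplus> \<one> \<otimes> a" using a by simp
  then show "a \<in> adjoin R I a" using idealD(2)[OF I] unfolding adjoin_def by blast
qed

lemma prime_compl_mult:
  "primeideal P R \<Longrightarrow> s \<in> carrier R - P \<Longrightarrow> t \<in> carrier R - P \<Longrightarrow> s \<otimes> t \<in> carrier R - P"
  using primeideal_multD by fastforce

lemma saturation_saturated:
  assumes P: "primeideal P R" and I: "ideal I R"
  shows "saturated R P (saturation R P I)" "I \<subseteq> saturation R P I"
proof -
  note Ic = idealD(1)[OF I, THEN subsetD]
  have one: "\<one> \<in> carrier R - P" using primeideal_one_notin[OF P] by simp
  have "ideal (saturation R P I) R"
  proof (rule idealI')
    show "saturation R P I \<subseteq> carrier R" by (auto simp: saturation_def)
    show "\<zero> \<in> saturation R P I" using one idealD(2)[OF I] by (force simp: saturation_def)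
    fix x y assume "x \<in> saturation R P I" "y \<in> saturation R P I"
    then obtain s t where *: "s \<in> carrier R - P" "x \<in> carrier R" "s \<otimes> x \<in> I"
       "t \<in> carrier R - P" "y \<in> carrier R" "t \<otimes> y \<in> I" unfolding saturation_def by blast
    have "(s \<otimes> t) \<otimes> (x \<oplus> y) = t \<otimes> (s \<otimes> x) \<oplus> s \<otimes> (t \<otimes> y)" using * by simp algebra
    then have "(s \<otimes> t) \<otimes> (x \<oplus> y) \<in> I" using * idealD(3,6)[OF I] by simp
    then show "x \<oplus> y \<in> saturation R P I" using * prime_compl_mult[OF P, of s t]
      unfolding saturation_def by blast
  next
    fix r x assume r: "r \<in> carrier R" and "x \<in> saturation R P I"
    then obtain s where *: "s \<in> carrier R - P" "x \<in> carrier R" "s \<otimes> x \<in> I"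
      unfolding saturation_def by blast
    have "s \<otimes> (r \<otimes> x) = r \<otimes> (s \<otimes> x)" using * r by simp algebra
    then have "s \<otimes> (r \<otimes> x) \<in> I" using * idealD(6)[OF I r] by simp
    then show "r \<otimes> x \<in> saturation R P I" using * r unfolding saturation_def by blast
  qed
  moreover have "x \<in> saturation R P I"
    if sx: "s \<in> carrier R - P" "x \<in> carrier R" "s \<otimes> x \<in> saturation R P I" for s x
  proof -
    obtain t where *: "t \<in> carrier R - P" "t \<otimes> (s \<otimes> x) \<in> I" using sx(3) unfolding saturation_def by blast
    then have "(t \<otimes> s) \<otimes> x \<in> I" using sx by (simp add: m_assoc)
    then show ?thesis using * sx prime_compl_mult[OF P, of t s] unfolding saturation_def by blast
  qed
  ultimately show "saturated R P (saturation R P I)" unfolding saturated_def by blast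
  show "I \<subseteq> saturation R P I"
    using one Ic unfolding saturation_def by force
qed

lemma saturation_minimal:
  assumes "saturated R P L" "I \<subseteq> L"
  shows "saturation R P I \<subseteq> L"
  using assms unfolding saturated_def saturation_def by blast

lemma adjoin_minimal:
  assumes "ideal L R" "I \<subseteq> L" "a \<in> L"
  shows "adjoin R I a \<subseteq> L"
proof
  fix x assume "x \<in> adjoin R I a"
  then obtain y r where "x = y \<oplus> r \<otimes> a" "y \<in> I" "r \<in> carrier R" unfolding adjoin_def by blast
  then show "x \<in> L" using assms idealD(3,6)[OF assms(1)] by (simp add: subset_iff)
qed

lemma adjoin_mono: "I \<subseteq> L \<Longrightarrow> adjoin R I a \<subseteq> adjoin R L a"
  unfolding adjoin_def by blast

lemma saturation_mono: "I \<subseteq> L \<Longrightarrow> saturation R P I \<subseteq> saturation R P L"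
  unfolding saturation_def by blast

lemma saturatedD: "saturated R P I \<Longrightarrow> s \<in> carrier R - P \<Longrightarrow> x \<in> carrier R \<Longrightarrow> s \<otimes> x \<in> I \<Longrightarrow> x \<in> I"
  unfolding saturated_def by blast

lemma saturated_ideal: "saturated R P I \<Longrightarrow> ideal I R"
  unfolding saturated_def by blast

end

locale noetherian_cring = noetherian_ring + cring
begin

text \<open>Zorn's lemma applies because, in a noetherian ring, the union of a chain of ideals is a
  member of the chain.\<close>

lemma maximal_ideal_in_family:
  assumes "F \<noteq> {}" "\<And>I. I \<in> F \<Longrightarrow> ideal I R"
  obtains I where "I \<in> F" "\<And>L. L \<in> F \<Longrightarrow> I \<subseteq> L \<Longrightarrow> L = I"
proof -
  have "\<exists>M\<in>F. \<forall>U\<in>F. M \<subseteq> U \<longrightarrow> U = M"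
  proof (rule subset_Zorn_nonempty[OF assms(1)])
    fix C assume C: "C \<noteq> {}" "subset.chain F C"
    then have "subset.chain {I. ideal I R} C" using assms(2) by (auto simp: subset_chain_def)
    then have "\<Union>C \<in> C" using ideal_chain_is_trivial C(1) by blast
    then show "\<Union>C \<in> F" using C(2) by (auto simp: subset_chain_def)
  qed
  then show thesis using that by blast
qed

text \<open>Induction from larger ideals to smaller ones; among counterexamples there would be a
  maximal one.\<close>

lemma noetherian_induct [consumes 1, case_names ideal]:
  assumes "ideal J R"
    and step: "\<And>J. ideal J R \<Longrightarrow> (\<And>L. ideal L R \<Longrightarrow> J \<subset> L \<Longrightarrow> T L) \<Longrightarrow> T J"
  shows "T J"
proof (rule ccontr)
  assume "\<not> T J"
  then have "{I. ideal I R \<and> \<not> T I} \<noteq> {}" using assms(1) by blast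
  then obtain I where "I \<in> {I. ideal I R \<and> \<not> T I}"
    "\<And>L. L \<in> {I. ideal I R \<and> \<not> T I} \<Longrightarrow> I \<subseteq> L \<Longrightarrow> L = I"
    using maximal_ideal_in_family[of "{I. ideal I R \<and> \<not> T I}"] by blast
  then show False using step[of I] by blast
qed

text \<open>A maximal element among the annihilators of the nonzero elements of \<open>R/J\<close> is prime;
  saturation keeps it inside \<open>P\<close>.\<close>

lemma exists_annihilated_by_prime:
  assumes P: "primeideal P R" and J: "saturated R P J" "J \<noteq> carrier R"
    and uniq: "\<And>N. primeideal N R \<Longrightarrow> J \<subseteq> N \<Longrightarrow> N \<subseteq> P \<Longrightarrow> N = P"
  obtains u where "u \<in> carrier R" "u \<notin> J" "\<And>x. x \<in> P \<Longrightarrow> x \<otimes> u \<in> J"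
proof -
  note Ji = saturated_ideal[OF J(1)]
  define ann where "ann = (\<lambda>u. {x \<in> carrier R. x \<otimes> u \<in> J})"
  define F where "F = ann ` (carrier R - J)"
  have ann_ideal: "ideal (ann u) R" if u: "u \<in> carrier R" for u
  proof (rule idealI')
    show "ann u \<subseteq> carrier R" "\<zero> \<in> ann u" using u idealD(2)[OF Ji] by (auto simp: ann_def)
    show "x \<oplus> y \<in> ann u" if "x \<in> ann u" "y \<in> ann u" for x y
      using that u idealD(3)[OF Ji] by (auto simp: ann_def l_distr)
    show "r \<otimes> x \<in> ann u" if "r \<in> carrier R" "x \<in> ann u" for r x
      using that u idealD(6)[OF Ji] by (auto simp: ann_def m_assoc)
  qed
  have ne: "F \<noteq> {}" using J(2) idealD(1)[OF Ji] by (auto simp: F_def)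
  obtain I where "I \<in> F" and Imax: "\<And>L. L \<in> F \<Longrightarrow> I \<subseteq> L \<Longrightarrow> L = I"
    using maximal_ideal_in_family[OF ne] ann_ideal by (auto simp: F_def)
  then obtain u where u: "u \<in> carrier R" "u \<notin> J" "I = ann u" by (auto simp: F_def)
  have "primeideal (ann u) R"
  proof (rule primeidealI')
    show "ideal (ann u) R" using ann_ideal u by blast
    show "\<one> \<notin> ann u" using u by (simp add: ann_def)
    fix x y assume xy: "x \<in> carrier R" "y \<in> carrier R" "x \<otimes> y \<in> ann u"
    show "x \<in> ann u \<or> y \<in> ann u"
    proof (cases "y \<otimes> u \<in> J")
      case False
      then have "ann (y \<otimes> u) \<in> F" using u xy by (auto simp: F_def)
      moreover have "I \<subseteq> ann (y \<otimes> u)"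
      proof
        fix z assume "z \<in> I"
        then have z: "z \<in> carrier R" "z \<otimes> u \<in> J" using u by (auto simp: ann_def)
        have "z \<otimes> (y \<otimes> u) = y \<otimes> (z \<otimes> u)" using z u xy by algebra
        then show "z \<in> ann (y \<otimes> u)" using z idealD(6)[OF Ji xy(2)] by (auto simp: ann_def)
      qed
      ultimately have "ann (y \<otimes> u) = ann u" using Imax u by blast
      moreover have "x \<in> ann (y \<otimes> u)" using xy u by (auto simp: ann_def m_assoc)
      ultimately show ?thesis by blast
    qed (use xy in \<open>auto simp: ann_def\<close>)
  qed
  moreover have "J \<subseteq> ann u"
    using idealD(1,7)[OF Ji] u by (auto simp: ann_def)
  moreover have "ann u \<subseteq> P"
    using saturatedD[OF J(1) _ u(1)] u by (auto simp: ann_def)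
  ultimately have "ann u = P" using uniq by blast
  then show thesis using that[of u] u by (auto simp: ann_def)
qed

text \<open>The local ring at \<open>P\<close> modulo \<open>J\<close> has dimension zero, hence is
  Artinian. Noetherian induction on \<open>J\<close> takes the place of a composition series: an
  element \<open>u\<close> that \<open>P\<close> annihilates modulo \<open>J\<close> is added to
  \<open>J\<close>, and the chain, or the chain with \<open>u\<close> added to its terms, lies over
  the larger ideal.\<close>

lemma saturated_dcc:
  assumes P: "primeideal P R" and J: "ideal J R"
  shows "saturated R P J \<Longrightarrow> (\<And>N. primeideal N R \<Longrightarrow> J \<subseteq> N \<Longrightarrow> N \<subseteq> P \<Longrightarrow> N = P) \<Longrightarrow>
    (\<And>i. saturated R P (I i) \<and> J \<subseteq> I i \<and> I (Suc i) \<subseteq> I i) \<Longrightarrow> \<exists>n::nat. I (Suc n) = I n"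
  using J
proof (induction J arbitrary: I rule: noetherian_induct)
  case (ideal J)
  note J = ideal(1) and IH = ideal(2) and Js = ideal(3) and uniq = ideal(4) and I = ideal(5)
  show ?case
  proof (cases "J = carrier R")
    case True
    then have "I i = carrier R" for i using I idealD(1)[OF saturated_ideal] by blast
    then show ?thesis by auto
  next
    case False
    obtain u where u: "u \<in> carrier R" "u \<notin> J" "\<And>x. x \<in> P \<Longrightarrow> x \<otimes> u \<in> J"
      using exists_annihilated_by_prime[OF P Js False uniq] by blast
    define J' where "J' = saturation R P (adjoin R J u)"
    note adj = adjoin_ideal[OF J u(1)]
    have J's: "saturated R P J'" and J'sub: "adjoin R J u \<subseteq> J'"
      unfolding J'_def using saturation_saturated[OF P adj(1)] by auto
    have J'i: "ideal J' R" using J's saturated_ideal by blast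
    have JJ': "J \<subset> J'" using J'sub adj u by blast
    have uniq': "\<And>N. primeideal N R \<Longrightarrow> J' \<subseteq> N \<Longrightarrow> N \<subseteq> P \<Longrightarrow> N = P" using uniq JJ' by blast
    show ?thesis
    proof (cases "\<forall>i. u \<in> I i")
      case True
      have "J' \<subseteq> I i" for i unfolding J'_def
      proof (rule saturation_minimal)
        show "saturated R P (I i)" using I by blast
        then show "adjoin R J u \<subseteq> I i" using True I by (intro adjoin_minimal saturated_ideal) auto
      qed
      then show ?thesis using IH[OF J'i JJ' J's uniq', of I] I by blast
    next
      case False
      then obtain i0 where i0: "u \<notin> I i0" by blast
      have dec: "I (i0 + i) \<subseteq> I i0" for i
        by (induction i) (use I in auto)
      \<comment> \<open>From \<open>i0\<close> on no term contains \<open>u\<close>. With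
        \<open>u\<close> added the terms lie over \<open>J'\<close>, so the induction hypothesis
        applies to them.\<close>
      define K where "K = (\<lambda>i. saturation R P (adjoin R (I (i0 + i)) u))"
      have "saturated R P (K i) \<and> J' \<subseteq> K i \<and> K (Suc i) \<subseteq> K i" for i
      proof -
        have "ideal (adjoin R (I (i0 + i)) u) R"
          using I u(1) by (intro adjoin_ideal(1) saturated_ideal[of P]) auto
        moreover have "adjoin R J u \<subseteq> adjoin R (I (i0 + i)) u" using I adjoin_mono by blast
        moreover have "adjoin R (I (i0 + Suc i)) u \<subseteq> adjoin R (I (i0 + i)) u"
          using I[of "i0 + i"] adjoin_mono by simp
        ultimately show ?thesis unfolding K_def J'_def
          using saturation_saturated(1)[OF P] saturation_mono by metis
      qed
      then obtain n where n: "K (Suc n) = K n" using IH[OF J'i JJ' J's uniq', of K] by blast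
      let ?i = "i0 + n"
      have Ii: "ideal (I ?i) R" "ideal (I (Suc ?i)) R" using I saturated_ideal by blast+
      have "I ?i \<subseteq> I (Suc ?i)"
      proof
        fix x assume x: "x \<in> I ?i"
        then have xc: "x \<in> carrier R" using idealD(1)[OF Ii(1)] by auto
        have "x \<in> K n" unfolding K_def
          using x adjoin_ideal[OF Ii(1) u(1)] saturation_saturated[OF P] by blast
        then have "x \<in> saturation R P (adjoin R (I (Suc ?i)) u)" using n unfolding K_def by simp
        then obtain s y r where s: "s \<in> carrier R - P" and yr: "y \<in> I (Suc ?i)" "r \<in> carrier R"
          "s \<otimes> x = y \<oplus> r \<otimes> u" unfolding saturation_def adjoin_def by blast
        have yI: "y \<in> I ?i" using yr I by blast
        have yc: "y \<in> carrier R" using yI idealD(1)[OF Ii(1)] by auto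
        have "r \<otimes> u = s \<otimes> x \<ominus> y" using yr(2,3) yc u(1) s xc by (simp; algebra)
        moreover have "s \<otimes> x \<ominus> y \<in> I ?i" using idealD(5,6)[OF Ii(1)] x yI s by blast
        ultimately have ru: "r \<otimes> u \<in> I ?i" by simp
        \<comment> \<open>Here \<open>r u\<close> lies in \<open>I ?i\<close> but \<open>u\<close>
          does not, so saturation forces \<open>r\<close> into \<open>P\<close>. Then
          \<open>r u\<close> is in \<open>J\<close>, hence already in the next term of the chain,
          and so is \<open>s x\<close>.\<close>
        have "r \<in> P"
        proof (rule ccontr)
          assume "r \<notin> P"
          then have "u \<in> I ?i" using saturatedD[of P "I ?i" r u] ru I u yr(2) by blast
          then show False using dec i0 by blast
        qed
        then have "r \<otimes> u \<in> I (Suc ?i)" using u(3) I by blast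
        then have "s \<otimes> x \<in> I (Suc ?i)" using yr idealD(3)[OF Ii(2)] by simp
        then show "x \<in> I (Suc ?i)" using saturatedD[of P "I (Suc ?i)" s x] I s xc by blast
      qed
      then show ?thesis using I by blast
    qed
  qed
qed

text \<open>Nakayama's lemma in the local ring at \<open>P\<close>. Instead of a determinant, a
  saturated ideal \<open>L\<close> maximal between \<open>K\<close> and \<open>I\<close> is used:
  above \<open>L\<close> the ideal \<open>I\<close> is generated, up to denominators, by a single
  element \<open>x\<close>.\<close>

lemma saturated_nakayama:
  assumes P: "primeideal P R" and K: "saturated R P K" and I: "saturated R P I" and KI: "K \<subseteq> I"
    and a: "a \<in> P"
    and gen: "\<And>x. x \<in> I \<Longrightarrow> \<exists>s\<in>carrier R - P. \<exists>z\<in>K. \<exists>w\<in>I. s \<otimes> x = z \<oplus> a \<otimes> w"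
  shows "I = K"
proof (rule ccontr)
  assume neq: "I \<noteq> K"
  define F where "F = {L. saturated R P L \<and> K \<subseteq> L \<and> L \<subset> I}"
  have ac: "a \<in> carrier R" using a primeideal_subset[OF P] by blast
  have ne: "F \<noteq> {}" using K KI neq by (auto simp: F_def)
  have Fi: "ideal L R" if "L \<in> F" for L using that by (auto simp: F_def intro: saturated_ideal)
  then obtain L where "L \<in> F" and Lmax: "\<And>L'. L' \<in> F \<Longrightarrow> L \<subseteq> L' \<Longrightarrow> L' = L"
    using maximal_ideal_in_family[OF ne Fi] by blast
  then have L: "saturated R P L" "K \<subseteq> L" "L \<subset> I" by (auto simp: F_def)
  then obtain x where x: "x \<in> I" "x \<notin> L" by blast
  note Ii = saturated_ideal[OF I] and Li = saturated_ideal[OF L(1)]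
  have xc: "x \<in> carrier R" using x idealD(1)[OF Ii] by blast
  note adj = adjoin_ideal[OF Li xc]
  note st = saturation_saturated[OF P adj(1)]
  let ?L = "saturation R P (adjoin R L x)"
  have "?L \<subseteq> I" using I L(3) x(1) adjoin_minimal[OF Ii] by (intro saturation_minimal) auto
  moreover have "?L \<noteq> L" "L \<subseteq> ?L" using st adj x by blast+
  ultimately have LI: "?L = I" using Lmax[of ?L] st L(2) unfolding F_def by blast
  obtain s z w where s: "s \<in> carrier R - P" and zw: "z \<in> K" "w \<in> I" "s \<otimes> x = z \<oplus> a \<otimes> w"
    using gen[OF x(1)] by blast
  then have "w \<in> ?L" using LI by simp
  then obtain t l r where t: "t \<in> carrier R - P" and wc: "w \<in> carrier R"
    and lr: "l \<in> L" "r \<in> carrier R" "t \<otimes> w = l \<oplus> r \<otimes> x"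
    unfolding saturation_def adjoin_def by blast
  have zL: "z \<in> L" using zw L by blast
  have lc: "l \<in> carrier R" "z \<in> carrier R" using idealD(1)[OF Li] lr zL by blast+
  have sc: "s \<in> carrier R" "t \<in> carrier R" using s t by auto
  have "(t \<otimes> s \<ominus> a \<otimes> r) \<otimes> x = t \<otimes> (s \<otimes> x) \<ominus> a \<otimes> (r \<otimes> x)"
    using sc lr(2) ac xc by algebra
  also have "\<dots> = t \<otimes> z \<oplus> a \<otimes> (t \<otimes> w) \<ominus> a \<otimes> (r \<otimes> x)"
    unfolding zw(3) using sc lr(2) ac xc wc lc by algebra
  also have "\<dots> = t \<otimes> z \<oplus> a \<otimes> l"
    unfolding lr(3) using sc lr(2) ac xc wc lc by algebra
  finally have eq: "(t \<otimes> s \<ominus> a \<otimes> r) \<otimes> x = t \<otimes> z \<oplus> a \<otimes> l" .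
  then have "(t \<otimes> s \<ominus> a \<otimes> r) \<otimes> x \<in> L" using idealD(3,6)[OF Li] zL lr(1) sc ac by simp
  \<comment> \<open>The product \<open>t s\<close> is outside \<open>P\<close> and
    \<open>a r\<close> is inside, so the factor in front of \<open>x\<close> is a unit of the local
    ring and saturation of \<open>L\<close> applies.\<close>
  moreover have "t \<otimes> s \<ominus> a \<otimes> r \<in> carrier R - P"
  proof -
    have "t \<otimes> s \<notin> P" using prime_compl_mult[OF P t s] by blast
    moreover have "t \<otimes> s = (t \<otimes> s \<ominus> a \<otimes> r) \<oplus> a \<otimes> r" using sc ac lr(2) by algebra
    moreover have "a \<otimes> r \<in> P" using primeD(7)[OF P lr(2) a] .
    ultimately have "t \<otimes> s \<ominus> a \<otimes> r \<notin> P" using primeD(3)[OF P] by metis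
    then show ?thesis using sc ac lr(2) by simp
  qed
  ultimately have "x \<in> L" using saturatedD[OF L(1)] xc by blast
  then show False using x by blast
qed

text \<open>Krull's principal ideal theorem modulo \<open>q\<close>. The \<open>p\<close>-saturations of \<open>q + (y\<^sup>n)\<close>, for
  \<open>y \<in> p - q\<close>, replace the usual symbolic powers of \<open>p\<close>.\<close>

lemma principal_ideal_theorem:
  assumes q: "primeideal q R" and p: "primeideal p R" and P: "primeideal P R"
    and qp: "q \<subset> p" and pP: "p \<subset> P" and a: "a \<in> P"
    and uniq: "\<And>N. primeideal N R \<Longrightarrow> q \<subseteq> N \<Longrightarrow> a \<in> N \<Longrightarrow> N \<subseteq> P \<Longrightarrow> N = P"
  shows False
proof -
  obtain y where y: "y \<in> p" "y \<notin> q" using qp by blast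
  note qi = primeideal.axioms(1)[OF q]
  have yc: "y \<in> carrier R" and ac: "a \<in> carrier R" using y a primeideal_subset p P by blast+
  have ap: "a \<notin> p" using uniq[OF p] qp pP by blast
  define I where "I = (\<lambda>n::nat. saturation R p (adjoin R q (y [^] n)))"
  have adjI: "ideal (adjoin R q (y [^] n)) R" "y [^] n \<in> adjoin R q (y [^] n)" "q \<subseteq> adjoin R q (y [^] n)" for n :: nat
    using adjoin_ideal[OF qi] yc by auto
  have Is: "saturated R p (I n)" for n unfolding I_def using saturation_saturated[OF p adjI(1)] by blast
  then have IsP: "saturated R P (I n)" for n using pP unfolding saturated_def by blast
  have Ii: "ideal (I n) R" for n using saturated_ideal[OF Is] .
  have qI: "q \<subseteq> I n" and yI: "y [^] n \<in> I n" for n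
    unfolding I_def using adjI saturation_saturated[OF p adjI(1)] by blast+
  have dec: "I (Suc n) \<subseteq> I n" for n
  proof -
    have "y [^] Suc n \<in> adjoin R q (y [^] n)" using idealD(7)[OF adjI(1) yc adjI(2)] by simp
    then show ?thesis unfolding I_def using adjI by (intro saturation_mono adjoin_minimal)
  qed
  let ?K = "\<lambda>n. saturation R P (adjoin R (I n) a)"
  let ?J = "saturation R P (adjoin R q a)"
  note adjq = adjoin_ideal[OF qi ac] and adjIn = adjoin_ideal[OF Ii ac]
  note Js = saturation_saturated[OF P adjq(1)]
  \<comment> \<open>With \<open>a\<close> added, the chain lies over \<open>q + (a)\<close>, and
    \<open>P\<close> is the only prime between that ideal and \<open>P\<close>.\<close>
  have "\<exists>n. ?K (Suc n) = ?K n"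
  proof (rule saturated_dcc[OF P saturated_ideal[OF Js(1)] Js(1)])
    show "N = P" if "primeideal N R" "?J \<subseteq> N" "N \<subseteq> P" for N
      using uniq[OF that(1) _ _ that(3)] that(2) Js(2) adjq(2,3) by blast
    show "saturated R P (?K i) \<and> ?J \<subseteq> ?K i \<and> ?K (Suc i) \<subseteq> ?K i" for i
      by (intro conjI saturation_saturated[OF P adjIn(1)] saturation_mono adjoin_mono qI dec)
  qed
  then obtain n where n: "?K (Suc n) = ?K n" by blast
  \<comment> \<open>Stability gives \<open>s x = z + a r\<close> with \<open>z\<close> in
    \<open>I (Suc n)\<close>. Since \<open>a\<close> is outside \<open>p\<close> and
    \<open>I n\<close> is \<open>p\<close>-saturated, \<open>r\<close> lies in \<open>I n\<close>,
    which is the hypothesis of Nakayama's lemma.\<close>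
  have "I n = I (Suc n)"
  proof (rule saturated_nakayama[OF P IsP IsP dec a])
    fix x assume x: "x \<in> I n"
    then have xc: "x \<in> carrier R" using idealD(1)[OF Ii] by blast
    have "x \<in> ?K n" using x saturation_saturated[OF P adjIn(1)] adjIn(2) by blast
    then have "x \<in> ?K (Suc n)" using n by simp
    then obtain s z r where s: "s \<in> carrier R - P" and zr: "z \<in> I (Suc n)" "r \<in> carrier R"
      "s \<otimes> x = z \<oplus> r \<otimes> a" unfolding saturation_def adjoin_def by blast
    have zI: "z \<in> I n" using zr dec by blast
    have zc: "z \<in> carrier R" using zI idealD(1)[OF Ii] by blast
    have sx: "s \<otimes> x = z \<oplus> a \<otimes> r" using zr(2,3) ac by (simp add: m_comm)
    have "a \<otimes> r = s \<otimes> x \<ominus> z" using sx zr(2) zc ac xc s by (simp; algebra)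
    moreover have "s \<otimes> x \<ominus> z \<in> I n" using idealD(5,6)[OF Ii] x zI s by blast
    ultimately have "r \<in> I n" using saturatedD[OF Is _ zr(2), of a] ac ap by auto
    then show "\<exists>s\<in>carrier R - P. \<exists>z\<in>I (Suc n). \<exists>w\<in>I n. s \<otimes> x = z \<oplus> a \<otimes> w"
      using s zr sx by blast
  qed
  \<comment> \<open>With a denominator \<open>s\<close> outside \<open>p\<close> this says that
    \<open>s y^n\<close> and \<open>r y^(n+1)\<close> agree modulo \<open>q\<close>. Cancelling
    \<open>y^n\<close> puts \<open>s - r y\<close> into \<open>q\<close>, and then \<open>s\<close>
    into \<open>p\<close>.\<close>
  then have "y [^] n \<in> I (Suc n)" using yI by blast
  then obtain s z r where s: "s \<in> carrier R - p" and zr: "z \<in> q" "r \<in> carrier R"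
      "s \<otimes> y [^] n = z \<oplus> r \<otimes> y [^] Suc n" unfolding I_def saturation_def adjoin_def by blast
  have zc: "z \<in> carrier R" using zr primeideal_subset[OF q] by blast
  have "(s \<ominus> r \<otimes> y) \<otimes> y [^] n = s \<otimes> y [^] n \<ominus> r \<otimes> (y [^] n \<otimes> y)"
    using s zr(2) yc nat_pow_closed[OF yc, of n] by (simp; algebra)
  also have "\<dots> = z" using zr(2,3) yc zc nat_pow_closed[OF yc, of n] by (simp; algebra)
  finally have "(s \<ominus> r \<otimes> y) \<otimes> y [^] n \<in> q" using zr(1) by simp
  moreover have "y [^] n \<notin> q"
    using y(2) yc primeideal_one_notin[OF q] by (induction n) (auto dest: primeideal_multD[OF q, rotated 2])
  ultimately have "s \<ominus> r \<otimes> y \<in> q" using primeideal_multD[OF q, of "s \<ominus> r \<otimes> y" "y [^] n"] s zr(2) yc by auto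
  then have "s \<ominus> r \<otimes> y \<in> p" using qp by blast
  moreover have "r \<otimes> y \<in> p" using primeD(6)[OF p zr(2) y(1)] .
  moreover have "s = (s \<ominus> r \<otimes> y) \<oplus> r \<otimes> y" using s zr(2) yc by (simp; algebra)
  ultimately have "s \<in> p" using primeD(3)[OF p] by metis
  then show False using s by blast
qed

text \<open>An element of the top prime can be pushed down to the second prime of the path without
  loss of length; the principal ideal theorem performs the exchange one prime at a time, from the
  top downwards.\<close>

lemma prime_path_through:
  assumes "prime_path R k U Z" "U \<noteq> Z" "a \<in> Z"
  shows "\<exists>Y l. k = Suc l \<and> U \<subset> Y \<and> a \<in> Y \<and> prime_path R l Y Z"
  using assms
proof (induction rule: prime_path.induct)
  case (prime_path_Suc U Y k Z)
  show ?case
  proof (cases "Y = Z")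
    case True
    then show ?thesis using prime_path_Suc prime_path_primes by blast
  next
    case False
    then obtain Y' l where Y': "k = Suc l" "Y \<subset> Y'" "a \<in> Y'" "prime_path R l Y' Z"
      using prime_path_Suc by blast
    have primes: "primeideal U R" "primeideal Y R" "primeideal Y' R"
      using prime_path_Suc Y' prime_path_primes by blast+
    \<comment> \<open>By induction \<open>a\<close> is already in \<open>Y'\<close>, two steps above
      \<open>U\<close>. If \<open>a\<close> is not in \<open>U\<close>, the principal ideal theorem
      shows that \<open>Y'\<close> is not minimal over \<open>U + (a)\<close>, so \<open>Y\<close>
      can be exchanged for a smaller prime through \<open>a\<close>.\<close>
    have "\<exists>W. primeideal W R \<and> U \<subset> W \<and> W \<subset> Y' \<and> a \<in> W"
    proof (cases "a \<in> U")
      case True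
      then show ?thesis using primes prime_path_Suc Y' by blast
    next
      case False
      have "insert a U \<subseteq> Y'" using Y' prime_path_Suc by blast
      then obtain W where W: "minimal_prime_over R (insert a U) W" "W \<subseteq> Y'"
        using minimal_prime_exists[OF primes(3)] by blast
      have "W \<noteq> Y'"
      proof
        assume "W = Y'"
        then have "\<And>N. primeideal N R \<Longrightarrow> U \<subseteq> N \<Longrightarrow> a \<in> N \<Longrightarrow> N \<subseteq> Y' \<Longrightarrow> N = Y'"
          using W unfolding minimal_prime_over_def by blast
        then show False
          using principal_ideal_theorem[OF primes prime_path_Suc.hyps(2) Y'(2,3)] by blast
      qed
      then show ?thesis using W False unfolding minimal_prime_over_def by blast
    qed
    then obtain W where W: "primeideal W R" "U \<subset> W" "W \<subset> Y'" "a \<in> W" by blast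
    then have "prime_path R (Suc l) W Z" using Y'(4) by (intro prime_path.prime_path_Suc)
    then show ?thesis using Y'(1) W by blast
  qed
qed auto

text \<open>Each generator costs one step: after the path is rerouted so that its second prime
  \<open>Y\<close> contains \<open>a\<close>, the prime \<open>P\<close> is still minimal over
  \<open>Y\<close> together with the remaining generators.\<close>

lemma height_theorem:
  assumes "prime_path R k U P" "set as \<subseteq> P"
    and "\<And>N. primeideal N R \<Longrightarrow> U \<subseteq> N \<Longrightarrow> set as \<subseteq> N \<Longrightarrow> N \<subseteq> P \<Longrightarrow> N = P"
  shows "k \<le> length as"
  using assms
proof (induction as arbitrary: U k)
  case Nil
  have "U = P" using Nil(1) Nil(3)[of U] prime_path_primes by fastforce
  then show ?case using Nil prime_path_refl_length by fastforce
next
  case (Cons a as)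
  show ?case
  proof (cases "U = P")
    case True
    then show ?thesis using Cons prime_path_refl_length by fastforce
  next
    case False
    then obtain Y l where Y: "k = Suc l" "U \<subset> Y" "a \<in> Y" "prime_path R l Y P"
      using prime_path_through[OF Cons(2) False, of a] Cons by auto
    have "l \<le> length as"
    proof (rule Cons.IH[OF Y(4)])
      show "set as \<subseteq> P" using Cons.prems(2) by simp
      show "N = P" if "primeideal N R" "Y \<subseteq> N" "set as \<subseteq> N" "N \<subseteq> P" for N
        using Cons.prems(3)[of N] that Y(2,3) by auto
    qed
    then show ?thesis using Y by simp
  qed
qed

end

section \<open>Extensions generated by one element\<close>

text \<open>The elements expressible as polynomials in \<open>x\<close> of degree below
  \<open>k\<close> with coefficients in \<open>A\<close>. Expressions need not be unique, so degree
  is a property of an expression and not of an element.\<close>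

primrec poly_below :: "('a, 'r) ring_scheme \<Rightarrow> 'a set \<Rightarrow> 'a \<Rightarrow> nat \<Rightarrow> 'a set"
  where
    "poly_below B A x 0 = {\<zero>\<^bsub>B\<^esub>}"
  | "poly_below B A x (Suc k) = {a \<otimes>\<^bsub>B\<^esub> x [^]\<^bsub>B\<^esub> k \<oplus>\<^bsub>B\<^esub> f | a f. a \<in> A \<and> f \<in> poly_below B A x k}"

locale subring_element = cring R for R (structure) +
  fixes A :: "'a set" and x :: 'a
  assumes subring: "subring A R" and x_closed: "x \<in> carrier R"
begin

abbreviation "pb \<equiv> poly_below R A x"
abbreviation "base \<equiv> R\<lparr>carrier := A\<rparr>"

lemmas A_simps = subringE[OF subring]

lemma A_closed: "a \<in> A \<Longrightarrow> a \<in> carrier R"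
  using A_simps(1) by blast

lemma base_cring: "cring base"
  using subcringI'[OF subring] subcring_iff[OF A_simps(1)] by blast

lemma pb_closed: "f \<in> pb k \<Longrightarrow> f \<in> carrier R"
  by (induction k arbitrary: f) (auto simp: A_closed x_closed)

lemma pb_zero: "\<zero> \<in> pb k"
proof (induction k)
  case (Suc k)
  have "\<zero> = \<zero> \<otimes> x [^] k \<oplus> \<zero>" using x_closed by simp
  then show ?case using Suc A_simps(2) by fastforce
qed simp

lemma pb_term: "a \<in> A \<Longrightarrow> a \<otimes> x [^] k \<in> pb (Suc k)"
proof -
  assume a: "a \<in> A"
  then have "a \<otimes> x [^] k = a \<otimes> x [^] k \<oplus> \<zero>" using A_closed x_closed by simp
  then show ?thesis using a pb_zero[of k] by auto
qed

lemma pb_SucI: "a \<in> A \<Longrightarrow> f \<in> pb k \<Longrightarrow> a \<otimes> x [^] k \<oplus> f \<in> pb (Suc k)"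
  by auto

lemma pb_Suc: "f \<in> pb k \<Longrightarrow> f \<in> pb (Suc k)"
proof -
  assume f: "f \<in> pb k"
  then have "f = \<zero> \<otimes> x [^] k \<oplus> f" using pb_closed x_closed by simp
  then show ?thesis using f A_simps(2) by auto
qed

lemma pb_mono: "f \<in> pb k \<Longrightarrow> k \<le> l \<Longrightarrow> f \<in> pb l"
proof (induction l)
  case (Suc l)
  then show ?case using pb_Suc[of f l] by (cases "k = Suc l") auto
qed simp

lemma pb_add: "f \<in> pb k \<Longrightarrow> g \<in> pb k \<Longrightarrow> f \<oplus> g \<in> pb k"
proof (induction k arbitrary: f g)
  case (Suc k)
  then obtain a f' b g' where *: "a \<in> A" "f' \<in> pb k" "f = a \<otimes> x [^] k \<oplus> f'"
    "b \<in> A" "g' \<in> pb k" "g = b \<otimes> x [^] k \<oplus> g'" by auto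
  then have c: "a \<in> carrier R" "b \<in> carrier R" "f' \<in> carrier R" "g' \<in> carrier R" "x [^] k \<in> carrier R"
    using A_closed pb_closed x_closed by auto
  have "f \<oplus> g = (a \<oplus> b) \<otimes> x [^] k \<oplus> (f' \<oplus> g')"
    unfolding * using c by algebra
  then show ?case using pb_SucI[OF A_simps(7)[OF *(1,4)] Suc.IH[OF *(2,5)]] by simp
qed simp

lemma pb_scale: "c \<in> A \<Longrightarrow> f \<in> pb k \<Longrightarrow> c \<otimes> f \<in> pb k"
proof (induction k arbitrary: f)
  case 0
  then show ?case using A_closed by simp
next
  case (Suc k)
  then obtain a f' where *: "a \<in> A" "f' \<in> pb k" "f = a \<otimes> x [^] k \<oplus> f'" by auto
  then have cl: "a \<in> carrier R" "c \<in> carrier R" "f' \<in> carrier R" "x [^] k \<in> carrier R"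
    using Suc(2) A_closed pb_closed x_closed by auto
  have "c \<otimes> f = (c \<otimes> a) \<otimes> x [^] k \<oplus> c \<otimes> f'"
    unfolding * using cl by algebra
  then show ?case using pb_SucI[OF A_simps(6)[OF Suc(2) *(1)] Suc.IH[OF Suc(2) *(2)]] by simp
qed

lemma pb_diff: "f \<in> pb k \<Longrightarrow> g \<in> pb k \<Longrightarrow> f \<ominus> g \<in> pb k"
proof -
  assume f: "f \<in> pb k" and g: "g \<in> pb k"
  have "\<ominus> \<one> \<in> A" using A_simps(3,5) by blast
  then have "f \<oplus> (\<ominus> \<one>) \<otimes> g \<in> pb k" using f g pb_add pb_scale by blast
  moreover have "f \<oplus> (\<ominus> \<one>) \<otimes> g = f \<ominus> g" using f g pb_closed[of f k] pb_closed[of g k] by algebra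
  ultimately show ?thesis by simp
qed

lemma pb_shift1: "f \<in> pb k \<Longrightarrow> x \<otimes> f \<in> pb (Suc k)"
proof (induction k arbitrary: f)
  case 0
  then show ?case using x_closed pb_zero[of 1] by simp
next
  case (Suc k)
  then obtain a f' where *: "a \<in> A" "f' \<in> pb k" "f = a \<otimes> x [^] k \<oplus> f'" by auto
  then have cl: "a \<in> carrier R" "f' \<in> carrier R" "x [^] k \<in> carrier R"
    using A_closed pb_closed x_closed by auto
  have "x \<otimes> f = a \<otimes> (x [^] k \<otimes> x) \<oplus> x \<otimes> f'"
    unfolding * using cl x_closed by algebra
  then have "x \<otimes> f = a \<otimes> x [^] Suc k \<oplus> x \<otimes> f'" by simp
  then show ?case using * Suc.IH[OF *(2)] by auto
qed

lemma pb_shift: "f \<in> pb k \<Longrightarrow> x [^] i \<otimes> f \<in> pb (i + k)"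
proof (induction i)
  case 0
  then show ?case using pb_closed by simp
next
  case (Suc i)
  have "x [^] Suc i \<otimes> f = x \<otimes> (x [^] i \<otimes> f)"
    using x_closed pb_closed[OF Suc.prems] by (simp add: m_ac)
  then show ?case using pb_shift1[OF Suc.IH[OF Suc.prems]] by simp
qed

lemma pb_1: "f \<in> pb 1 \<Longrightarrow> f \<in> A"
  using A_closed by auto

lemma pow_A: "c \<in> A \<Longrightarrow> c [^] (e::nat) \<in> A"
  by (induction e) (auto simp: A_simps(3,6))

text \<open>The leading coefficient \<open>d\<close> of \<open>g\<close> need not be invertible, so
  \<open>f\<close> is multiplied by \<open>d\<close> before its leading term is cancelled;
  \<open>e\<close> counts these multiplications.\<close>

lemma pseudo_division:
  assumes g: "g = d \<otimes> x [^] m \<oplus> g'" "d \<in> A" "g' \<in> pb m" and f: "f \<in> pb k"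
  shows "\<exists>(e::nat) h r. h \<in> pb (k - m) \<and> r \<in> pb m \<and> d [^] e \<otimes> f = h \<otimes> g \<oplus> r"
  using f
proof (induction k arbitrary: f)
  case 0
  then have "f = \<zero>" by simp
  then show ?case using g A_closed pb_closed x_closed pb_zero[of m]
    by (intro exI[of _ 0] exI[of _ \<zero>]) auto
next
  case (Suc k)
  have dc: "d \<in> carrier R" "g' \<in> carrier R" "f \<in> carrier R" using g(2,3) Suc(2) A_closed pb_closed by blast+
  then have gc: "g \<in> carrier R" using g(1) x_closed by simp
  show ?case
  proof (cases "k < m")
    case True
    then have "f \<in> pb m" using Suc(2) pb_mono[of f "Suc k" m] by simp
    moreover have "d [^] (0::nat) \<otimes> f = \<zero> \<otimes> g \<oplus> f" using dc gc by simp
    ultimately show ?thesis using pb_zero by blast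
  next
    case False
    then have mk: "m \<le> k" by simp
    obtain c f' where *: "c \<in> A" "f' \<in> pb k" "f = c \<otimes> x [^] k \<oplus> f'" using Suc(2) by auto
    have cc: "c \<in> carrier R" "f' \<in> carrier R" using * A_closed pb_closed by auto
    define y where "y = x [^] (k - m)"
    define z where "z = x [^] m"
    have yz: "y \<in> carrier R" "z \<in> carrier R" and xk: "x [^] k = y \<otimes> z"
      unfolding y_def z_def using x_closed mk by (auto simp: nat_pow_mult)
    define f1 where "f1 = d \<otimes> f' \<ominus> c \<otimes> (y \<otimes> g')"
    have "f1 \<in> pb k" unfolding f1_def
    proof (rule pb_diff)
      show "d \<otimes> f' \<in> pb k" using * g pb_scale by blast
      have "y \<otimes> g' \<in> pb k" using pb_shift[OF g(3), of "k - m"] mk by (simp add: y_def)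
      then show "c \<otimes> (y \<otimes> g') \<in> pb k" using * pb_scale by blast
    qed
    then obtain e h r where IH: "h \<in> pb (k - m)" "r \<in> pb m" "d [^] (e::nat) \<otimes> f1 = h \<otimes> g \<oplus> r"
      using Suc.IH by blast
    define w where "w = d [^] e"
    have wA: "w \<in> A" and wc: "w \<in> carrier R" using pow_A[OF g(2)] A_closed by (auto simp: w_def)
    have hc: "h \<in> carrier R" "r \<in> carrier R" using IH pb_closed by auto
    let ?h = "(w \<otimes> c) \<otimes> y \<oplus> h"
    have f1c: "f1 \<in> carrier R" unfolding f1_def using dc cc yz by simp
    have "d \<otimes> f = (c \<otimes> y) \<otimes> g \<oplus> f1"
      unfolding f1_def *(3) g(1) xk z_def[symmetric] using dc cc yz by algebra
    then have "(w \<otimes> d) \<otimes> f = w \<otimes> ((c \<otimes> y) \<otimes> g \<oplus> f1)"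
      using wc dc by (simp add: m_assoc)
    also have "\<dots> = (w \<otimes> (c \<otimes> y)) \<otimes> g \<oplus> w \<otimes> f1" using wc cc yz gc f1c by algebra
    also have "\<dots> = ?h \<otimes> g \<oplus> r"
      using IH(3) unfolding w_def[symmetric] using wc cc yz gc hc by (simp; algebra)
    finally have "d [^] Suc e \<otimes> f = ?h \<otimes> g \<oplus> r" by (simp add: w_def)
    moreover have "?h \<in> pb (Suc k - m)"
    proof -
      have "(w \<otimes> c) \<otimes> y \<in> pb (Suc (k - m))" unfolding y_def
        using wA *(1) A_simps(6) by (intro pb_term) auto
      then show ?thesis using pb_add[OF _ pb_Suc[OF IH(1)]] mk by (simp add: Suc_diff_le)
    qed
    ultimately show ?thesis using IH(2) by blast
  qed
qed

lemma prime_pow_notin: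
  "primeideal W R \<Longrightarrow> c \<in> carrier R \<Longrightarrow> c \<notin> W \<Longrightarrow> c [^] (e::nat) \<notin> W"
  by (induction e) (auto simp: primeideal_one_notin dest: primeideal_multD[rotated 3])

end

locale one_generator_extension = subring_element +
  assumes generated: "f \<in> carrier R \<Longrightarrow> \<exists>k. f \<in> poly_below R A x k"
begin

text \<open>An element of \<open>W - U\<close> of least degree serves as \<open>f\<close>. If its
  leading coefficient were in \<open>U\<close>, removing the leading term would leave an element of
  \<open>W\<close> of lower degree, hence in \<open>U\<close>, and \<open>f\<close> would be in
  \<open>U\<close> too.\<close>

lemma minimal_degree_difference:
  assumes U: "primeideal U R" and W: "primeideal W R" and UW: "U \<subset> W"
  obtains m c f f' where "f = c \<otimes> x [^] m \<oplus> f'" "c \<in> A" "f' \<in> pb m" "f \<in> W" "f \<notin> U" "c \<notin> U"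
    "\<And>h. h \<in> W \<Longrightarrow> h \<in> pb m \<Longrightarrow> h \<in> U"
proof -
  let ?T = "\<lambda>k. \<exists>f. f \<in> pb k \<and> f \<in> W \<and> f \<notin> U"
  obtain f0 where "f0 \<in> W" "f0 \<notin> U" using UW by blast
  then have ex: "\<exists>k. ?T k" using generated primeideal_subset[OF W] by blast
  define k where "k = (LEAST k. ?T k)"
  have Tk: "?T k" unfolding k_def using LeastI_ex[OF ex] .
  have kmin: "\<And>j. j < k \<Longrightarrow> \<not> ?T j" unfolding k_def using not_less_Least by blast
  obtain f where f: "f \<in> pb k" "f \<in> W" "f \<notin> U" using Tk by blast
  have "k \<noteq> 0" using f primeD(2)[OF U] by (cases k) auto
  then obtain m where k: "k = Suc m" by (cases k) auto
  then obtain c f' where *: "c \<in> A" "f' \<in> pb m" "f = c \<otimes> x [^] m \<oplus> f'" using f(1) by auto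
  have low: "\<And>h. h \<in> W \<Longrightarrow> h \<in> pb m \<Longrightarrow> h \<in> U" using kmin[of m] k by blast
  have cc: "c \<in> carrier R" "f' \<in> carrier R" "x [^] m \<in> carrier R"
    using * A_closed pb_closed x_closed by auto
  have "c \<notin> U"
  proof
    assume "c \<in> U"
    then have cx: "c \<otimes> x [^] m \<in> U" using primeD(7)[OF U cc(3)] by blast
    then have "f \<ominus> c \<otimes> x [^] m \<in> W" using UW f(2) primeD(5)[OF W] by blast
    moreover have "f \<ominus> c \<otimes> x [^] m = f'" unfolding *(3) using cc by algebra
    ultimately have "f' \<in> U" using low *(2) by simp
    then show False using cx f(3) *(3) primeD(3)[OF U] by blast
  qed
  then show thesis using that * f low by blast
qed

text \<open>This reflects that a polynomial ring in one variable over a field has dimension one.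
  Elements \<open>f\<close> of \<open>N2 - N1\<close> and \<open>g\<close> of \<open>N3 - N2\<close>
  of least degrees \<open>m\<close> and \<open>l\<close> are divided by each other; their leading
  coefficients behave like units because \<open>N3\<close> contracts into \<open>N1\<close>.\<close>

lemma no_three_primes_over_one:
  assumes N: "primeideal N1 R" "primeideal N2 R" "primeideal N3 R" "N1 \<subset> N2" "N2 \<subset> N3"
    and sub: "N3 \<inter> A \<subseteq> N1"
  shows False
proof -
  obtain m c f f' where f: "f = c \<otimes> x [^] m \<oplus> f'" "c \<in> A" "f' \<in> pb m" "f \<in> N2" "f \<notin> N1" "c \<notin> N1"
    "\<And>h. h \<in> N2 \<Longrightarrow> h \<in> pb m \<Longrightarrow> h \<in> N1"
    by (rule minimal_degree_difference[OF N(1,2,4)], rule that; assumption)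
  obtain l d g g' where g: "g = d \<otimes> x [^] l \<oplus> g'" "d \<in> A" "g' \<in> pb l" "g \<in> N3" "g \<notin> N2" "d \<notin> N2"
    "\<And>h. h \<in> N3 \<Longrightarrow> h \<in> pb l \<Longrightarrow> h \<in> N2"
    by (rule minimal_degree_difference[OF N(2,3,5)], rule that; assumption)
  have cc: "c \<in> carrier R" "d \<in> carrier R" "f \<in> carrier R" "g \<in> carrier R"
    using f(2,4) g(2,4) A_closed primeideal_subset[OF N(2)] primeideal_subset[OF N(3)] by auto
  have cN: "c \<notin> N2" "d \<notin> N1" using f g sub N by blast+
  have fpb: "f \<in> pb (Suc m)" "g \<in> pb (Suc l)" using f(1-3) g(1-3) by auto
  \<comment> \<open>Otherwise division of \<open>g\<close> by \<open>f\<close> leaves a remainder in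
    \<open>N3\<close> of degree below \<open>l\<close>, hence in \<open>N2\<close>, and a power of
    \<open>c\<close> times \<open>g\<close> would lie in \<open>N2\<close>.\<close>
  have lm: "l < m"
  proof (rule ccontr)
    assume "\<not> l < m"
    then have ml: "m \<le> l" by simp
    obtain e h r where er: "h \<in> pb (Suc l - m)" "r \<in> pb m" "c [^] (e::nat) \<otimes> g = h \<otimes> f \<oplus> r"
      using pseudo_division[OF f(1-3) fpb(2)] by blast
    have hr: "h \<in> carrier R" "r \<in> carrier R" using er pb_closed by auto
    have ce: "c [^] e \<in> carrier R" using cc by simp
    have hf: "h \<otimes> f \<in> N2" using primeD(6)[OF N(2) hr(1) f(4)] .
    have "r = c [^] e \<otimes> g \<ominus> h \<otimes> f" using er(3) hr cc ce by (simp; algebra)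
    moreover have "c [^] e \<otimes> g \<ominus> h \<otimes> f \<in> N3"
      using primeD(5,6)[OF N(3)] hf N(5) g(4) ce by blast
    ultimately have "r \<in> N3" by simp
    then have "r \<in> N2" using g(7)[of r] pb_mono[OF er(2) ml] by blast
    then have "c [^] e \<otimes> g \<in> N2" using er(3) hf primeD(3)[OF N(2)] by simp
    then show False
      using primeideal_multD[OF N(2) ce cc(4)] prime_pow_notin[OF N(2) cc(1) cN(1)] g(5) by blast
  qed
  \<comment> \<open>A positive \<open>l\<close> makes the quotient \<open>h\<close> below have
    degree less than \<open>m\<close>, so that minimality of \<open>f\<close> applies to it.\<close>
  have l0: "l > 0"
  proof (rule ccontr)
    assume "\<not> l > 0"
    then have "g \<in> pb 1" using fpb(2) by (simp del: poly_below.simps)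
    then have "g \<in> A" by (rule pb_1)
    then show False using g(4,5) sub N(4) by blast
  qed
  \<comment> \<open>In the division of \<open>f\<close> by \<open>g\<close>, both the remainder and
    the quotient turn out to lie in \<open>N2\<close> with degree below \<open>m\<close>, hence in
    \<open>N1\<close>. This drags a power of \<open>d\<close> times \<open>f\<close> into
    \<open>N1\<close>.\<close>
  obtain e h r where er: "h \<in> pb (Suc m - l)" "r \<in> pb l" "d [^] (e::nat) \<otimes> f = h \<otimes> g \<oplus> r"
      using pseudo_division[OF g(1-3) fpb(1)] by blast
  have hr: "h \<in> carrier R" "r \<in> carrier R" using er pb_closed by auto
  have de: "d [^] e \<in> carrier R" using cc by simp
  have df: "d [^] e \<otimes> f \<in> N2" using primeD(6)[OF N(2) de f(4)] .
  have hg: "h \<otimes> g \<in> N3" using primeD(6)[OF N(3) hr(1) g(4)] .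
  have "r = d [^] e \<otimes> f \<ominus> h \<otimes> g" using er(3) hr cc de by (simp; algebra)
  moreover have "d [^] e \<otimes> f \<ominus> h \<otimes> g \<in> N3"
    using primeD(5)[OF N(3) _ hg] df N(5) by blast
  ultimately have "r \<in> N3" by simp
  then have "r \<in> N2" using g(7) er(2) by blast
  then have r1: "r \<in> N1" using f(7)[of r] pb_mono[OF er(2)] lm by simp
  have hg2: "h \<otimes> g = d [^] e \<otimes> f \<ominus> r" using er(3) hr cc de by (simp; algebra)
  then have "h \<otimes> g \<in> N2" using primeD(5)[OF N(2) df] r1 N(4) by auto
  then have "h \<in> N2" using primeideal_multD[OF N(2) hr(1) cc(4)] g(5) by blast
  then have "h \<in> N1" using f(7)[of h] pb_mono[OF er(1), of m] l0 by simp
  then have "h \<otimes> g \<in> N1" using primeD(7)[OF N(1)] cc by blast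
  then have "d [^] e \<otimes> f \<in> N1" using er(3) r1 primeD(3)[OF N(1)] by simp
  then show False
    using primeideal_multD[OF N(1) de cc(3)] prime_pow_notin[OF N(1) cc(2) cN(2)] f(5) by blast
qed

lemma contract_prime:
  assumes W: "primeideal W R"
  shows "primeideal (W \<inter> A) base"
proof -
  interpret b: cring base by (rule base_cring)
  show ?thesis
  proof (rule b.primeidealI')
    show "ideal (W \<inter> A) base"
      using primeD[OF W] A_simps by (intro b.idealI') auto
    show "\<one>\<^bsub>base\<^esub> \<notin> W \<inter> A" using primeideal_one_notin[OF W] by simp
    show "u \<in> W \<inter> A \<or> v \<in> W \<inter> A"
      if "u \<in> carrier base" "v \<in> carrier base" "u \<otimes>\<^bsub>base\<^esub> v \<in> W \<inter> A" for u v
      using primeideal_multD[OF W, of u v] that A_closed by auto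
  qed
qed

text \<open>As soon as the contractions differ, the path can be rerouted through an element of \<open>A\<close>
  so that already its first step changes the contraction.\<close>

lemma contract_path:
  assumes "noetherian_cring R" "prime_path R k U W"
  shows "\<exists>l. k \<le> Suc l \<and> prime_path base l (U \<inter> A) (W \<inter> A)"
  using assms(2)
proof (induction k arbitrary: U)
  case 0
  then have "U = W" "primeideal U R" by (auto elim: prime_path.cases)
  then show ?case using prime_path_0[OF contract_prime] by auto
next
  case (Suc k)
  have pr: "primeideal U R" "primeideal W R" "U \<subseteq> W" using prime_path_primes[OF Suc.prems] by auto
  show ?case
  \<comment> \<open>If both ends have the same contraction, there is room for a single step. This is
    the one unit of length that contraction may lose.\<close>
  proof (cases "W \<inter> A \<subseteq> U")
    case True
    then have eq: "U \<inter> A = W \<inter> A" using pr by blast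
    obtain Y where Y: "U \<subset> Y" "prime_path R k Y W" using Suc.prems by (cases rule: prime_path.cases) auto
    have "k = 0"
    proof (rule ccontr)
      assume "k \<noteq> 0"
      then have "Y \<noteq> W" using Y(2) prime_path_refl_length by blast
      then have "Y \<subset> W" "primeideal Y R" using prime_path_primes[OF Y(2)] by auto
      then show False using no_three_primes_over_one[of U Y W] pr Y(1) True by blast
    qed
    then show ?thesis using eq prime_path_0[OF contract_prime[OF pr(2)]] by auto
  next
    case False
    then obtain a where a: "a \<in> W" "a \<in> A" "a \<notin> U" by blast
    then obtain Y where Y: "U \<subset> Y" "a \<in> Y" "prime_path R k Y W"
      using noetherian_cring.prime_path_through[OF assms(1) Suc.prems _ a(1)] by blast
    obtain l where l: "k \<le> Suc l" "prime_path base l (Y \<inter> A) (W \<inter> A)"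
      using Suc.IH[OF Y(3)] by blast
    have "U \<inter> A \<subset> Y \<inter> A" using Y a by blast
    then have "prime_path base (Suc l) (U \<inter> A) (W \<inter> A)"
      using l(2) contract_prime[OF pr(1)] prime_path_Suc by blast
    then show ?thesis using l(1) by (intro exI[of _ "Suc l"]) auto
  qed
qed

section \<open>Leading coefficients and Hilbert's basis theorem\<close>

definition lead_coeffs :: "nat \<Rightarrow> 'a set \<Rightarrow> 'a set"
  where "lead_coeffs k I = {a \<in> A. \<exists>f \<in> pb k. a \<otimes> x [^] k \<oplus> f \<in> I}"

lemma lead_coeffs_ideal:
  assumes I: "ideal I R"
  shows "ideal (lead_coeffs k I) base"
proof -
  interpret b: cring base by (rule base_cring)
  have xk: "x [^] k \<in> carrier R" using x_closed by simp
  show ?thesis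
  proof (rule b.idealI')
    show "lead_coeffs k I \<subseteq> carrier base" by (auto simp: lead_coeffs_def)
    have "\<zero> \<otimes> x [^] k \<oplus> \<zero> \<in> I" using idealD(2)[OF I] xk by simp
    then show "\<zero>\<^bsub>base\<^esub> \<in> lead_coeffs k I"
      using A_simps(2) pb_zero by (auto simp: lead_coeffs_def)
  next
    fix a b assume "a \<in> lead_coeffs k I" "b \<in> lead_coeffs k I"
    then obtain f g where *: "a \<in> A" "b \<in> A" "f \<in> pb k" "g \<in> pb k"
      "a \<otimes> x [^] k \<oplus> f \<in> I" "b \<otimes> x [^] k \<oplus> g \<in> I" by (auto simp: lead_coeffs_def)
    then have "(a \<otimes> x [^] k \<oplus> f) \<oplus> (b \<otimes> x [^] k \<oplus> g) \<in> I" using idealD(3)[OF I] by blast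
    moreover have "(a \<otimes> x [^] k \<oplus> f) \<oplus> (b \<otimes> x [^] k \<oplus> g) = (a \<oplus> b) \<otimes> x [^] k \<oplus> (f \<oplus> g)"
      using * A_closed[of a] A_closed[of b] pb_closed[of f k] pb_closed[of g k] xk by algebra
    ultimately show "a \<oplus>\<^bsub>base\<^esub> b \<in> lead_coeffs k I"
      using * A_simps(7) pb_add by (auto simp: lead_coeffs_def)
  next
    fix r a assume r: "r \<in> carrier base" and "a \<in> lead_coeffs k I"
    then obtain f where *: "r \<in> A" "a \<in> A" "f \<in> pb k" "a \<otimes> x [^] k \<oplus> f \<in> I" by (auto simp: lead_coeffs_def)
    then have "r \<otimes> (a \<otimes> x [^] k \<oplus> f) \<in> I" using idealD(6)[OF I] A_closed by blast
    moreover have "r \<otimes> (a \<otimes> x [^] k \<oplus> f) = (r \<otimes> a) \<otimes> x [^] k \<oplus> r \<otimes> f"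
      using * A_closed[of a] A_closed[of r] pb_closed[of f k] xk by algebra
    ultimately show "r \<otimes>\<^bsub>base\<^esub> a \<in> lead_coeffs k I"
      using * A_simps(6) pb_scale by (auto simp: lead_coeffs_def)
  qed
qed

lemma lead_coeffs_mono: "I \<subseteq> L \<Longrightarrow> lead_coeffs k I \<subseteq> lead_coeffs k L"
  unfolding lead_coeffs_def by blast

lemma lead_coeffs_Suc:
  assumes I: "ideal I R"
  shows "lead_coeffs k I \<subseteq> lead_coeffs (Suc k) I"
proof
  fix a assume "a \<in> lead_coeffs k I"
  then obtain f where *: "a \<in> A" "f \<in> pb k" "a \<otimes> x [^] k \<oplus> f \<in> I" by (auto simp: lead_coeffs_def)
  then have "x \<otimes> (a \<otimes> x [^] k \<oplus> f) \<in> I" using idealD(6)[OF I x_closed] by blast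
  moreover have "x \<otimes> (a \<otimes> x [^] k \<oplus> f) = a \<otimes> (x [^] k \<otimes> x) \<oplus> x \<otimes> f"
    using *(1,2) A_closed[of a] pb_closed[of f k] x_closed nat_pow_closed[OF x_closed, of k] by algebra
  ultimately show "a \<in> lead_coeffs (Suc k) I"
    using *(1) pb_shift1[OF *(2)] by (auto simp: lead_coeffs_def)
qed

lemma lead_coeffs_le: "ideal I R \<Longrightarrow> k \<le> l \<Longrightarrow> lead_coeffs k I \<subseteq> lead_coeffs l I"
proof (induction l)
  case (Suc l)
  then show ?case using lead_coeffs_Suc[of I l] by (cases "k = Suc l") auto
qed simp

text \<open>By induction on the degree: an element of \<open>I\<close> is reduced by an element of
  \<open>L\<close> with the same leading coefficient, and the difference has smaller degree.\<close>

lemma lead_coeffs_determine: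
  assumes L: "ideal L R" and I: "ideal I R" and LI: "L \<subseteq> I"
    and eq: "\<And>k. lead_coeffs k I \<subseteq> lead_coeffs k L"
  shows "I \<subseteq> L"
proof -
  have "f \<in> L" if "f \<in> pb k" "f \<in> I" for k f
    using that
  proof (induction k arbitrary: f)
    case 0
    then show ?case using idealD(2)[OF L] by simp
  next
    case (Suc k)
    then obtain a f' where *: "a \<in> A" "f' \<in> pb k" "f = a \<otimes> x [^] k \<oplus> f'" by auto
    then have "a \<in> lead_coeffs k L" using eq Suc by (auto simp: lead_coeffs_def)
    then obtain g where g: "g \<in> pb k" "a \<otimes> x [^] k \<oplus> g \<in> L" by (auto simp: lead_coeffs_def)
    have c: "a \<in> carrier R" "f' \<in> carrier R" "g \<in> carrier R" "x [^] k \<in> carrier R"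
      using * g A_closed pb_closed x_closed by auto
    have fg: "f' \<ominus> g = f \<ominus> (a \<otimes> x [^] k \<oplus> g)" unfolding *(3) using c by algebra
    then have "f' \<ominus> g \<in> I" using idealD(5)[OF I Suc(3)] g(2) LI by auto
    then have "f' \<ominus> g \<in> L" using Suc.IH pb_diff * g by blast
    moreover have "f = (f' \<ominus> g) \<oplus> (a \<otimes> x [^] k \<oplus> g)" unfolding *(3) using c by algebra
    ultimately show ?case using idealD(3)[OF L] g(2) by simp
  qed
  then show ?thesis using generated idealD(1)[OF I] by blast
qed

text \<open>In a chain \<open>C\<close> one member \<open>I0\<close> attains a leading coefficient
  ideal that is maximal over all degrees and members, say in degree \<open>k0\<close>. Beyond
  \<open>k0\<close> nothing can grow above \<open>I0\<close>, and each of the finitely many smaller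
  degrees is settled by one member \<open>J k\<close>.\<close>

theorem hilbert_basis:
  assumes "noetherian_ring base"
  shows "noetherian_ring R"
proof (rule trivial_ideal_chain_imp_noetherian)
  interpret b: noetherian_cring base
    using assms base_cring by (simp add: noetherian_cring_def)
  fix C assume C: "C \<noteq> {}" "subset.chain {I. ideal I R} C"
  then have Ci: "\<And>I. I \<in> C \<Longrightarrow> ideal I R" and Cc: "\<And>I L. I \<in> C \<Longrightarrow> L \<in> C \<Longrightarrow> I \<subseteq> L \<or> L \<subseteq> I"
    by (auto simp: subset_chain_def)
  let ?G = "{lead_coeffs k I | k I. I \<in> C}"
  have "?G \<noteq> {}" using C(1) by blast
  then obtain G where G: "G \<in> ?G" and Gmax: "\<And>G'. G' \<in> ?G \<Longrightarrow> G \<subseteq> G' \<Longrightarrow> G' = G"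
    by (rule b.maximal_ideal_in_family) (use lead_coeffs_ideal Ci in blast)+
  obtain k0 I0 where I0: "I0 \<in> C" and G0: "G = lead_coeffs k0 I0" using G by blast
  have max0: "lead_coeffs k I = lead_coeffs k0 I0" if "I \<in> C" "lead_coeffs k0 I0 \<subseteq> lead_coeffs k I" for k I
    using Gmax[of "lead_coeffs k I"] that unfolding G0 by blast
  have "\<exists>J\<in>C. \<forall>I\<in>C. lead_coeffs k J \<subseteq> lead_coeffs k I \<longrightarrow> lead_coeffs k I = lead_coeffs k J" for k
  proof -
    have "lead_coeffs k ` C \<noteq> {}" using C(1) by blast
    then obtain G where G: "G \<in> lead_coeffs k ` C" and Gmax: "\<And>G'. G' \<in> lead_coeffs k ` C \<Longrightarrow> G \<subseteq> G' \<Longrightarrow> G' = G"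
      by (rule b.maximal_ideal_in_family) (use lead_coeffs_ideal Ci in blast)+
    obtain J where "J \<in> C" "G = lead_coeffs k J" using G by blast
    then show ?thesis using Gmax by (intro bexI[of _ J]) auto
  qed
  then obtain J where J: "\<And>k. J k \<in> C"
    and maxJ: "\<And>k I. I \<in> C \<Longrightarrow> lead_coeffs k (J k) \<subseteq> lead_coeffs k I \<Longrightarrow> lead_coeffs k I = lead_coeffs k (J k)"
    by metis
  \<comment> \<open>A finite subset of the chain has an upper bound in it; the \<open>L\<close>
    obtained for \<open>k0\<close> will be the largest member of \<open>C\<close>.\<close>
  have "\<exists>L\<in>C. \<forall>I\<in>insert I0 (J ` {..<k}). I \<subseteq> L" for k
  proof (induction k)
    case 0
    then show ?case using I0 by auto
  next
    case (Suc k)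
    then obtain L where L: "L \<in> C" "\<forall>I\<in>insert I0 (J ` {..<k}). I \<subseteq> L" by blast
    show ?case
    proof (cases "L \<subseteq> J k")
      case True
      then show ?thesis using L J[of k] by (intro bexI[of _ "J k"]) (auto simp: lessThan_Suc)
    next
      case False
      then have "J k \<subseteq> L" using Cc J L by blast
      then show ?thesis using L by (intro bexI[of _ L]) (auto simp: lessThan_Suc)
    qed
  qed
  then obtain L where L: "L \<in> C" "I0 \<subseteq> L" "\<And>k. k < k0 \<Longrightarrow> J k \<subseteq> L" by (metis imageI insertCI lessThan_iff)
  have "I \<subseteq> L" if I: "I \<in> C" for I
  proof (rule ccontr)
    assume "\<not> I \<subseteq> L"
    then have LI: "L \<subseteq> I" using Cc I L(1) by blast
    have "lead_coeffs k I \<subseteq> lead_coeffs k L" for k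
    proof (cases "k < k0")
      case True
      then have "lead_coeffs k (J k) \<subseteq> lead_coeffs k L" "lead_coeffs k L \<subseteq> lead_coeffs k I"
        using L(3) LI lead_coeffs_mono by auto
      then show ?thesis using maxJ[OF I] by blast
    next
      case False
      then have "lead_coeffs k0 I0 \<subseteq> lead_coeffs k I0" using lead_coeffs_le Ci I0 by simp
      moreover have "lead_coeffs k I0 \<subseteq> lead_coeffs k L" "lead_coeffs k L \<subseteq> lead_coeffs k I"
        using L(2) LI lead_coeffs_mono by auto
      ultimately show ?thesis using max0[OF I] by blast
    qed
    then show False using lead_coeffs_determine[OF Ci[OF L(1)] Ci[OF I] LI] \<open>\<not> I \<subseteq> L\<close> by blast
  qed
  then have "\<Union>C = L" using L(1) by blast
  then show "\<Union>C \<in> C" using L(1) by simp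
qed

end

section \<open>Polynomial rings\<close>

lemma finite_submultisets: "finite {k. k \<subseteq># m}"
proof (induction m)
  case (add i m)
  have "{k. k \<subseteq># add_mset i m} \<subseteq> {k. k \<subseteq># m} \<union> add_mset i ` {k. k \<subseteq># m}"
  proof
    fix k assume "k \<in> {k. k \<subseteq># add_mset i m}"
    then have k: "k \<subseteq># add_mset i m" by simp
    show "k \<in> {k. k \<subseteq># m} \<union> add_mset i ` {k. k \<subseteq># m}"
    proof (cases "i \<in># k")
      case True
      then obtain k' where "k = add_mset i k'" by (meson mset_add)
      then show ?thesis using k by auto
    next
      case False
      then have "k \<subseteq># m" using k unfolding subseteq_mset_def
        by (metis count_add_mset count_eq_zero_iff zero_le)
      then show ?thesis by simp
    qed
  qed
  then show ?case using add by (meson finite_UnI finite_imageI finite_subset)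
qed simp

lemma (in ring) finsum_in_ideal:
  assumes I: "ideal I R" and "\<And>i. i \<in> F \<Longrightarrow> f i \<in> I"
  shows "finsum R f F \<in> I"
proof (cases "finite F")
  case True
  then show ?thesis using assms(2)
  proof (induction F)
    case (insert i F)
    then have "f \<in> F \<rightarrow> carrier R" "f i \<in> carrier R" using idealD(1)[OF I] by auto
    then show ?case using insert idealD(3)[OF I] by simp
  qed (simp add: idealD(2)[OF I])
qed (simp add: idealD(2)[OF I])

context cring
begin

abbreviation "PR V \<equiv> mpoly_ring R V"

definition pmul :: "('v multiset \<Rightarrow> 'a) \<Rightarrow> ('v multiset \<Rightarrow> 'a) \<Rightarrow> 'v multiset \<Rightarrow> 'a"
  where "pmul p q = (\<lambda>m. \<Oplus>k\<in>{k. k \<subseteq># m}. p k \<otimes> q (m - k))"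

abbreviation "coeff_closed p \<equiv> (\<forall>m. p m \<in> carrier R)"

lemma mpoly_simps:
  "carrier (PR V) = indexed_pset V (carrier R)" "monoid.mult (PR V) = pmul"
  "one (PR V) = indexed_const \<one>" "ring.zero (PR V) = indexed_const \<zero>" "ring.add (PR V) = indexed_padd"
  by (simp_all add: mpoly_ring_def pmul_def fun_eq_iff)

lemma pset_coeff: "p \<in> indexed_pset V (carrier R) \<Longrightarrow> p m \<in> carrier R"
  using indexed_pset_in_carrier[of "carrier R"] carrier_coeffE by blast

lemma mpoly_coeffs: "p \<in> carrier (PR V) \<Longrightarrow> coeff_closed p"
  using pset_coeff[of p V] by (simp add: mpoly_simps)

lemma pmul_coeff: "coeff_closed p \<Longrightarrow> coeff_closed q \<Longrightarrow> pmul p q m \<in> carrier R"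
  unfolding pmul_def by (intro finsum_closed) auto

lemma pmul_comm:
  fixes p q :: "'v multiset \<Rightarrow> 'a"
  assumes "coeff_closed p" "coeff_closed q"
  shows "pmul p q = pmul q p"
proof
  fix m :: "'v multiset"
  have img: "(\<lambda>k. m - k) ` {k. k \<subseteq># m} = {k. k \<subseteq># m}"
  proof
    show "{k. k \<subseteq># m} \<subseteq> (\<lambda>k. m - k) ` {k. k \<subseteq># m}"
    proof
      fix k assume "k \<in> {k. k \<subseteq># m}"
      then have "k = m - (m - k)" "m - k \<subseteq># m" by (auto simp: subset_mset.diff_diff_right)
      then show "k \<in> (\<lambda>k. m - k) ` {k. k \<subseteq># m}" by blast
    qed
  qed auto
  have inj: "inj_on (\<lambda>k. m - k) {k. k \<subseteq># m}"
    by (rule inj_onI) (metis mem_Collect_eq subset_mset.diff_diff_right subset_mset.diff_add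
        add_diff_cancel_left' cancel_ab_semigroup_add_class.add_diff_cancel_left' diff_diff_add
        subset_mset.add_diff_inverse add_right_cancel)
  have "pmul q p m = (\<Oplus>k\<in>(\<lambda>k. m - k) ` {k. k \<subseteq># m}. q k \<otimes> p (m - k))"
    unfolding pmul_def img ..
  also have "\<dots> = (\<Oplus>k\<in>{k. k \<subseteq># m}. q (m - k) \<otimes> p (m - (m - k)))"
    using assms by (intro finsum_reindex inj) auto
  also have "\<dots> = pmul p q m"
    unfolding pmul_def
  proof (rule finsum_cong')
    fix k assume "k \<in> {k. k \<subseteq># m}"
    then have "m - (m - k) = k" by (simp add: subset_mset.diff_diff_right)
    then show "q (m - k) \<otimes> p (m - (m - k)) = p k \<otimes> q (m - k)" using assms by (simp add: m_comm)
  qed (use assms in auto)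
  finally show "pmul p q m = pmul q p m" by simp
qed

lemma pmul_const:
  fixes q :: "'v multiset \<Rightarrow> 'a"
  assumes "a \<in> carrier R" "coeff_closed q"
  shows "pmul (indexed_const a) q = (\<lambda>m. a \<otimes> q m)"
proof
  fix m :: "'v multiset"
  have "(\<Oplus>k\<in>{{#} :: 'v multiset}. a \<otimes> q m) = pmul (indexed_const a) q m"
    unfolding pmul_def
    by (rule add.finprod_mono_neutral_cong_left)
      (use assms finite_submultisets in \<open>auto simp: indexed_const_def\<close>)
  then show "pmul (indexed_const a) q m = a \<otimes> q m" using assms by simp
qed

lemma pmul_padd:
  assumes "coeff_closed p" "coeff_closed q" "coeff_closed r"
  shows "pmul (indexed_padd p q) r = indexed_padd (pmul p r) (pmul q r)"
proof
  fix m
  have "pmul (indexed_padd p q) r m = (\<Oplus>k\<in>{k. k \<subseteq># m}. p k \<otimes> r (m - k) \<oplus> q k \<otimes> r (m - k))"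
    unfolding pmul_def indexed_padd_def using assms by (intro finsum_cong') (auto simp: l_distr)
  also have "\<dots> = pmul p r m \<oplus> pmul q r m" unfolding pmul_def
    using assms by (intro finsum_addf) auto
  finally show "pmul (indexed_padd p q) r m = indexed_padd (pmul p r) (pmul q r) m"
    by (simp add: indexed_padd_def)
qed

text \<open>Submultisets not containing \<open>i\<close> contribute zero on the left, and the others
  correspond to submultisets of \<open>m - {#i#}\<close>.\<close>

lemma pmul_pmult:
  assumes "coeff_closed p" "coeff_closed q"
  shows "pmul (indexed_pmult p i) q = indexed_pmult (pmul p q) i"
proof
  fix m
  show "pmul (indexed_pmult p i) q m = indexed_pmult (pmul p q) i m"
  proof (cases "i \<in># m")
    case False
    then have "\<And>k. k \<subseteq># m \<Longrightarrow> i \<notin># k" by (meson mset_subset_eqD)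
    then have "pmul (indexed_pmult p i) q m = (\<Oplus>k\<in>{k. k \<subseteq># m}. \<zero>)" unfolding pmul_def
      using assms by (intro finsum_cong') (auto simp: indexed_pmult_def)
    then show ?thesis using False by (simp add: indexed_pmult_def)
  next
    case True
    then obtain m' where m: "m = add_mset i m'" by (meson mset_add)
    have "pmul p q m' = (\<Oplus>k\<in>{k. k \<subseteq># m'}. indexed_pmult p i (add_mset i k) \<otimes> q (m - add_mset i k))"
      unfolding pmul_def using assms by (intro finsum_cong') (auto simp: indexed_pmult_def m)
    also have "\<dots> = (\<Oplus>k\<in>add_mset i ` {k. k \<subseteq># m'}. indexed_pmult p i k \<otimes> q (m - k))"
      using assms by (intro finsum_reindex[symmetric]) (auto simp: indexed_pmult_def inj_on_def)
    also have "\<dots> = pmul (indexed_pmult p i) q m" unfolding pmul_def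
    proof (rule add.finprod_mono_neutral_cong_left)
      show "finite {k. k \<subseteq># m}" by (rule finite_submultisets)
      show "add_mset i ` {k. k \<subseteq># m'} \<subseteq> {k. k \<subseteq># m}" by (auto simp: m)
      fix k assume k: "k \<in> {k. k \<subseteq># m} - add_mset i ` {k. k \<subseteq># m'}"
      have "i \<notin># k"
      proof
        assume "i \<in># k"
        then obtain k' where "k = add_mset i k'" by (meson mset_add)
        then show False using k by (auto simp: m)
      qed
      then show "indexed_pmult p i k \<otimes> q (m - k) = \<zero>" using assms by (simp add: indexed_pmult_def)
    qed (use assms in \<open>auto simp: indexed_pmult_def\<close>)
    finally show ?thesis using m by (simp add: indexed_pmult_def)
  qed
qed

lemma pmult_var:
  assumes "coeff_closed p"
  shows "indexed_pmult p i = pmul (indexed_var i) p"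
proof -
  have c: "coeff_closed (indexed_const \<one>)" by (simp add: indexed_const_def)
  have "pmul (indexed_var i) p = indexed_pmult (pmul (indexed_const \<one>) p) i"
    unfolding indexed_var_def using pmul_pmult[OF c assms] by simp
  also have "pmul (indexed_const \<one>) p = p" using pmul_const[of \<one> p] assms by (simp add: fun_eq_iff)
  finally show ?thesis by simp
qed

lemma pset_scale:
  fixes q :: "'c multiset \<Rightarrow> 'a"
  shows "q \<in> indexed_pset V (carrier R) \<Longrightarrow> a \<in> carrier R \<Longrightarrow> (\<lambda>m. a \<otimes> q m) \<in> indexed_pset V (carrier R)"
proof (induction rule: indexed_pset.induct)
  case (indexed_const k)
  then have "(\<lambda>m :: 'c multiset. a \<otimes> indexed_const k m) = indexed_const (a \<otimes> k)"
    by (auto simp: indexed_const_def)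
  moreover have "indexed_const (a \<otimes> k) \<in> indexed_pset V (carrier R)"
    using indexed_const by (intro indexed_pset.indexed_const) simp
  ultimately show ?case by simp
next
  case (indexed_padd p q)
  then have "(\<lambda>m. a \<otimes> indexed_padd p q m) = indexed_padd (\<lambda>m. a \<otimes> p m) (\<lambda>m. a \<otimes> q m)"
    by (auto simp: indexed_padd_def r_distr pset_coeff)
  then show ?case using indexed_padd indexed_pset.indexed_padd by simp
next
  case (indexed_pmult p i)
  then have "(\<lambda>m. a \<otimes> indexed_pmult p i m) = indexed_pmult (\<lambda>m. a \<otimes> p m) i"
    by (auto simp: indexed_pmult_def)
  then show ?case using indexed_pmult indexed_pset.indexed_pmult by simp
qed

lemma pset_pmul:
  "p \<in> indexed_pset V (carrier R) \<Longrightarrow> q \<in> indexed_pset V (carrier R) \<Longrightarrow>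
    pmul p q \<in> indexed_pset V (carrier R)"
proof (induction rule: indexed_pset.induct)
  case (indexed_const k)
  then show ?case using pmul_const[of k q] pset_scale[of q V k] pset_coeff[of q V] by simp
next
  case (indexed_padd p p')
  then show ?case
    using pmul_padd[of p p' q] pset_coeff[of _ V] indexed_pset.indexed_padd[of "pmul p q" V "carrier R"] by simp
next
  case (indexed_pmult p i)
  then show ?case
    using pmul_pmult[of p q i] pset_coeff[of _ V] indexed_pset.indexed_pmult[of "pmul p q" V "carrier R"] by simp
qed

lemma pmul_scale:
  assumes "a \<in> carrier R" "coeff_closed p" "coeff_closed q"
  shows "pmul (\<lambda>m. a \<otimes> p m) q = (\<lambda>m. a \<otimes> pmul p q m)"
proof
  fix m
  have "a \<otimes> pmul p q m = (\<Oplus>k\<in>{k. k \<subseteq># m}. a \<otimes> (p k \<otimes> q (m - k)))"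
    unfolding pmul_def using assms finite_submultisets by (intro finsum_rdistr) auto
  also have "\<dots> = pmul (\<lambda>m. a \<otimes> p m) q m" unfolding pmul_def
    using assms by (intro finsum_cong') (auto simp: m_assoc)
  finally show "pmul (\<lambda>m. a \<otimes> p m) q m = a \<otimes> pmul p q m" by simp
qed

text \<open>Induction on the construction of \<open>p\<close> avoids a triple sum: constants, sums
  and multiplication by a variable each pass through \<open>pmul\<close>.\<close>

lemma pmul_assoc:
  "p \<in> indexed_pset V (carrier R) \<Longrightarrow> coeff_closed q \<Longrightarrow> coeff_closed r \<Longrightarrow>
    pmul (pmul p q) r = pmul p (pmul q r)"
proof (induction rule: indexed_pset.induct)
  case (indexed_const a)
  then show ?case using pmul_coeff[of q r] by (simp add: pmul_const pmul_scale)
next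
  case (indexed_padd p p')
  then have "coeff_closed p" "coeff_closed p'" using pset_coeff by blast+
  then show ?case using indexed_padd by (simp add: pmul_padd pmul_coeff)
next
  case (indexed_pmult p i)
  then have "coeff_closed p" using pset_coeff by blast
  then show ?case using indexed_pmult by (simp add: pmul_pmult pmul_coeff)
qed

lemma mpoly_cring: "cring (PR V)"
proof (rule cringI)
  show "abelian_group (PR V)"
  proof (rule abelian_groupI)
    fix p q r assume p: "p \<in> carrier (PR V)" "q \<in> carrier (PR V)" "r \<in> carrier (PR V)"
    note c = mpoly_coeffs[OF p(1)] mpoly_coeffs[OF p(2)] mpoly_coeffs[OF p(3)]
    show "p \<oplus>\<^bsub>PR V\<^esub> q \<in> carrier (PR V)" using p indexed_pset.indexed_padd by (auto simp: mpoly_simps)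
    show "(p \<oplus>\<^bsub>PR V\<^esub> q) \<oplus>\<^bsub>PR V\<^esub> r = p \<oplus>\<^bsub>PR V\<^esub> (q \<oplus>\<^bsub>PR V\<^esub> r)"
      using c by (simp add: mpoly_simps indexed_padd_def a_assoc)
    show "p \<oplus>\<^bsub>PR V\<^esub> q = q \<oplus>\<^bsub>PR V\<^esub> p" using c by (simp add: mpoly_simps indexed_padd_def a_comm)
    show "\<zero>\<^bsub>PR V\<^esub> \<oplus>\<^bsub>PR V\<^esub> p = p" using c by (simp add: mpoly_simps indexed_padd_def indexed_zero_def)
    have "(\<lambda>m. (\<ominus> \<one>) \<otimes> p m) \<oplus>\<^bsub>PR V\<^esub> p = \<zero>\<^bsub>PR V\<^esub>"
      using c by (simp add: mpoly_simps indexed_padd_def indexed_zero_def l_minus l_neg)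
    then show "\<exists>y\<in>carrier (PR V). y \<oplus>\<^bsub>PR V\<^esub> p = \<zero>\<^bsub>PR V\<^esub>"
      using p pset_scale[of p V "\<ominus> \<one>"] by (intro bexI[of _ "\<lambda>m. (\<ominus> \<one>) \<otimes> p m"]) (auto simp: mpoly_simps)
  next
    show "\<zero>\<^bsub>PR V\<^esub> \<in> carrier (PR V)" using indexed_pset.indexed_const by (auto simp: mpoly_simps)
  qed
  show "comm_monoid (PR V)"
  proof (rule comm_monoidI)
    fix p q r assume p: "p \<in> carrier (PR V)" "q \<in> carrier (PR V)" "r \<in> carrier (PR V)"
    note c = mpoly_coeffs[OF p(1)] mpoly_coeffs[OF p(2)] mpoly_coeffs[OF p(3)]
    show "p \<otimes>\<^bsub>PR V\<^esub> q \<in> carrier (PR V)" using p pset_pmul by (auto simp: mpoly_simps)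
    show "(p \<otimes>\<^bsub>PR V\<^esub> q) \<otimes>\<^bsub>PR V\<^esub> r = p \<otimes>\<^bsub>PR V\<^esub> (q \<otimes>\<^bsub>PR V\<^esub> r)"
      using pmul_assoc p c by (simp add: mpoly_simps)
    show "p \<otimes>\<^bsub>PR V\<^esub> q = q \<otimes>\<^bsub>PR V\<^esub> p" using c pmul_comm by (simp add: mpoly_simps)
    show "\<one>\<^bsub>PR V\<^esub> \<otimes>\<^bsub>PR V\<^esub> p = p" using c pmul_const[of \<one> p] by (simp add: mpoly_simps fun_eq_iff)
  next
    show "\<one>\<^bsub>PR V\<^esub> \<in> carrier (PR V)" using indexed_pset.indexed_const by (auto simp: mpoly_simps)
  qed
  show "(p \<oplus>\<^bsub>PR V\<^esub> q) \<otimes>\<^bsub>PR V\<^esub> r = p \<otimes>\<^bsub>PR V\<^esub> r \<oplus>\<^bsub>PR V\<^esub> q \<otimes>\<^bsub>PR V\<^esub> r"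
    if "p \<in> carrier (PR V)" "q \<in> carrier (PR V)" "r \<in> carrier (PR V)" for p q r
    using pmul_padd[OF mpoly_coeffs[OF that(1)] mpoly_coeffs[OF that(2)] mpoly_coeffs[OF that(3)]] by (simp add: mpoly_simps)
qed

lemma const_closed: "a \<in> carrier R \<Longrightarrow> indexed_const a \<in> carrier (PR V)"
  unfolding mpoly_simps by (rule indexed_pset.indexed_const)

lemma var_closed: "i \<in> V \<Longrightarrow> indexed_var i \<in> carrier (PR V)"
  unfolding indexed_var_def mpoly_simps
  by (intro indexed_pset.indexed_pmult indexed_pset.indexed_const) auto

lemma mpoly_induct [consumes 1, case_names const add var]:
  assumes "p \<in> carrier (PR V)"
    and "\<And>a. a \<in> carrier R \<Longrightarrow> T (indexed_const a)"
    and "\<And>p q. p \<in> carrier (PR V) \<Longrightarrow> q \<in> carrier (PR V) \<Longrightarrow> T p \<Longrightarrow> T q \<Longrightarrow> T (p \<oplus>\<^bsub>PR V\<^esub> q)"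
    and "\<And>p i. p \<in> carrier (PR V) \<Longrightarrow> i \<in> V \<Longrightarrow> T p \<Longrightarrow> T (indexed_var i \<otimes>\<^bsub>PR V\<^esub> p)"
  shows "T p"
  using assms(1) unfolding mpoly_simps
proof (induction rule: indexed_pset.induct)
  case (indexed_pmult p i)
  then have "indexed_pmult p i = indexed_var i \<otimes>\<^bsub>PR V\<^esub> p"
    using pmult_var[of p i] pset_coeff[of p V] by (simp add: mpoly_simps)
  then show ?case using assms(4)[of p i] indexed_pmult by (simp add: mpoly_simps)
qed (use assms(2,3) in \<open>auto simp: mpoly_simps\<close>)

lemma const_hom: "indexed_const \<in> ring_hom R (PR (V :: 'v set))"
proof (rule ring_hom_memI)
  fix a b assume ab: "a \<in> carrier R" "b \<in> carrier R"
  then have "coeff_closed (indexed_const b :: 'v multiset \<Rightarrow> 'a)" by (simp add: indexed_const_def)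
  then show "indexed_const (a \<otimes> b) = indexed_const a \<otimes>\<^bsub>PR V\<^esub> indexed_const b"
    using ab pmul_const[of a "indexed_const b :: 'v multiset \<Rightarrow> 'a"]
    by (auto simp: mpoly_simps) (auto simp: indexed_const_def)
  show "indexed_const (a \<oplus> b) = indexed_const a \<oplus>\<^bsub>PR V\<^esub> indexed_const b"
    by (simp add: mpoly_simps indexed_padd_const)
qed (use const_closed in \<open>auto simp: mpoly_simps\<close>)

lemma finite_support: "p \<in> carrier (PR V) \<Longrightarrow> finite {m. p m \<noteq> \<zero>}"
  unfolding mpoly_simps
proof (induction rule: indexed_pset.induct)
  case (indexed_const k)
  have "{m. indexed_const k m \<noteq> \<zero>} \<subseteq> {{#}}" by (auto simp: indexed_const_def)
  then show ?case using finite_subset by blast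
next
  case (indexed_padd p q)
  have "{m. indexed_padd p q m \<noteq> \<zero>} \<subseteq> {m. p m \<noteq> \<zero>} \<union> {m. q m \<noteq> \<zero>}" by (auto simp: indexed_padd_def)
  then show ?case using indexed_padd finite_subset by blast
next
  case (indexed_pmult p i)
  have "{m. indexed_pmult p i m \<noteq> \<zero>} \<subseteq> add_mset i ` {m. p m \<noteq> \<zero>}"
  proof
    fix m assume "m \<in> {m. indexed_pmult p i m \<noteq> \<zero>}"
    then have "i \<in># m" "p (m - {#i#}) \<noteq> \<zero>" by (auto simp: indexed_pmult_def split: if_splits)
    then show "m \<in> add_mset i ` {m. p m \<noteq> \<zero>}" by (intro image_eqI[of _ _ "m - {#i#}"]) auto
  qed
  then show ?case using indexed_pmult finite_subset by blast
qed

end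

section \<open>Evaluation\<close>

definition mon :: "('b, 's) ring_scheme \<Rightarrow> ('v \<Rightarrow> 'b) \<Rightarrow> 'v multiset \<Rightarrow> 'b"
  where "mon T g m = (\<Otimes>\<^bsub>T\<^esub>i\<in>set_mset m. g i [^]\<^bsub>T\<^esub> count m i)"

definition ev :: "('a, 'r) ring_scheme \<Rightarrow> ('b, 's) ring_scheme \<Rightarrow> ('a \<Rightarrow> 'b) \<Rightarrow> ('v \<Rightarrow> 'b) \<Rightarrow> ('v multiset \<Rightarrow> 'a) \<Rightarrow> 'b"
  where "ev A T h g p = (\<Oplus>\<^bsub>T\<^esub>m\<in>{m. p m \<noteq> \<zero>\<^bsub>A\<^esub>}. h (p m) \<otimes>\<^bsub>T\<^esub> mon T g m)"

text \<open>The function \<open>ev\<close> does not know the set of variables, so \<open>g\<close>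
  has to take values in \<open>T\<close> at every index. Substitutions are therefore given default
  values off the variables.\<close>

locale evaluation = R: cring R + T: cring T for R (structure) and T +
  fixes h g
  assumes h: "h \<in> ring_hom R T" and g: "\<And>i. g i \<in> carrier T"
begin

abbreviation "M \<equiv> mon T g"
abbreviation "E \<equiv> ev R T h g"

sublocale H: ring_hom_cring R T h
  using h R.is_cring T.is_cring by (simp add: ring_hom_cring_def ring_hom_cring_axioms_def)

lemma mon_superset:
  assumes "finite F" "set_mset m \<subseteq> F"
  shows "M m = (\<Otimes>\<^bsub>T\<^esub>i\<in>F. g i [^]\<^bsub>T\<^esub> count m i)"
  unfolding mon_def
  by (rule T.finprod_mono_neutral_cong_left)
    (use assms g not_in_iff in \<open>auto simp: not_in_iff\<close>)

lemma mon_closed: "M m \<in> carrier T"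
  unfolding mon_def using g by (intro T.finprod_closed) auto

lemma mon_empty: "M {#} = \<one>\<^bsub>T\<^esub>"
  by (simp add: mon_def)

lemma mon_add_mset: "M (add_mset i m) = g i \<otimes>\<^bsub>T\<^esub> M m"
proof -
  let ?F = "set_mset m - {i}"
  have ex: "(\<Otimes>\<^bsub>T\<^esub>j\<in>insert i ?F. g j [^]\<^bsub>T\<^esub> count m' j) =
      g i [^]\<^bsub>T\<^esub> count m' i \<otimes>\<^bsub>T\<^esub> (\<Otimes>\<^bsub>T\<^esub>j\<in>?F. g j [^]\<^bsub>T\<^esub> count m' j)" for m'
    using g by (intro T.finprod_insert) auto
  have eq: "(\<Otimes>\<^bsub>T\<^esub>j\<in>?F. g j [^]\<^bsub>T\<^esub> count (add_mset i m) j) = (\<Otimes>\<^bsub>T\<^esub>j\<in>?F. g j [^]\<^bsub>T\<^esub> count m j)"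
    using g by (intro T.finprod_cong') auto
  have cl: "(\<Otimes>\<^bsub>T\<^esub>j\<in>?F. g j [^]\<^bsub>T\<^esub> count m j) \<in> carrier T" using g by (intro T.finprod_closed) auto
  have "M (add_mset i m) = g i [^]\<^bsub>T\<^esub> Suc (count m i) \<otimes>\<^bsub>T\<^esub> (\<Otimes>\<^bsub>T\<^esub>j\<in>?F. g j [^]\<^bsub>T\<^esub> count m j)"
    using mon_superset[of "insert i ?F" "add_mset i m"] ex[of "add_mset i m"] eq by auto
  moreover have "M m = g i [^]\<^bsub>T\<^esub> count m i \<otimes>\<^bsub>T\<^esub> (\<Otimes>\<^bsub>T\<^esub>j\<in>?F. g j [^]\<^bsub>T\<^esub> count m j)"
    using mon_superset[of "insert i ?F" "m"] ex[of m] by auto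
  ultimately show ?thesis using cl g by (simp add: T.m_ac)
qed

lemma ev_superset:
  assumes "finite F" "{m. p m \<noteq> \<zero>} \<subseteq> F" "\<forall>m. p m \<in> carrier R"
  shows "E p = (\<Oplus>\<^bsub>T\<^esub>m\<in>F. h (p m) \<otimes>\<^bsub>T\<^esub> M m)"
  unfolding ev_def
  by (rule T.add.finprod_mono_neutral_cong_left) (use assms mon_closed in auto)

lemma ev_closed:
  assumes "\<forall>m. p m \<in> carrier R"
  shows "E p \<in> carrier T"
  unfolding ev_def using assms mon_closed by (intro T.finsum_closed) auto

lemma ev_const: "a \<in> carrier R \<Longrightarrow> E (R.indexed_const a) = h a"
proof -
  assume a: "a \<in> carrier R"
  then have "E (R.indexed_const a) = (\<Oplus>\<^bsub>T\<^esub>m\<in>{{#}}. h (R.indexed_const a m) \<otimes>\<^bsub>T\<^esub> M m)"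
    by (intro ev_superset) (auto simp: R.indexed_const_def split: if_splits)
  also have "\<dots> = h a" using a by (simp add: R.indexed_const_def mon_empty)
  finally show ?thesis .
qed

lemmas coeffs = R.mpoly_coeffs

lemma ev_add:
  assumes p: "p \<in> carrier (R.PR V)" and q: "q \<in> carrier (R.PR V)"
  shows "E (p \<oplus>\<^bsub>R.PR V\<^esub> q) = E p \<oplus>\<^bsub>T\<^esub> E q"
proof -
  let ?F = "{m. p m \<noteq> \<zero>} \<union> {m. q m \<noteq> \<zero>}"
  have pq: "p \<oplus>\<^bsub>R.PR V\<^esub> q = (\<lambda>m. p m \<oplus> q m)" by (simp add: R.mpoly_simps R.indexed_padd_def)
  have fin: "finite ?F" using R.finite_support assms by blast
  note c = coeffs[OF p] coeffs[OF q]
  have "E (p \<oplus>\<^bsub>R.PR V\<^esub> q) = (\<Oplus>\<^bsub>T\<^esub>m\<in>?F. h (p m \<oplus> q m) \<otimes>\<^bsub>T\<^esub> M m)"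
    unfolding pq using c by (intro ev_superset fin) auto
  also have "\<dots> = (\<Oplus>\<^bsub>T\<^esub>m\<in>?F. h (p m) \<otimes>\<^bsub>T\<^esub> M m \<oplus>\<^bsub>T\<^esub> h (q m) \<otimes>\<^bsub>T\<^esub> M m)"
    using c mon_closed by (intro T.finsum_cong') (auto simp: T.l_distr)
  also have "\<dots> = (\<Oplus>\<^bsub>T\<^esub>m\<in>?F. h (p m) \<otimes>\<^bsub>T\<^esub> M m) \<oplus>\<^bsub>T\<^esub> (\<Oplus>\<^bsub>T\<^esub>m\<in>?F. h (q m) \<otimes>\<^bsub>T\<^esub> M m)"
    using c mon_closed by (intro T.finsum_addf) auto
  also have "\<dots> = E p \<oplus>\<^bsub>T\<^esub> E q"
    using ev_superset[of ?F p] ev_superset[of ?F q] fin c by simp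
  finally show ?thesis .
qed

lemma ev_pmult:
  assumes p: "p \<in> carrier (R.PR V)"
  shows "E (R.indexed_pmult p i) = g i \<otimes>\<^bsub>T\<^esub> E p"
proof -
  let ?F = "{m. p m \<noteq> \<zero>}"
  note c = coeffs[OF p]
  have fin: "finite ?F" using R.finite_support p by blast
  have "{m. R.indexed_pmult p i m \<noteq> \<zero>} \<subseteq> add_mset i ` ?F"
  proof
    fix m assume "m \<in> {m. R.indexed_pmult p i m \<noteq> \<zero>}"
    then have "i \<in># m" "p (m - {#i#}) \<noteq> \<zero>" by (auto simp: R.indexed_pmult_def split: if_splits)
    then show "m \<in> add_mset i ` {m. p m \<noteq> \<zero>}" by (intro image_eqI[of _ _ "m - {#i#}"]) auto
  qed
  then have "E (R.indexed_pmult p i) = (\<Oplus>\<^bsub>T\<^esub>m\<in>add_mset i ` ?F. h (R.indexed_pmult p i m) \<otimes>\<^bsub>T\<^esub> M m)"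
    using c fin by (intro ev_superset) (auto simp: R.indexed_pmult_def)
  also have "\<dots> = (\<Oplus>\<^bsub>T\<^esub>m\<in>?F. h (R.indexed_pmult p i (add_mset i m)) \<otimes>\<^bsub>T\<^esub> M (add_mset i m))"
    using c mon_closed by (intro T.finsum_reindex) (auto simp: R.indexed_pmult_def inj_on_def)
  also have "\<dots> = (\<Oplus>\<^bsub>T\<^esub>m\<in>?F. g i \<otimes>\<^bsub>T\<^esub> (h (p m) \<otimes>\<^bsub>T\<^esub> M m))"
    using c mon_closed g by (intro T.finsum_cong') (auto simp: R.indexed_pmult_def mon_add_mset T.m_ac)
  also have "\<dots> = g i \<otimes>\<^bsub>T\<^esub> E p"
    unfolding ev_def using c mon_closed g fin by (intro T.finsum_rdistr[symmetric]) auto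
  finally show ?thesis .
qed

lemma ev_var: "E (R.indexed_var i) = g i"
proof -
  have "R.indexed_const \<one> \<in> carrier (R.PR {i})" by (simp add: R.const_closed)
  from ev_pmult[OF this, of i] show ?thesis using ev_const[of \<one>] g by (simp add: R.indexed_var_def)
qed

lemma ev_mult:
  assumes p: "p \<in> carrier (R.PR V)" and q: "q \<in> carrier (R.PR V)"
  shows "E (p \<otimes>\<^bsub>R.PR V\<^esub> q) = E p \<otimes>\<^bsub>T\<^esub> E q"
proof -
  interpret S: cring "R.PR V" by (rule R.mpoly_cring)
  show ?thesis using p
  proof (induction rule: R.mpoly_induct)
    case (const a)
    let ?F = "{m. q m \<noteq> \<zero>}"
    note c = coeffs[OF q]
    have fin: "finite ?F" using R.finite_support q by blast
    have "R.indexed_const a \<otimes>\<^bsub>R.PR V\<^esub> q = (\<lambda>m. a \<otimes> q m)"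
      using const c by (simp add: R.mpoly_simps R.pmul_const)
    moreover have "E (\<lambda>m. a \<otimes> q m) = (\<Oplus>\<^bsub>T\<^esub>m\<in>?F. h (a \<otimes> q m) \<otimes>\<^bsub>T\<^esub> M m)"
      using const c fin by (intro ev_superset) auto
    moreover have "\<dots> = (\<Oplus>\<^bsub>T\<^esub>m\<in>?F. h a \<otimes>\<^bsub>T\<^esub> (h (q m) \<otimes>\<^bsub>T\<^esub> M m))"
      using const c mon_closed by (intro T.finsum_cong') (auto simp: T.m_assoc)
    moreover have "\<dots> = h a \<otimes>\<^bsub>T\<^esub> E q"
      unfolding ev_def using const c mon_closed fin by (intro T.finsum_rdistr[symmetric]) auto
    ultimately show ?case using const by (simp add: ev_const)
  next
    case (add p p')
    then have "(p \<oplus>\<^bsub>R.PR V\<^esub> p') \<otimes>\<^bsub>R.PR V\<^esub> q = p \<otimes>\<^bsub>R.PR V\<^esub> q \<oplus>\<^bsub>R.PR V\<^esub> p' \<otimes>\<^bsub>R.PR V\<^esub> q"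
      using q by (simp add: S.l_distr)
    then show ?case using add q ev_closed[OF coeffs] by (simp add: ev_add T.l_distr)
  next
    case (var p i)
    have v: "R.indexed_var i \<otimes>\<^bsub>R.PR V\<^esub> r = R.indexed_pmult r i" if "r \<in> carrier (R.PR V)" for r
      using R.pmult_var[OF coeffs[OF that]] by (simp add: R.mpoly_simps)
    have "E ((R.indexed_var i \<otimes>\<^bsub>R.PR V\<^esub> p) \<otimes>\<^bsub>R.PR V\<^esub> q) = E (R.indexed_var i \<otimes>\<^bsub>R.PR V\<^esub> (p \<otimes>\<^bsub>R.PR V\<^esub> q))"
      using S.m_assoc[OF R.var_closed[OF var(2)] var(1) q] by simp
    also have "\<dots> = g i \<otimes>\<^bsub>T\<^esub> E (p \<otimes>\<^bsub>R.PR V\<^esub> q)"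
      using v[of "p \<otimes>\<^bsub>R.PR V\<^esub> q"] ev_pmult[of "p \<otimes>\<^bsub>R.PR V\<^esub> q" V i] S.m_closed[OF var(1) q] by simp
    also have "\<dots> = E (R.indexed_var i \<otimes>\<^bsub>R.PR V\<^esub> p) \<otimes>\<^bsub>T\<^esub> E q"
      using var v[OF var(1)] ev_pmult[OF var(1)] g ev_closed[OF coeffs] q by (simp add: T.m_assoc)
    finally show ?case .
  qed
qed

lemma ev_hom: "E \<in> ring_hom (R.PR V) T"
proof (rule ring_hom_memI)
  show "E \<one>\<^bsub>R.PR V\<^esub> = \<one>\<^bsub>T\<^esub>" using ev_const[of \<one>] by (simp add: R.mpoly_simps)
qed (use ev_closed[OF coeffs] ev_add ev_mult in auto)

end

lemma ring_hom_cring': "h \<in> ring_hom A B \<Longrightarrow> cring A \<Longrightarrow> cring B \<Longrightarrow> ring_hom_cring A B h"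
  by (simp add: ring_hom_cring_def ring_hom_cring_axioms_def)

text \<open>Uniqueness in the universal property of the polynomial ring, relative to an ideal. For
  the zero ideal it gives equality of homomorphisms; for other ideals it handles maps that are
  mutually inverse only modulo relations.\<close>

lemma (in cring) hom_agree_mod:
  assumes B: "cring B" and f: "f \<in> ring_hom (PR V) B" and g: "g \<in> ring_hom (PR V) B"
    and I: "ideal I B"
    and c: "\<And>a. a \<in> carrier R \<Longrightarrow> f (indexed_const a) \<ominus>\<^bsub>B\<^esub> g (indexed_const a) \<in> I"
    and v: "\<And>i. i \<in> V \<Longrightarrow> f (indexed_var i) \<ominus>\<^bsub>B\<^esub> g (indexed_var i) \<in> I"
    and p: "p \<in> carrier (PR V)"
  shows "f p \<ominus>\<^bsub>B\<^esub> g p \<in> I"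
  using p
proof (induction rule: mpoly_induct)
  case (const a)
  then show ?case by (rule c)
next
  case (add p q)
  interpret B: cring B by (rule B)
  have cl: "f p \<in> carrier B" "g p \<in> carrier B" "f q \<in> carrier B" "g q \<in> carrier B"
    using add ring_hom_closed[OF f] ring_hom_closed[OF g] by auto
  have "f (p \<oplus>\<^bsub>PR V\<^esub> q) \<ominus>\<^bsub>B\<^esub> g (p \<oplus>\<^bsub>PR V\<^esub> q) = (f p \<ominus>\<^bsub>B\<^esub> g p) \<oplus>\<^bsub>B\<^esub> (f q \<ominus>\<^bsub>B\<^esub> g q)"
    unfolding ring_hom_add[OF f add(1,2)] ring_hom_add[OF g add(1,2)] using cl by algebra
  then show ?case using add idealD(3)[OF I] by simp
next
  case (var p i)
  interpret B: cring B by (rule B)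
  note vi = var_closed[OF var(2)]
  have cl: "f p \<in> carrier B" "g p \<in> carrier B" "f (indexed_var i) \<in> carrier B" "g (indexed_var i) \<in> carrier B"
    using var vi ring_hom_closed[OF f] ring_hom_closed[OF g] by auto
  have "f (indexed_var i \<otimes>\<^bsub>PR V\<^esub> p) \<ominus>\<^bsub>B\<^esub> g (indexed_var i \<otimes>\<^bsub>PR V\<^esub> p) =
     f (indexed_var i) \<otimes>\<^bsub>B\<^esub> (f p \<ominus>\<^bsub>B\<^esub> g p) \<oplus>\<^bsub>B\<^esub> g p \<otimes>\<^bsub>B\<^esub> (f (indexed_var i) \<ominus>\<^bsub>B\<^esub> g (indexed_var i))"
    unfolding ring_hom_mult[OF f vi var(1)] ring_hom_mult[OF g vi var(1)] using cl by algebra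
  then show ?case using idealD(3,6)[OF I] cl var v by simp
qed

lemma (in cring) hom_eq:
  assumes B: "cring B" and f: "f \<in> ring_hom (PR V) B" and g: "g \<in> ring_hom (PR V) B"
    and c: "\<And>a. a \<in> carrier R \<Longrightarrow> f (indexed_const a) = g (indexed_const a)"
    and v: "\<And>i. i \<in> V \<Longrightarrow> f (indexed_var i) = g (indexed_var i)"
    and p: "p \<in> carrier (PR V)"
  shows "f p = g p"
proof -
  interpret B: cring B by (rule B)
  have cl: "f q \<in> carrier B" "g q \<in> carrier B" if "q \<in> carrier (PR V)" for q
    using that ring_hom_closed[OF f] ring_hom_closed[OF g] by auto
  have "f p \<ominus>\<^bsub>B\<^esub> g p \<in> {\<zero>\<^bsub>B\<^esub>}"
    by (rule hom_agree_mod[OF B f g B.zeroideal _ _ p])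
      (use c v cl[OF const_closed] cl[OF var_closed] in \<open>auto simp: B.r_right_minus_eq\<close>)
  then show ?thesis using cl[OF p] by (simp add: B.r_right_minus_eq)
qed

section \<open>Primes of polynomial rings\<close>

context cring
begin

text \<open>The extended ideal \<open>Q[X]\<close>, described by coefficients so that membership can
  be read off.\<close>

definition coeffs_in :: "'v set \<Rightarrow> 'a set \<Rightarrow> ('v multiset \<Rightarrow> 'a) set"
  where "coeffs_in V Q = {f \<in> carrier (PR V). \<forall>m. f m \<in> Q}"

lemma coeffs_in_ideal:
  assumes Q: "ideal Q R"
  shows "ideal (coeffs_in V Q) (PR V)"
proof -
  interpret S: cring "PR V" by (rule mpoly_cring)
  show ?thesis
  proof (rule S.idealI')
    show "coeffs_in V Q \<subseteq> carrier (PR V)" by (auto simp: coeffs_in_def)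
    show "\<zero>\<^bsub>PR V\<^esub> \<in> coeffs_in V Q"
      using idealD(2)[OF Q] S.zero_closed by (simp add: coeffs_in_def mpoly_simps indexed_zero_def)
    show "f \<oplus>\<^bsub>PR V\<^esub> g \<in> coeffs_in V Q" if "f \<in> coeffs_in V Q" "g \<in> coeffs_in V Q" for f g
      using that idealD(3)[OF Q] S.add.m_closed[of f g]
      by (simp add: coeffs_in_def mpoly_simps indexed_padd_def)
    show "r \<otimes>\<^bsub>PR V\<^esub> f \<in> coeffs_in V Q" if r: "r \<in> carrier (PR V)" and f: "f \<in> coeffs_in V Q" for r f
    proof -
      have "pmul r f m \<in> Q" for m
        unfolding pmul_def
        by (rule finsum_in_ideal[OF Q])
          (use mpoly_coeffs[OF r] f idealD(6)[OF Q] in \<open>auto simp: coeffs_in_def\<close>)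
      then show ?thesis using S.m_closed[of r f] r f by (simp add: coeffs_in_def mpoly_simps)
    qed
  qed
qed

text \<open>If \<open>f\<close> and \<open>g\<close> have coefficients outside \<open>Q\<close>, then modulo \<open>Q\<close> the product of the
  coefficients at the largest such monomials is a coefficient of \<open>f g\<close>.\<close>

lemma coeffs_in_prime:
  fixes V :: "'v :: linorder set"
  assumes Q: "primeideal Q R"
  shows "primeideal (coeffs_in V Q) (PR V)"
proof -
  interpret S: cring "PR V" by (rule mpoly_cring)
  note Qi = primeideal.axioms(1)[OF Q]
  have top: "\<exists>m. f m \<notin> Q \<and> (\<forall>k. m < k \<longrightarrow> f k \<in> Q)"
    if f: "f \<in> carrier (PR V)" "f \<notin> coeffs_in V Q" for f
  proof -
    \<comment> \<open>The multiset extension of the order on the variables is total and compatible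
      with addition, so it serves as a monomial order; finite support provides a largest
      monomial.\<close>
    let ?F = "{m. f m \<notin> Q}"
    have "?F \<subseteq> {m. f m \<noteq> \<zero>}" using idealD(2)[OF Qi] by auto
    then have fin: "finite ?F" using finite_support[OF f(1)] finite_subset by blast
    have ne: "?F \<noteq> {}" using f by (auto simp: coeffs_in_def)
    have "Max ?F \<in> ?F" using Max_in[OF fin ne] .
    moreover have "f k \<in> Q" if "Max ?F < k" for k
      using Max_ge[OF fin, of k] that by fastforce
    ultimately show ?thesis by blast
  qed
  show ?thesis
  proof (rule S.primeidealI')
    show "ideal (coeffs_in V Q) (PR V)" by (rule coeffs_in_ideal[OF Qi])
    show "\<one>\<^bsub>PR V\<^esub> \<notin> coeffs_in V Q"
      using primeideal_one_notin[OF Q] by (auto simp: coeffs_in_def mpoly_simps indexed_const_def)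
    fix f g assume f: "f \<in> carrier (PR V)" and g: "g \<in> carrier (PR V)"
      and fg: "f \<otimes>\<^bsub>PR V\<^esub> g \<in> coeffs_in V Q"
    show "f \<in> coeffs_in V Q \<or> g \<in> coeffs_in V Q"
    proof (rule ccontr)
      assume "\<not> ?thesis"
      then obtain a b where a: "f a \<notin> Q" "\<And>k. a < k \<Longrightarrow> f k \<in> Q"
        and b: "g b \<notin> Q" "\<And>k. b < k \<Longrightarrow> g k \<in> Q"
        using top[OF f] top[OF g] by blast
      note cf = mpoly_coeffs[OF f] and cg = mpoly_coeffs[OF g]
      let ?G = "{k. k \<subseteq># a + b} - {a}"
      let ?t = "\<lambda>k. f k \<otimes> g (a + b - k)"
      have rest: "finsum R ?t ?G \<in> Q"
      proof (rule finsum_in_ideal[OF Qi])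
        fix k assume k: "k \<in> ?G"
        show "?t k \<in> Q"
        proof (cases "a < k")
          case True
          then show ?thesis using a(2) cg idealD(7)[OF Qi] by blast
        next
          case False
          then have ka: "k < a" using k by (auto simp: not_less_iff_gr_or_eq)
          have eq: "k + (a + b - k) = a + b" using k by simp
          \<comment> \<open>If the first factor is below \<open>a\<close>, the second must exceed
            \<open>b\<close>, because their sum is \<open>a + b\<close> and the order is compatible
            with addition.\<close>
          have "b < a + b - k"
          proof (rule ccontr)
            assume "\<not> b < a + b - k"
            then have "k + (a + b - k) < a + b" using add_less_le_mono[OF ka] by (simp add: not_less)
            then show False using eq by simp
          qed
          then show ?thesis using b(2) cf idealD(6)[OF Qi] by blast
        qed
      qed
      have "pmul f g (a + b) = finsum R ?t (insert a ?G)"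
        unfolding pmul_def by (rule finsum_cong') (use cf cg in auto)
      also have "\<dots> = f a \<otimes> g b \<oplus> finsum R ?t ?G"
        using cf cg finite_submultisets by (subst finsum_insert) auto
      finally have "f a \<otimes> g b \<oplus> finsum R ?t ?G \<in> Q"
        using fg by (metis (no_types, lifting) coeffs_in_def mem_Collect_eq mpoly_simps(2))
      then have "(f a \<otimes> g b \<oplus> finsum R ?t ?G) \<ominus> finsum R ?t ?G \<in> Q"
        using rest idealD(5)[OF Qi] by blast
      moreover have "(f a \<otimes> g b \<oplus> finsum R ?t ?G) \<ominus> finsum R ?t ?G = f a \<otimes> g b"
      proof -
        have "finsum R ?t ?G \<in> carrier R" "f a \<in> carrier R" "g b \<in> carrier R"
          using rest idealD(1)[OF Qi] cf cg by auto
        moreover have "(u \<otimes> v \<oplus> w) \<ominus> w = u \<otimes> v"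
          if "w \<in> carrier R" "u \<in> carrier R" "v \<in> carrier R" for u v w
          using that by algebra
        ultimately show ?thesis by blast
      qed
      ultimately show False using primeideal_multD[OF Q] cf cg a(1) b(1) by metis
    qed
  qed
qed

end

section \<open>Substitutions of variables and the primes they define\<close>

definition subst_ev :: "('a, 'r) ring_scheme \<Rightarrow> 'v set \<Rightarrow> ('v \<Rightarrow> 'v multiset \<Rightarrow> 'a) \<Rightarrow>
    ('v multiset \<Rightarrow> 'a) \<Rightarrow> 'v multiset \<Rightarrow> 'a"
  where "subst_ev A V g = ev A (mpoly_ring A V) (ring.indexed_const A) g"

text \<open>The kernel of the map to polynomials over \<open>A/Q\<close> that sends
  \<open>X_i\<close> to the class of \<open>g i\<close>. Constants \<open>g i = b i\<close> give
  \<open>Q + (X_i - b_i)\<close>, and the identity substitution gives \<open>Q[X]\<close>. As a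
  preimage of a prime it is prime for every choice of \<open>g\<close>.\<close>

definition subst_prime :: "('a, 'r) ring_scheme \<Rightarrow> 'v set \<Rightarrow> ('v \<Rightarrow> 'v multiset \<Rightarrow> 'a) \<Rightarrow>
    'a set \<Rightarrow> ('v multiset \<Rightarrow> 'a) set"
  where "subst_prime A V g Q =
    {f \<in> carrier (mpoly_ring A V). subst_ev A V g f \<in> cring.coeffs_in A V Q}"

lemma preimage_prime:
  assumes h: "h \<in> ring_hom A B" and A: "cring A" and B: "cring B" and N: "primeideal N B"
  shows "primeideal {a \<in> carrier A. h a \<in> N} A"
proof -
  interpret ring_hom_cring A B h using ring_hom_cring'[OF h A B] .
  show ?thesis
  proof (rule R.primeidealI')
    show "ideal {a \<in> carrier A. h a \<in> N} A"
      using primeD(2,3,6)[OF N] by (intro R.idealI') auto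
    show "\<one>\<^bsub>A\<^esub> \<notin> {a \<in> carrier A. h a \<in> N}" using primeideal_one_notin[OF N] by simp
  qed (use primeideal_multD[OF N] in auto)
qed

context cring
begin

lemma subst_evaluation:
  assumes "\<And>i. g i \<in> carrier (PR V)"
  shows "evaluation R (PR V) indexed_const g"
  using assms is_cring mpoly_cring[of V] const_hom[of V]
  by (simp add: evaluation_def evaluation_axioms_def)

lemma subst_ev_simps:
  assumes g: "\<And>i. g i \<in> carrier (PR V)"
  shows "subst_ev R V g \<in> ring_hom (PR V) (PR V)"
    "a \<in> carrier R \<Longrightarrow> subst_ev R V g (indexed_const a) = indexed_const a"
    "subst_ev R V g (indexed_var i) = g i"
proof -
  interpret evaluation R "PR V" indexed_const g using subst_evaluation[OF g] .
  show "subst_ev R V g \<in> ring_hom (PR V) (PR V)" unfolding subst_ev_def by (rule ev_hom)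
  show "a \<in> carrier R \<Longrightarrow> subst_ev R V g (indexed_const a) = indexed_const a"
    unfolding subst_ev_def by (rule ev_const)
  show "subst_ev R V g (indexed_var i) = g i" unfolding subst_ev_def by (rule ev_var)
qed

lemma subst_prime_prime:
  fixes V :: "'v :: linorder set"
  assumes "\<And>i. g i \<in> carrier (PR V)" "primeideal Q R"
  shows "primeideal (subst_prime R V g Q) (PR V)"
  unfolding subst_prime_def
  by (rule preimage_prime[OF subst_ev_simps(1)[OF assms(1)] mpoly_cring mpoly_cring coeffs_in_prime[OF assms(2)]])

lemma mem_ideal_if_coeffs:
  assumes g: "\<And>i. g i \<in> carrier (PR V)" and N: "ideal N (PR V)"
    and f: "f \<in> carrier (PR V)" "\<And>m. indexed_const (f m) \<in> N"
  shows "subst_ev R V g f \<in> N"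
proof -
  interpret evaluation R "PR V" indexed_const g using subst_evaluation[OF g] .
  show ?thesis unfolding subst_ev_def ev_def
    by (rule T.finsum_in_ideal[OF N]) (use f idealD(7)[OF N mon_closed] in auto)
qed

lemma const_in_coeffs_in: "ideal Q R \<Longrightarrow> a \<in> Q \<Longrightarrow> indexed_const a \<in> coeffs_in V Q"
  using idealD(1)[of Q R] idealD(2)[of Q R] const_closed[of a V]
  by (auto simp: coeffs_in_def) (auto simp: indexed_const_def)

lemma const_in_coeffs_inD: "indexed_const a \<in> coeffs_in V Q \<Longrightarrow> a \<in> Q"
  by (auto simp: coeffs_in_def indexed_const_def dest: spec[of _ "{#}"])

lemma subst_ev_id:
  assumes g: "\<And>i. g i \<in> carrier (PR V)" and eq: "\<And>i. i \<in> V \<Longrightarrow> g i = indexed_var i"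
    and f: "f \<in> carrier (PR V)"
  shows "subst_ev R V g f = f"
proof -
  have "subst_ev R V g f = id f"
    by (rule hom_eq[OF mpoly_cring subst_ev_simps(1)[OF g] id_ring_hom _ _ f])
      (use subst_ev_simps(2,3)[OF g] eq in auto)
  then show ?thesis by simp
qed

lemma coeffs_in_subset:
  assumes N: "ideal N (PR V)" and Q: "\<And>a. a \<in> Q \<Longrightarrow> indexed_const a \<in> N"
  shows "coeffs_in V Q \<subseteq> N"
proof
  interpret S: cring "PR V" by (rule mpoly_cring)
  fix f assume f: "f \<in> coeffs_in V Q"
  then have fc: "f \<in> carrier (PR V)" by (simp add: coeffs_in_def)
  \<comment> \<open>The identity substitution, with zero as default off \<open>V\<close>; evaluating
    with it displays \<open>f\<close> as the sum of its terms.\<close>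
  define g where "g = (\<lambda>i. if i \<in> V then indexed_var i else \<zero>\<^bsub>PR V\<^esub>)"
  have g: "g i \<in> carrier (PR V)" for i using var_closed by (auto simp: g_def)
  have "subst_ev R V g f \<in> N"
    by (rule mem_ideal_if_coeffs[OF g N fc]) (use f Q in \<open>auto simp: coeffs_in_def\<close>)
  then show "f \<in> N" using subst_ev_id[OF g _ fc] by (simp add: g_def)
qed

text \<open>A substitution \<open>t\<close> keeps coefficients in \<open>Q\<close>, so what
  \<open>g\<close> sends into \<open>Q[X]\<close> is also sent there by \<open>t\<close> after
  \<open>g\<close>. Specialising variables therefore enlarges these primes.\<close>

lemma subst_prime_mono:
  assumes g: "\<And>i. g i \<in> carrier (PR V)" and t: "\<And>i. t i \<in> carrier (PR V)"
    and g': "\<And>i. g' i \<in> carrier (PR V)"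
    and eq: "\<And>i. i \<in> V \<Longrightarrow> subst_ev R V t (g i) = g' i"
    and Q: "ideal Q R"
  shows "subst_prime R V g Q \<subseteq> subst_prime R V g' Q"
proof
  fix f assume "f \<in> subst_prime R V g Q"
  then have f: "f \<in> carrier (PR V)" "subst_ev R V g f \<in> coeffs_in V Q" by (auto simp: subst_prime_def)
  have "(subst_ev R V t \<circ> subst_ev R V g) f = subst_ev R V g' f"
    by (rule hom_eq[OF mpoly_cring ring_hom_trans[OF subst_ev_simps(1)[OF g] subst_ev_simps(1)[OF t]]
          subst_ev_simps(1)[OF g'] _ _ f(1)])
      (use subst_ev_simps(2,3)[OF g] subst_ev_simps(2,3)[OF t] subst_ev_simps(2,3)[OF g'] eq in auto)
  moreover have "subst_ev R V t (subst_ev R V g f) \<in> coeffs_in V Q"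
  proof (rule mem_ideal_if_coeffs[OF t coeffs_in_ideal[OF Q]])
    show "subst_ev R V g f \<in> carrier (PR V)" using f(2) by (simp add: coeffs_in_def)
    show "indexed_const (subst_ev R V g f m) \<in> coeffs_in V Q" for m
      by (rule const_in_coeffs_in[OF Q]) (use f(2) in \<open>auto simp: coeffs_in_def\<close>)
  qed
  ultimately show "f \<in> subst_prime R V g' Q" using f by (simp add: subst_prime_def)
qed

lemma subst_prime_contract:
  assumes g: "\<And>i. g i \<in> carrier (PR V)" and Q: "ideal Q R" and a: "a \<in> carrier R"
  shows "indexed_const a \<in> subst_prime R V g Q \<longleftrightarrow> a \<in> Q"
  using const_in_coeffs_in[OF Q] const_in_coeffs_inD subst_ev_simps(2)[OF g a] const_closed[OF a]
  unfolding subst_prime_def by auto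

lemma var_mem_subst_prime:
  assumes g: "\<And>i. g i \<in> carrier (PR V)" and i: "i \<in> V"
  shows "indexed_var i \<in> subst_prime R V g Q \<longleftrightarrow> g i \<in> coeffs_in V Q"
  using subst_ev_simps(3)[OF g] var_closed[OF i] unfolding subst_prime_def by auto

definition contraction :: "('v multiset \<Rightarrow> 'a) set \<Rightarrow> 'a set"
  where "contraction N = {a \<in> carrier R. indexed_const a \<in> N}"

lemma contraction_prime:
  "primeideal N (PR V) \<Longrightarrow> primeideal (contraction N) R"
  unfolding contraction_def by (rule preimage_prime[OF const_hom is_cring mpoly_cring])

text \<open>The operations of \<open>mpoly_ring R V\<close> are the same for all \<open>V\<close>;
  only the carrier changes. The ring in fewer variables is thus literally a subring, and results on
  \<open>one_generator_extension\<close> apply.\<close>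

lemma mpoly_extension:
  fixes i :: nat
  shows "one_generator_extension (PR {..<Suc i}) (carrier (PR {..<i})) (indexed_var i)"
proof -
  let ?B = "PR {..<Suc i}" let ?A = "carrier (PR {..<i})"
  interpret B: cring ?B by (rule mpoly_cring)
  have sub: "p \<in> carrier ?B" if "p \<in> ?A" for p
    using that
  proof (induction rule: mpoly_induct)
    case (add p q)
    have "p \<oplus>\<^bsub>?B\<^esub> q \<in> carrier ?B" using add by blast
    then show ?case by (simp add: mpoly_simps)
  next
    case (var p j)
    have "indexed_var j \<otimes>\<^bsub>?B\<^esub> p \<in> carrier ?B" using var var_closed[of j "{..<Suc i}"] by auto
    then show ?case by (simp add: mpoly_simps)
  qed (simp add: const_closed)
  have eq: "?B\<lparr>carrier := ?A\<rparr> = PR {..<i}" by (simp add: mpoly_ring_def)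
  have "ring (?B\<lparr>carrier := ?A\<rparr>)" unfolding eq using mpoly_cring cring.axioms(1) by blast
  then have sr: "subring ?A ?B" using sub by (intro B.ring_incl_imp_subring) auto
  have vi: "indexed_var i \<in> carrier ?B" by (rule var_closed) simp
  interpret pre: subring_element ?B ?A "indexed_var i"
    using sr vi mpoly_cring by (simp add: subring_element_def subring_element_axioms_def)
  show ?thesis
  proof unfold_locales
    fix f assume "f \<in> carrier ?B"
    then show "\<exists>k. f \<in> pre.pb k"
    proof (induction rule: mpoly_induct)
      case (const a)
      have "indexed_const a \<otimes>\<^bsub>?B\<^esub> indexed_var i [^]\<^bsub>?B\<^esub> (0::nat) \<in> pre.pb (Suc 0)"
        by (rule pre.pb_term[OF const_closed[OF const]])
      moreover have "indexed_const a \<otimes>\<^bsub>?B\<^esub> indexed_var i [^]\<^bsub>?B\<^esub> (0::nat) = indexed_const a"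
        using const_closed[OF const, of "{..<Suc i}"] by simp
      ultimately show ?case by metis
    next
      case (add p q)
      then obtain k l where "p \<in> pre.pb k" "q \<in> pre.pb l" by blast
      then have "p \<in> pre.pb (max k l)" "q \<in> pre.pb (max k l)" using pre.pb_mono by auto
      then show ?case using pre.pb_add by blast
    next
      case (var p j)
      then obtain k where k: "p \<in> pre.pb k" by blast
      show ?case
      proof (cases "j = i")
        case True
        then show ?thesis using pre.pb_shift1[OF k] by blast
      next
        case False
        then have "indexed_var j \<in> ?A" using var(2) by (intro var_closed) simp
        then show ?thesis using pre.pb_scale[OF _ k] by blast
      qed
    qed
  qed
qed

lemma mpoly_base: "(PR V)\<lparr>carrier := carrier (PR W)\<rparr> = PR W"
  by (simp add: mpoly_ring_def)

end

section \<open>Primes, chains and noetherianity along surjections\<close>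

lemma prime_path_surj_pullback:
  assumes h: "h \<in> ring_hom A B" and A: "cring A" and B: "cring B" and surj: "carrier B \<subseteq> h ` carrier A"
    and p: "prime_path B k U W"
  shows "prime_path A k {a \<in> carrier A. h a \<in> U} {a \<in> carrier A. h a \<in> W}"
  using p
proof (induction rule: prime_path.induct)
  case (prime_path_0 U)
  then show ?case using preimage_prime[OF h A B] by (intro prime_path.prime_path_0)
next
  case (prime_path_Suc U Y k Z)
  have "{a \<in> carrier A. h a \<in> U} \<subset> {a \<in> carrier A. h a \<in> Y}"
  proof -
    have "Y \<subseteq> carrier B" using prime_path_primes[OF prime_path_Suc(3)] primeideal_subset by blast
    then obtain b where "b \<in> Y" "b \<notin> U" "b \<in> carrier B" using prime_path_Suc(2) by blast
    then obtain a where "a \<in> carrier A" "h a \<in> Y" "h a \<notin> U" using surj by blast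
    then show ?thesis using prime_path_Suc(2) by blast
  qed
  then show ?case using prime_path_Suc preimage_prime[OF h A B] by (intro prime_path.prime_path_Suc)
qed

lemma image_prime:
  assumes h: "h \<in> ring_hom A B" and A: "cring A" and B: "cring B" and surj: "carrier B \<subseteq> h ` carrier A"
    and N: "primeideal N A" and ker: "\<And>a. a \<in> carrier A \<Longrightarrow> h a = \<zero>\<^bsub>B\<^esub> \<Longrightarrow> a \<in> N"
  shows "primeideal (h ` N) B" "a \<in> carrier A \<Longrightarrow> h a \<in> h ` N \<longleftrightarrow> a \<in> N"
proof -
  interpret ring_hom_cring A B h using ring_hom_cring'[OF h A B] .
  note Nc = primeideal_subset[OF N]
  have mem: "h a \<in> h ` N \<longleftrightarrow> a \<in> N" if a: "a \<in> carrier A" for a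
  proof
    assume "h a \<in> h ` N"
    then obtain n where n: "n \<in> N" "h a = h n" by blast
    have nc: "n \<in> carrier A" using n Nc by blast
    have "h (a \<ominus>\<^bsub>A\<^esub> n) = \<zero>\<^bsub>B\<^esub>" using a nc n(2) by (simp add: a_minus_def S.r_neg)
    then have "a \<ominus>\<^bsub>A\<^esub> n \<in> N" using ker a nc by simp
    moreover have "a = (a \<ominus>\<^bsub>A\<^esub> n) \<oplus>\<^bsub>A\<^esub> n" using a nc by algebra
    ultimately show "a \<in> N" using primeD(3)[OF N _ n(1)] by metis
  qed blast
  then show "a \<in> carrier A \<Longrightarrow> h a \<in> h ` N \<longleftrightarrow> a \<in> N" .
  show "primeideal (h ` N) B"
  proof (rule S.primeidealI')
    show "ideal (h ` N) B"
    proof (rule S.idealI')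
      show "h ` N \<subseteq> carrier B" using Nc by auto
      show "\<zero>\<^bsub>B\<^esub> \<in> h ` N" using primeD(2)[OF N] hom_zero by (metis imageI)
      show "x \<oplus>\<^bsub>B\<^esub> y \<in> h ` N" if "x \<in> h ` N" "y \<in> h ` N" for x y
      proof -
        obtain u v where uv: "u \<in> N" "v \<in> N" "x = h u" "y = h v" using \<open>x \<in> h ` N\<close> \<open>y \<in> h ` N\<close> by auto
        then have "x \<oplus>\<^bsub>B\<^esub> y = h (u \<oplus>\<^bsub>A\<^esub> v)" using Nc by (simp add: subset_iff)
        then show ?thesis using primeD(3)[OF N uv(1,2)] by blast
      qed
      show "r \<otimes>\<^bsub>B\<^esub> x \<in> h ` N" if r: "r \<in> carrier B" and x: "x \<in> h ` N" for r x
      proof -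
        obtain u v where uv: "u \<in> carrier A" "v \<in> N" "r = h u" "x = h v"
          using subsetD[OF surj r] x by auto
        then have "r \<otimes>\<^bsub>B\<^esub> x = h (u \<otimes>\<^bsub>A\<^esub> v)" using Nc by (simp add: subset_iff)
        then show ?thesis using primeD(6)[OF N uv(1,2)] by blast
      qed
    qed
    show "\<one>\<^bsub>B\<^esub> \<notin> h ` N" using mem[of "\<one>\<^bsub>A\<^esub>"] primeideal_one_notin[OF N] by simp
    fix x y assume xy: "x \<in> carrier B" "y \<in> carrier B" "x \<otimes>\<^bsub>B\<^esub> y \<in> h ` N"
    obtain u v where uv: "u \<in> carrier A" "v \<in> carrier A" "x = h u" "y = h v"
      using subsetD[OF surj xy(1)] subsetD[OF surj xy(2)] by auto
    then have "h (u \<otimes>\<^bsub>A\<^esub> v) \<in> h ` N" using xy(3) by simp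
    then have "u \<otimes>\<^bsub>A\<^esub> v \<in> N" using mem[OF R.m_closed[OF uv(1,2)]] by blast
    then show "x \<in> h ` N \<or> y \<in> h ` N" using primeideal_multD[OF N uv(1,2)] uv by blast
  qed
qed

lemma prime_path_surj_image:
  assumes h: "h \<in> ring_hom A B" and A: "cring A" and B: "cring B" and surj: "carrier B \<subseteq> h ` carrier A"
    and p: "prime_path A k U W"
    and ker: "\<And>a. a \<in> carrier A \<Longrightarrow> h a = \<zero>\<^bsub>B\<^esub> \<Longrightarrow> a \<in> U"
  shows "prime_path B k (h ` U) (h ` W)"
  using p ker
proof (induction rule: prime_path.induct)
  case (prime_path_0 U)
  show ?case using image_prime(1)[OF h A B surj prime_path_0] by (rule prime_path.prime_path_0)
next
  case (prime_path_Suc U Y k Z)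
  have kerY: "\<And>a. a \<in> carrier A \<Longrightarrow> h a = \<zero>\<^bsub>B\<^esub> \<Longrightarrow> a \<in> Y" using prime_path_Suc by blast
  obtain y where y: "y \<in> Y" "y \<notin> U" using prime_path_Suc(2) by blast
  have "y \<in> carrier A" using y prime_path_primes[OF prime_path_Suc(3)] primeideal_subset by blast
  then have "h y \<notin> h ` U" using image_prime(2)[OF h A B surj prime_path_Suc(1,5)] y(2) by blast
  then have "h ` U \<subset> h ` Y" using y(1) prime_path_Suc(2) by blast
  then show ?case using prime_path_Suc.IH[OF kerY] image_prime(1)[OF h A B surj prime_path_Suc(1,5)]
    by (intro prime_path.prime_path_Suc)
qed

lemma noetherian_surj_image:
  assumes h: "h \<in> ring_hom A B" and A: "cring A" "noetherian_ring A" and B: "cring B"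
    and surj: "carrier B \<subseteq> h ` carrier A"
  shows "noetherian_ring B"
proof -
  interpret ring_hom_cring A B h using ring_hom_cring'[OF h A(1) B] .
  interpret A: noetherian_cring A using A by (simp add: noetherian_cring_def)
  let ?pre = "\<lambda>I. {a \<in> carrier A. h a \<in> I}"
  show ?thesis
  proof (rule S.trivial_ideal_chain_imp_noetherian)
    fix C assume C: "C \<noteq> {}" "subset.chain {I. ideal I B} C"
    have pre: "ideal (?pre I) A" if "ideal I B" for I
      using idealD(2,3,6)[OF that] by (intro R.idealI') auto
    have ne: "?pre ` C \<noteq> {}" using C by blast
    have pre_ideal: "ideal I A" if "I \<in> ?pre ` C" for I
      using that pre C(2) by (auto simp: subset_chain_def)
    obtain G where "G \<in> ?pre ` C" and Gmax: "\<And>L. L \<in> ?pre ` C \<Longrightarrow> G \<subseteq> L \<Longrightarrow> L = G"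
      by (rule A.maximal_ideal_in_family[OF ne pre_ideal], assumption, rule that; assumption)
    then obtain J where J: "J \<in> C" "G = ?pre J" by blast
    have "I \<subseteq> J" if I: "I \<in> C" for I
    proof (cases "J \<subseteq> I")
      case True
      then have "?pre I = ?pre J" using Gmax[of "?pre I"] I J(2) by blast
      moreover have "I \<subseteq> carrier B" using I C(2) idealD(1) by (auto simp: subset_chain_def)
      ultimately show ?thesis using surj by blast
    next
      case False
      then show ?thesis using I J(1) C(2) by (auto simp: subset_chain_def)
    qed
    then have "\<Union>C = J" using J(1) by blast
    then show "\<Union>C \<in> C" using J(1) by simp
  qed
qed

context cring
begin

lemma const_surj: "carrier (PR {}) \<subseteq> indexed_const ` carrier R"
proof
  fix f assume "f \<in> carrier (PR {})"
  then show "f \<in> indexed_const ` carrier R"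
  proof (induction rule: mpoly_induct)
    case (add p q)
    then show ?case by (auto simp: mpoly_simps indexed_padd_const)
  qed auto
qed

lemma mpoly_noetherian:
  assumes "noetherian_ring R"
  shows "noetherian_ring (PR {..<n :: nat})"
proof (induction n)
  case 0
  then show ?case using noetherian_surj_image[OF const_hom is_cring assms mpoly_cring const_surj] by simp
next
  case (Suc n)
  interpret E: one_generator_extension "PR {..<Suc n}" "carrier (PR {..<n})" "indexed_var n"
    by (rule mpoly_extension)
  show ?case using E.hilbert_basis Suc by (simp add: mpoly_base)
qed

text \<open>The variables are removed one at a time, each at a cost of at most one step; with no
  variable left, the polynomial ring is a copy of \<open>R\<close>. Keeping track of the endpoints
  makes this a bound on heights and not only on dimensions.\<close>

lemma contraction_path:
  assumes "noetherian_ring R" "prime_path (PR {..<n :: nat}) k U W"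
  shows "\<exists>l. k \<le> l + n \<and> prime_path R l (contraction U) (contraction W)"
  using assms(2)
proof (induction n arbitrary: k U W)
  case 0
  then have "prime_path R k (contraction U) (contraction W)"
    unfolding contraction_def
    using prime_path_surj_pullback[OF const_hom is_cring mpoly_cring const_surj] by simp
  then show ?case by auto
next
  case (Suc n)
  interpret E: one_generator_extension "PR {..<Suc n}" "carrier (PR {..<n})" "indexed_var n"
    by (rule mpoly_extension)
  have "noetherian_cring (PR {..<Suc n})"
    using mpoly_noetherian[OF assms(1)] mpoly_cring by (simp add: noetherian_cring_def)
  then obtain l where l: "k \<le> Suc l"
    "prime_path (PR {..<n}) l (U \<inter> carrier (PR {..<n})) (W \<inter> carrier (PR {..<n}))"
    using E.contract_path[OF _ Suc.prems] by (auto simp: mpoly_base)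
  have con: "contraction (N \<inter> carrier (PR {..<n})) = contraction N" for N
    unfolding contraction_def using const_closed by blast
  show ?case using Suc.IH[OF l(2)] l(1) unfolding con by (metis add_Suc_right le_trans not_less_eq_eq)
qed

end

section \<open>Quotients and catenary rings\<close>

lemma quotient_hom:
  assumes A: "cring A" and I: "ideal I A"
  shows "cring (A Quot I)" "(+>\<^bsub>A\<^esub>) I \<in> ring_hom A (A Quot I)"
    "carrier (A Quot I) \<subseteq> (+>\<^bsub>A\<^esub>) I ` carrier A"
    "a \<in> carrier A \<Longrightarrow> (I +>\<^bsub>A\<^esub> a = \<zero>\<^bsub>A Quot I\<^esub>) \<longleftrightarrow> a \<in> I"
proof -
  interpret cring A by (rule A)
  interpret ideal I A by (rule I)
  show "cring (A Quot I)" by (rule quotient_is_cring[OF A])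
  show "(+>\<^bsub>A\<^esub>) I \<in> ring_hom A (A Quot I)" by (rule rcos_ring_hom)
  show "carrier (A Quot I) \<subseteq> (+>\<^bsub>A\<^esub>) I ` carrier A"
    by (auto simp: FactRing_def A_RCOSETS_def')
  show "a \<in> carrier A \<Longrightarrow> (I +>\<^bsub>A\<^esub> a = \<zero>\<^bsub>A Quot I\<^esub>) \<longleftrightarrow> a \<in> I"
    using a_rcos_zero[OF I, of a] rcos_const_imp_mem[of a] by (auto simp: FactRing_def)
qed

text \<open>A prime strictly between two neighbours could be inserted and would lengthen the
  path.\<close>

lemma maximal_path_saturated:
  assumes "prime_path A k U W" and max: "\<And>l. prime_path A l U W \<Longrightarrow> l \<le> k"
  shows "\<exists>p. saturated_prime_chain A k p \<and> p 0 = U \<and> p k = W"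
proof -
  obtain p where p: "prime_chain A k p" "p 0 = U" "p k = W" using prime_path_imp_chain[OF assms(1)] by blast
  have "\<not> (primeideal P A \<and> p i \<subset> P \<and> P \<subset> p (Suc i))" if i: "i < k" for i P
  proof
    assume P: "primeideal P A \<and> p i \<subset> P \<and> P \<subset> p (Suc i)"
    define q where "q = (\<lambda>j. if j \<le> i then p j else if j = Suc i then P else p (j - 1))"
    have "prime_chain A (Suc k) q"
      unfolding prime_chain_def
    proof (intro conjI allI impI)
      fix j assume "j \<le> Suc k"
      then show "primeideal (q j) A" using p(1) P i by (auto simp: q_def prime_chain_def)
    next
      fix j assume j: "j < Suc k"
      consider "j < i" | "j = i" | "j = Suc i" | "j > Suc i" by linarith
      then show "q j \<subset> q (Suc j)"
      proof cases
        case 4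
        then obtain j' where "j = Suc j'" by (cases j) auto
        then show ?thesis using p(1) 4 j by (auto simp: q_def prime_chain_def)
      qed (use p(1) P i in \<open>auto simp: q_def prime_chain_def\<close>)
    qed
    then have "prime_path A (Suc k) (q 0) (q (Suc k))" by (rule prime_chain_imp_path)
    then have "prime_path A (Suc k) U W" using p i by (simp add: q_def)
    then show False using max by fastforce
  qed
  then show ?thesis using p unfolding saturated_prime_chain_def by blast
qed

lemma saturated_chain_append:
  assumes p: "saturated_prime_chain A k p" and q: "saturated_prime_chain A l q" and eq: "p k = q 0"
  shows "\<exists>r. saturated_prime_chain A (k + l) r \<and> r 0 = p 0 \<and> r (k + l) = q l"
proof -
  define r where "r = (\<lambda>i. if i \<le> k then p i else q (i - k))"
  have rk: "r i = q (i - k)" if "k \<le> i" for i using that eq by (cases "i = k") (auto simp: r_def)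
  have step: "(\<exists>j<k. r i = p j \<and> r (Suc i) = p (Suc j)) \<or> (\<exists>j<l. r i = q j \<and> r (Suc i) = q (Suc j))"
    if "i < k + l" for i
  proof (cases "i < k")
    case True
    then show ?thesis by (auto simp: r_def)
  next
    case False
    then have "r i = q (i - k)" "r (Suc i) = q (Suc (i - k))" using rk[of i] rk[of "Suc i"] by (auto simp: Suc_diff_le)
    then show ?thesis using False that by (intro disjI2 exI[of _ "i - k"]) auto
  qed
  have "saturated_prime_chain A (k + l) r"
    unfolding saturated_prime_chain_def prime_chain_def
  proof (intro conjI allI impI)
    fix i assume "i \<le> k + l"
    then show "primeideal (r i) A" using p q by (auto simp: r_def saturated_prime_chain_def prime_chain_def)
  next
    fix i assume "i < k + l"
    then show "r i \<subset> r (Suc i)" using step[of i] p q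
      unfolding saturated_prime_chain_def prime_chain_def by metis
  next
    fix i assume "i < k + l"
    then show "\<nexists>P. primeideal P A \<and> r i \<subset> P \<and> P \<subset> r (Suc i)" using step[of i] p q
      unfolding saturated_prime_chain_def by metis
  qed
  moreover have "r 0 = p 0" "r (k + l) = q l" using rk[of "k + l"] by (auto simp: r_def)
  ultimately show ?thesis by blast
qed

lemma catenaryD:
  assumes "catenary A" "primeideal P A" "primeideal Q A" "P \<subseteq> Q"
    and "saturated_prime_chain A m p" "p 0 = P" "p m = Q" "saturated_prime_chain A n q" "q 0 = P" "q n = Q"
  shows "m = n"
proof -
  have "\<forall>m n p q. saturated_prime_chain A m p \<longrightarrow> p 0 = P \<longrightarrow> p m = Q \<longrightarrow>
        saturated_prime_chain A n q \<longrightarrow> q 0 = P \<longrightarrow> q n = Q \<longrightarrow> m = n"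
    using assms(1-4) unfolding catenary_def by blast
  then show ?thesis using assms(5-10) by blast
qed

lemma catenary_bound:
  assumes "catenary A" "primeideal P A" "primeideal Q A" "P \<subseteq> Q"
  obtains N where "\<And>n p. prime_chain A n p \<Longrightarrow> p 0 = P \<Longrightarrow> p n = Q \<Longrightarrow> n \<le> N"
  using assms unfolding catenary_def by meson

text \<open>Longest paths exist by the uniform bound contained in \<open>catenary\<close>, and they
  are saturated. The concatenation of longest paths through \<open>Y\<close> and a longest path from
  \<open>U\<close> to \<open>W\<close> are both saturated, so they have equal length.\<close>

lemma catenary_paths:
  assumes cat: "catenary A" and "primeideal U A" "primeideal Y A" "primeideal W A" "U \<subseteq> Y" "Y \<subseteq> W"
  obtains k l where "prime_path A k U Y" "prime_path A l Y W"
    "\<And>m. prime_path A m U W \<Longrightarrow> m \<le> k + l"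
proof -
  have max: "\<exists>k. prime_path A k I J \<and> (\<forall>l. prime_path A l I J \<longrightarrow> l \<le> k)"
    if IJ: "primeideal I A" "primeideal J A" "I \<subseteq> J" for I J
  proof -
    obtain B where B: "\<And>k p. prime_chain A k p \<Longrightarrow> p 0 = I \<Longrightarrow> p k = J \<Longrightarrow> k \<le> B"
      using catenary_bound[OF cat IJ] by blast
    have bound: "\<forall>l. prime_path A l I J \<longrightarrow> l \<le> B" using prime_path_imp_chain B by blast
    have ex: "\<exists>k. prime_path A k I J" using prime_path_le_1 IJ by blast
    show ?thesis using GreatestI_ex_nat[OF ex] Greatest_le_nat[of "\<lambda>k. prime_path A k I J"] bound by blast
  qed
  obtain k where k: "prime_path A k U Y" "\<And>m. prime_path A m U Y \<Longrightarrow> m \<le> k" using max[of U Y] assms by blast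
  obtain l where l: "prime_path A l Y W" "\<And>m. prime_path A m Y W \<Longrightarrow> m \<le> l" using max[of Y W] assms by blast
  obtain n where n: "prime_path A n U W" "\<And>m. prime_path A m U W \<Longrightarrow> m \<le> n" using max[of U W] assms by blast
  obtain p where p: "saturated_prime_chain A k p" "p 0 = U" "p k = Y" using maximal_path_saturated[OF k] by blast
  obtain q where q: "saturated_prime_chain A l q" "q 0 = Y" "q l = W" using maximal_path_saturated[OF l] by blast
  obtain r where r: "saturated_prime_chain A n r" "r 0 = U" "r n = W" using maximal_path_saturated[OF n] by blast
  obtain t where t: "saturated_prime_chain A (k + l) t" "t 0 = U" "t (k + l) = W"
    using saturated_chain_append[OF p(1) q(1)] p q by auto
  have "U \<subseteq> W" using assms by blast
  then have "n = k + l" using catenaryD[OF cat assms(2,4) _ r t] by blast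
  then show thesis using that[OF k(1) l(1)] n(2) by blast
qed

text \<open>Universal catenarity speaks about quotients. The quotient by zero is only isomorphic to
  the ring, so chains and their saturation are transported along the quotient map.\<close>

lemma catenary_if_quotient_zero:
  assumes A: "cring A" and cat: "catenary (A Quot {\<zero>\<^bsub>A\<^esub>})"
  shows "catenary A"
proof -
  interpret cring A by (rule A)
  let ?Z = "{\<zero>\<^bsub>A\<^esub>}" let ?B = "A Quot ?Z"
  note qh = quotient_hom[OF A zeroideal]
  define h where "h = (+>\<^bsub>A\<^esub>) ?Z"
  have h: "h \<in> ring_hom A ?B" "carrier ?B \<subseteq> h ` carrier A" using qh by (auto simp: h_def)
  have ker: "a \<in> N" if "primeideal N A" "a \<in> carrier A" "h a = \<zero>\<^bsub>?B\<^esub>" for a N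
    using qh(4)[OF that(2)] that primeD(2) by (auto simp: h_def)
  have pr: "primeideal (h ` N) ?B" if "primeideal N A" for N
    using image_prime(1)[OF h(1) A qh(1) h(2) that ker[OF that]] .
  have sub: "h ` I \<subseteq> h ` J \<longleftrightarrow> I \<subseteq> J" if "primeideal I A" "primeideal J A" for I J
    using image_prime(2)[OF h(1) A qh(1) h(2) that(2) ker[OF that(2)]] primeideal_subset[OF that(1)] by blast
  have psub: "h ` I \<subset> h ` J \<longleftrightarrow> I \<subset> J" if "primeideal I A" "primeideal J A" for I J
    unfolding less_le_not_le using sub[OF that] sub[OF that(2,1)] by simp
  have pull: "\<exists>N. primeideal N A \<and> W = h ` N" if W: "primeideal W ?B" for W
  proof -
    have "W = h ` {a \<in> carrier A. h a \<in> W}" using primeideal_subset[OF W] h(2) by blast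
    then show ?thesis using preimage_prime[OF h(1) A qh(1) W] by blast
  qed
  have chain: "prime_chain ?B k (\<lambda>i. h ` p i)" if "prime_chain A k p" for k p
    using that pr psub unfolding prime_chain_def by (metis Suc_leI less_imp_le)
  have sat: "saturated_prime_chain ?B k (\<lambda>i. h ` p i)" if p: "saturated_prime_chain A k p" for k p
    unfolding saturated_prime_chain_def
  proof (intro conjI allI impI notI)
    show "prime_chain ?B k (\<lambda>i. h ` p i)" using p chain unfolding saturated_prime_chain_def by blast
    fix i assume i: "i < k" and "\<exists>P. primeideal P ?B \<and> h ` p i \<subset> P \<and> P \<subset> h ` p (Suc i)"
    then obtain N where N: "primeideal N A" "h ` p i \<subset> h ` N" "h ` N \<subset> h ` p (Suc i)" using pull by metis
    have pi: "primeideal (p i) A" "primeideal (p (Suc i)) A"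
      using p i unfolding saturated_prime_chain_def prime_chain_def by auto
    have "p i \<subset> N" "N \<subset> p (Suc i)" using N psub[OF pi(1) N(1)] psub[OF N(1) pi(2)] by auto
    then show False using p i N(1) unfolding saturated_prime_chain_def by blast
  qed
  show ?thesis
    unfolding catenary_def
  proof (intro allI impI conjI)
    fix P Q assume PQ: "primeideal P A" "primeideal Q A" "P \<subseteq> Q"
    then have PQ': "primeideal (h ` P) ?B" "primeideal (h ` Q) ?B" "h ` P \<subseteq> h ` Q" using pr by auto
    obtain B where B: "\<And>k p. prime_chain ?B k p \<Longrightarrow> p 0 = h ` P \<Longrightarrow> p k = h ` Q \<Longrightarrow> k \<le> B"
      using catenary_bound[OF cat PQ'] by blast
    show "\<exists>N. \<forall>n p. prime_chain A n p \<longrightarrow> p 0 = P \<longrightarrow> p n = Q \<longrightarrow> n \<le> N"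
    proof (intro exI allI impI)
      fix n p assume "prime_chain A n p" "p 0 = P" "p n = Q"
      then show "n \<le> B" by (intro B[OF chain[of n p]]) auto
    qed
    fix m n p q
    assume "saturated_prime_chain A m p" "p 0 = P" "p m = Q" "saturated_prime_chain A n q" "q 0 = P" "q n = Q"
    then show "m = n" by (intro catenaryD[OF cat PQ' sat[of m p] _ _ sat[of n q]]) auto
  qed
qed

text \<open>Equidimensionality in terms of chains: a chain witnessing the dimension of
  \<open>B/p\<close> is pulled back to \<open>B\<close>, and its first prime, which contains
  \<open>p\<close>, is replaced by \<open>p\<close>. Length 0 is treated apart because
  \<open>krull_dim\<close> yields chains only from a positive bound.\<close>

lemma equidimensional_path:
  assumes B: "cring B" and eq: "equidimensional B" and p: "minimal_prime_over B {\<zero>\<^bsub>B\<^esub>} p"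
    and path: "prime_path B k U W"
  obtains l V where "k \<le> l" "prime_path B l p V"
proof (cases k)
  case 0
  then show thesis using that[of 0 p] p by (auto simp: minimal_prime_over_def intro: prime_path_0)
next
  case (Suc k')
  have pp: "primeideal p B" using p by (simp add: minimal_prime_over_def)
  note pi = primeideal.axioms(1)[OF pp]
  note qh = quotient_hom[OF B pi]
  have "enat (Suc k') \<le> krull_dim (B Quot p)"
    using eq p krull_dim_path_le[OF path] Suc unfolding equidimensional_def by auto
  then obtain l Y Z where l: "Suc k' \<le> l" "prime_path (B Quot p) l Y Z" using krull_dim_path_exists by blast
  have path': "prime_path B l {a \<in> carrier B. p +>\<^bsub>B\<^esub> a \<in> Y} {a \<in> carrier B. p +>\<^bsub>B\<^esub> a \<in> Z}"
    using prime_path_surj_pullback[OF qh(2) B qh(1,3) l(2)] .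
  have "p \<subseteq> {a \<in> carrier B. p +>\<^bsub>B\<^esub> a \<in> Y}"
  proof
    fix a assume a: "a \<in> p"
    then have "a \<in> carrier B" "p +>\<^bsub>B\<^esub> a = \<zero>\<^bsub>B Quot p\<^esub>" using qh(4) primeideal_subset[OF pp] by auto
    then show "a \<in> {a \<in> carrier B. p +>\<^bsub>B\<^esub> a \<in> Y}"
      using primeD(2)[of Y "B Quot p"] prime_path_primes[OF l(2)] by simp
  qed
  then show thesis using prime_path_shrink_start[OF path' pp] that l(1) Suc by blast
qed

section \<open>Localization\<close>

locale fractions = module R M for R (structure) and M (structure) +
  fixes S :: "'a set"
  assumes S_sub: "S \<subseteq> carrier R" and one_S: "\<one> \<in> S"
    and mult_S: "s \<in> S \<Longrightarrow> t \<in> S \<Longrightarrow> s \<otimes> t \<in> S"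
begin

abbreviation "fr \<equiv> frac R S M"
abbreviation "MS \<equiv> module_of_fractions R S M"

lemma S_closed: "s \<in> S \<Longrightarrow> s \<in> carrier R"
  using S_sub by blast

lemma frac_rel_iff: "((m, s), (m', s')) \<in> frac_rel R S M \<longleftrightarrow>
    m \<in> carrier M \<and> s \<in> S \<and> m' \<in> carrier M \<and> s' \<in> S \<and>
    (\<exists>u\<in>S. (u \<otimes> s') \<odot>\<^bsub>M\<^esub> m = (u \<otimes> s) \<odot>\<^bsub>M\<^esub> m')"
  unfolding frac_rel_def using smult_assoc1 S_closed by (auto; metis)

lemma frac_equiv: "equiv (carrier M \<times> S) (frac_rel R S M)"
proof (rule equivI)
  show "frac_rel R S M \<subseteq> (carrier M \<times> S) \<times> (carrier M \<times> S)"
    by (auto simp: frac_rel_def)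
  show "refl_on (carrier M \<times> S) (frac_rel R S M)"
    using one_S by (auto simp: refl_on_def frac_rel_iff)
  show "sym (frac_rel R S M)"
    by (rule symI) (auto simp: frac_rel_iff, metis)
  show "trans (frac_rel R S M)"
  proof (rule transI)
    fix p q r assume pq: "(p, q) \<in> frac_rel R S M" and qr: "(q, r) \<in> frac_rel R S M"
    obtain m s m' s' m'' s'' where eq: "p = (m, s)" "q = (m', s')" "r = (m'', s'')"
      by (metis surj_pair)
    obtain u where u: "u \<in> S" "(u \<otimes> s') \<odot>\<^bsub>M\<^esub> m = (u \<otimes> s) \<odot>\<^bsub>M\<^esub> m'"
      using pq unfolding eq frac_rel_iff by blast
    obtain v where v: "v \<in> S" "(v \<otimes> s'') \<odot>\<^bsub>M\<^esub> m' = (v \<otimes> s') \<odot>\<^bsub>M\<^esub> m''"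
      using qr unfolding eq frac_rel_iff by blast
    have mem: "m \<in> carrier M" "m' \<in> carrier M" "m'' \<in> carrier M" "s \<in> S" "s' \<in> S" "s'' \<in> S"
      using pq qr unfolding eq frac_rel_iff by auto
    note c = mem S_closed[OF mem(4)] S_closed[OF mem(5)] S_closed[OF mem(6)]
      S_closed[OF u(1)] S_closed[OF v(1)]
    have "((u \<otimes> v \<otimes> s') \<otimes> s'') \<odot>\<^bsub>M\<^esub> m = (v \<otimes> s'') \<odot>\<^bsub>M\<^esub> ((u \<otimes> s') \<odot>\<^bsub>M\<^esub> m)"
      using c by (simp add: smult_assoc1[symmetric] m_ac)
    also have "\<dots> = (u \<otimes> s) \<odot>\<^bsub>M\<^esub> ((v \<otimes> s'') \<odot>\<^bsub>M\<^esub> m')"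
      unfolding u(2) using c by (simp add: smult_assoc1[symmetric] m_ac)
    also have "\<dots> = ((u \<otimes> v \<otimes> s') \<otimes> s) \<odot>\<^bsub>M\<^esub> m''"
      unfolding v(2) using c by (simp add: smult_assoc1[symmetric] m_ac)
    finally have "((u \<otimes> v \<otimes> s') \<otimes> s'') \<odot>\<^bsub>M\<^esub> m = ((u \<otimes> v \<otimes> s') \<otimes> s) \<odot>\<^bsub>M\<^esub> m''" .
    then show "(p, r) \<in> frac_rel R S M"
      unfolding eq frac_rel_iff using mem u v mult_S by blast
  qed
qed

lemma frac_eq_iff:
  assumes "m \<in> carrier M" "s \<in> S" "m' \<in> carrier M" "s' \<in> S"
  shows "fr m s = fr m' s' \<longleftrightarrow> (\<exists>u\<in>S. (u \<otimes> s') \<odot>\<^bsub>M\<^esub> m = (u \<otimes> s) \<odot>\<^bsub>M\<^esub> m')"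
proof -
  have "fr m s = fr m' s' \<longleftrightarrow> ((m, s), (m', s')) \<in> frac_rel R S M"
    unfolding frac_def using eq_equiv_class_iff[OF frac_equiv] assms by auto
  then show ?thesis using assms by (simp add: frac_rel_iff)
qed

lemma frac_eqI:
  "m \<in> carrier M \<Longrightarrow> s \<in> S \<Longrightarrow> m' \<in> carrier M \<Longrightarrow> s' \<in> S \<Longrightarrow>
    s' \<odot>\<^bsub>M\<^esub> m = s \<odot>\<^bsub>M\<^esub> m' \<Longrightarrow> fr m s = fr m' s'"
  using one_S S_closed by (subst frac_eq_iff) (auto intro!: bexI[of _ \<one>])

lemma frac_mem_iff:
  "(m', s') \<in> fr m s \<longleftrightarrow> ((m, s), (m', s')) \<in> frac_rel R S M"
  by (simp add: frac_def)

lemma frac_memD: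
  assumes "(m', s') \<in> fr m s"
  shows "m' \<in> carrier M" "s' \<in> S" "\<exists>u\<in>S. (u \<otimes> s') \<odot>\<^bsub>M\<^esub> m = (u \<otimes> s) \<odot>\<^bsub>M\<^esub> m'"
  using assms unfolding frac_mem_iff frac_rel_iff by auto

lemma frac_self: "m \<in> carrier M \<Longrightarrow> s \<in> S \<Longrightarrow> (m, s) \<in> fr m s"
  unfolding frac_mem_iff frac_rel_iff using one_S by auto

lemma MS_carrier: "carrier MS = {fr m s | m s. m \<in> carrier M \<and> s \<in> S}"
  unfolding module_of_fractions_def Let_def frac_def by (auto simp: quotient_def)

lemma MS_zero: "\<zero>\<^bsub>MS\<^esub> = fr \<zero>\<^bsub>M\<^esub> \<one>"
  by (simp add: module_of_fractions_def Let_def)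

text \<open>Operations on fractions are defined as unions over all representatives. Well-definedness
  says that the family is constant, and then the union is its common value.\<close>

lemma UN_pairs_const:
  assumes "p \<in> U" "q \<in> W" "\<And>x s y t. (x, s) \<in> U \<Longrightarrow> (y, t) \<in> W \<Longrightarrow> F x s y t = c"
  shows "(\<Union>(x, s)\<in>U. \<Union>(y, t)\<in>W. F x s y t) = c"
proof (rule SUP_eq_const)
  show "U \<noteq> {}" using assms(1) by blast
  fix p assume p: "p \<in> U"
  have "(\<Union>(y, t)\<in>W. F (fst p) (snd p) y t) = c"
    by (rule SUP_eq_const) (use assms(2,3) p in auto)
  then show "(case p of (x, s) \<Rightarrow> \<Union>(y, t)\<in>W. F x s y t) = c" by (simp add: case_prod_unfold)
qed

lemma MS_add:
  assumes x: "x \<in> carrier M" "s \<in> S" and y: "y \<in> carrier M" "t \<in> S"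
  shows "fr x s \<oplus>\<^bsub>MS\<^esub> fr y t = fr (t \<odot>\<^bsub>M\<^esub> x \<oplus>\<^bsub>M\<^esub> s \<odot>\<^bsub>M\<^esub> y) (s \<otimes> t)"
proof -
  have const: "fr (t' \<odot>\<^bsub>M\<^esub> x' \<oplus>\<^bsub>M\<^esub> s' \<odot>\<^bsub>M\<^esub> y') (s' \<otimes> t') = fr (t \<odot>\<^bsub>M\<^esub> x \<oplus>\<^bsub>M\<^esub> s \<odot>\<^bsub>M\<^esub> y) (s \<otimes> t)"
    if x'm: "(x', s') \<in> fr x s" and y'm: "(y', t') \<in> fr y t" for x' s' y' t'
  proof -
    note x' = frac_memD[OF x'm] and y' = frac_memD[OF y'm]
    obtain u where u: "u \<in> S" "(u \<otimes> s') \<odot>\<^bsub>M\<^esub> x = (u \<otimes> s) \<odot>\<^bsub>M\<^esub> x'" using x' by blast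
    obtain v where v: "v \<in> S" "(v \<otimes> t') \<odot>\<^bsub>M\<^esub> y = (v \<otimes> t) \<odot>\<^bsub>M\<^esub> y'" using y' by blast
    note c = x(1) y(1) x'(1) y'(1) S_closed[OF x(2)] S_closed[OF y(2)] S_closed[OF x'(2)] S_closed[OF y'(2)]
      S_closed[OF u(1)] S_closed[OF v(1)]
    have "((u \<otimes> v) \<otimes> (s \<otimes> t)) \<odot>\<^bsub>M\<^esub> (t' \<odot>\<^bsub>M\<^esub> x' \<oplus>\<^bsub>M\<^esub> s' \<odot>\<^bsub>M\<^esub> y') =
        (v \<otimes> t \<otimes> t') \<odot>\<^bsub>M\<^esub> ((u \<otimes> s) \<odot>\<^bsub>M\<^esub> x') \<oplus>\<^bsub>M\<^esub> (u \<otimes> s \<otimes> s') \<odot>\<^bsub>M\<^esub> ((v \<otimes> t) \<odot>\<^bsub>M\<^esub> y')"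
      using c by (simp add: smult_assoc1[symmetric] smult_r_distr m_ac)
    also have "\<dots> = (v \<otimes> t \<otimes> t') \<odot>\<^bsub>M\<^esub> ((u \<otimes> s') \<odot>\<^bsub>M\<^esub> x) \<oplus>\<^bsub>M\<^esub> (u \<otimes> s \<otimes> s') \<odot>\<^bsub>M\<^esub> ((v \<otimes> t') \<odot>\<^bsub>M\<^esub> y)"
      by (simp only: u(2) v(2))
    also have "\<dots> = ((u \<otimes> v) \<otimes> (s' \<otimes> t')) \<odot>\<^bsub>M\<^esub> (t \<odot>\<^bsub>M\<^esub> x \<oplus>\<^bsub>M\<^esub> s \<odot>\<^bsub>M\<^esub> y)"
      using c by (simp add: smult_assoc1[symmetric] smult_r_distr m_ac)
    finally show ?thesis
      using c x(2) y(2) x'(2) y'(2) mult_S mult_S[OF u(1) v(1)]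
      by (subst frac_eq_iff) auto
  qed
  have eq: "fr x s \<oplus>\<^bsub>MS\<^esub> fr y t =
     (\<Union>(x', s')\<in>fr x s. \<Union>(y', t')\<in>fr y t. fr (t' \<odot>\<^bsub>M\<^esub> x' \<oplus>\<^bsub>M\<^esub> s' \<odot>\<^bsub>M\<^esub> y') (s' \<otimes> t'))"
    by (simp add: module_of_fractions_def Let_def)
  show ?thesis unfolding eq by (rule UN_pairs_const[OF frac_self[OF x] frac_self[OF y] const])
qed

lemma MS_abelian_group: "abelian_group MS"
proof (rule abelian_groupI)
  show "\<zero>\<^bsub>MS\<^esub> \<in> carrier MS" unfolding MS_zero MS_carrier using one_S by blast
  fix X1 Y1 Z1 assume "X1 \<in> carrier MS" "Y1 \<in> carrier MS" "Z1 \<in> carrier MS"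
  then obtain x s y t z w where
    x: "x \<in> carrier M" "s \<in> S" "X1 = fr x s" and y: "y \<in> carrier M" "t \<in> S" "Y1 = fr y t" and
    z: "z \<in> carrier M" "w \<in> S" "Z1 = fr z w" unfolding MS_carrier by blast
  note c = x y z S_closed[OF x(2)] S_closed[OF y(2)] S_closed[OF z(2)]
  show "X1 \<oplus>\<^bsub>MS\<^esub> Y1 \<in> carrier MS"
    unfolding MS_carrier x y MS_add[OF x(1,2) y(1,2)] using c mult_S by blast
  show "(X1 \<oplus>\<^bsub>MS\<^esub> Y1) \<oplus>\<^bsub>MS\<^esub> Z1 = X1 \<oplus>\<^bsub>MS\<^esub> (Y1 \<oplus>\<^bsub>MS\<^esub> Z1)"
    using c mult_S by (simp add: MS_add smult_r_distr smult_assoc1[symmetric] m_ac M.a_ac)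
  show "X1 \<oplus>\<^bsub>MS\<^esub> Y1 = Y1 \<oplus>\<^bsub>MS\<^esub> X1"
    using c by (simp add: MS_add m_comm M.a_comm)
  show "\<zero>\<^bsub>MS\<^esub> \<oplus>\<^bsub>MS\<^esub> X1 = X1"
    using c one_S by (simp add: MS_zero MS_add)
  have "fr (\<ominus>\<^bsub>M\<^esub> x) s \<oplus>\<^bsub>MS\<^esub> fr x s = fr (s \<odot>\<^bsub>M\<^esub> (\<ominus>\<^bsub>M\<^esub> x) \<oplus>\<^bsub>M\<^esub> s \<odot>\<^bsub>M\<^esub> x) (s \<otimes> s)"
    using c by (simp add: MS_add)
  also have "s \<odot>\<^bsub>M\<^esub> (\<ominus>\<^bsub>M\<^esub> x) \<oplus>\<^bsub>M\<^esub> s \<odot>\<^bsub>M\<^esub> x = \<zero>\<^bsub>M\<^esub>"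
    using c by (simp add: smult_r_distr[symmetric] M.l_neg)
  also have "fr \<zero>\<^bsub>M\<^esub> (s \<otimes> s) = \<zero>\<^bsub>MS\<^esub>"
    unfolding MS_zero using c one_S mult_S by (intro frac_eqI) auto
  finally show "\<exists>y\<in>carrier MS. y \<oplus>\<^bsub>MS\<^esub> X1 = \<zero>\<^bsub>MS\<^esub>"
    unfolding x(3) using c by (intro bexI[of _ "fr (\<ominus>\<^bsub>M\<^esub> x) s"]) (auto simp: MS_carrier)
qed

end

lemma abelian_group_cong:
  assumes "abelian_group G" and "carrier H = carrier G" "ring.zero H = ring.zero G" "ring.add H = ring.add G"
  shows "abelian_group H"
proof -
  interpret abelian_group G by fact
  show ?thesis
    by (rule abelian_groupI) (use assms(2-4) a_assoc a_comm l_neg in \<open>auto intro: bexI[of _ "\<ominus>\<^bsub>G\<^esub> _"]\<close>)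
qed

lemma (in cring) ring_as_module: "module R (ring_as_module R)"
proof -
  have "abelian_group (ring_as_module R)"
    by (rule abelian_group_cong[OF is_abelian_group]) (simp_all add: ring_as_module_def)
  then show ?thesis
    by (intro moduleI is_cring) (auto simp: ring_as_module_def l_distr r_distr m_assoc)
qed

locale ring_fractions = cring R for R (structure) +
  fixes S :: "'a set"
  assumes S_sub: "S \<subseteq> carrier R" and one_S: "\<one> \<in> S"
    and mult_S: "s \<in> S \<Longrightarrow> t \<in> S \<Longrightarrow> s \<otimes> t \<in> S"
begin

sublocale F: fractions R "ring_as_module R" S
  using ring_as_module S_sub one_S mult_S
  by (simp add: fractions_def fractions_axioms_def)

abbreviation "RS \<equiv> ring_of_fractions R S"

lemma rm_simps: "carrier (ring_as_module R) = carrier R" "\<zero>\<^bsub>ring_as_module R\<^esub> = \<zero>"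
  "x \<oplus>\<^bsub>ring_as_module R\<^esub> y = x \<oplus> y" "x \<odot>\<^bsub>ring_as_module R\<^esub> y = x \<otimes> y"
  by (simp_all add: ring_as_module_def)

lemma RS_simps:
  "carrier RS = {F.fr a s | a s. a \<in> carrier R \<and> s \<in> S}" "\<zero>\<^bsub>RS\<^esub> = F.fr \<zero> \<one>" "\<one>\<^bsub>RS\<^esub> = F.fr \<one> \<one>"
  "carrier RS = carrier F.MS" "\<zero>\<^bsub>RS\<^esub> = \<zero>\<^bsub>F.MS\<^esub>" "ring.add RS = ring.add F.MS"
  using F.MS_carrier
  by (simp_all add: ring_of_fractions_def module_of_fractions_def Let_def rm_simps)

lemma RS_add:
  assumes "a \<in> carrier R" "s \<in> S" "b \<in> carrier R" "t \<in> S"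
  shows "F.fr a s \<oplus>\<^bsub>RS\<^esub> F.fr b t = F.fr (t \<otimes> a \<oplus> s \<otimes> b) (s \<otimes> t)"
  using F.MS_add[of a s b t] assms by (simp add: RS_simps(6) rm_simps)

end

text \<open>For the module \<open>R\<close> itself, scalar multiplication of fractions is the multiplication of the
  ring of fractions.\<close>

locale module_fractions = fractions R M S + ring_fractions R S
  for R (structure) and M (structure) and S
begin

lemma smult_fractions_const:
  assumes a: "a \<in> carrier R" "s \<in> S" and y: "y \<in> carrier M" "t \<in> S"
  shows "(\<Union>(a', s')\<in>F.fr a s. \<Union>(y', t')\<in>fr y t. fr (a' \<odot>\<^bsub>M\<^esub> y') (s' \<otimes> t')) = fr (a \<odot>\<^bsub>M\<^esub> y) (s \<otimes> t)"
proof (rule UN_pairs_const)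
  show "(a, s) \<in> F.fr a s" "(y, t) \<in> fr y t"
    using F.frac_self frac_self a y by (auto simp: rm_simps)
  fix a' s' y' t' assume a'm: "(a', s') \<in> F.fr a s" and y'm: "(y', t') \<in> fr y t"
  note a' = F.frac_memD[OF a'm, unfolded rm_simps] and y' = frac_memD[OF y'm]
  obtain u where u: "u \<in> S" "(u \<otimes> s') \<otimes> a = (u \<otimes> s) \<otimes> a'" using a' by blast
  obtain v where v: "v \<in> S" "(v \<otimes> t') \<odot>\<^bsub>M\<^esub> y = (v \<otimes> t) \<odot>\<^bsub>M\<^esub> y'" using y' by blast
  note c = a(1) y(1) a'(1) y'(1) S_closed[OF a(2)] S_closed[OF y(2)] S_closed[OF a'(2)] S_closed[OF y'(2)]
      S_closed[OF u(1)] S_closed[OF v(1)]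
  have "((u \<otimes> v) \<otimes> (s \<otimes> t)) \<odot>\<^bsub>M\<^esub> (a' \<odot>\<^bsub>M\<^esub> y') = ((u \<otimes> s) \<otimes> a') \<odot>\<^bsub>M\<^esub> ((v \<otimes> t) \<odot>\<^bsub>M\<^esub> y')"
    using c by (simp add: smult_assoc1[symmetric] m_ac)
  also have "\<dots> = ((u \<otimes> s') \<otimes> a) \<odot>\<^bsub>M\<^esub> ((v \<otimes> t') \<odot>\<^bsub>M\<^esub> y)" by (simp only: u(2) v(2))
  also have "\<dots> = ((u \<otimes> v) \<otimes> (s' \<otimes> t')) \<odot>\<^bsub>M\<^esub> (a \<odot>\<^bsub>M\<^esub> y)"
    using c by (simp add: smult_assoc1[symmetric] m_ac)
  finally show "fr (a' \<odot>\<^bsub>M\<^esub> y') (s' \<otimes> t') = fr (a \<odot>\<^bsub>M\<^esub> y) (s \<otimes> t)"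
    using c a(2) y(2) a'(2) y'(2) F.mult_S F.mult_S[OF u(1) v(1)]
    by (subst frac_eq_iff) auto
qed

lemma MS_smult:
  assumes "a \<in> carrier R" "s \<in> S" "y \<in> carrier M" "t \<in> S"
  shows "F.fr a s \<odot>\<^bsub>MS\<^esub> fr y t = fr (a \<odot>\<^bsub>M\<^esub> y) (s \<otimes> t)"
proof -
  have "F.fr a s \<odot>\<^bsub>MS\<^esub> fr y t =
    (\<Union>(a', s')\<in>F.fr a s. \<Union>(y', t')\<in>fr y t. fr (a' \<odot>\<^bsub>M\<^esub> y') (s' \<otimes> t'))"
    by (simp add: module_of_fractions_def Let_def)
  then show ?thesis using smult_fractions_const[OF assms] by simp
qed

end

context ring_fractions
begin

lemma RS_mult:
  assumes "a \<in> carrier R" "s \<in> S" "b \<in> carrier R" "t \<in> S"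
  shows "F.fr a s \<otimes>\<^bsub>RS\<^esub> F.fr b t = F.fr (a \<otimes> b) (s \<otimes> t)"
proof -
  interpret G: module_fractions R "ring_as_module R" S ..
  have "F.fr a s \<otimes>\<^bsub>RS\<^esub> F.fr b t = (\<Union>(a', s')\<in>F.fr a s. \<Union>(b', t')\<in>F.fr b t. F.fr (a' \<otimes> b') (s' \<otimes> t'))"
    by (simp add: ring_of_fractions_def Let_def)
  then show ?thesis using G.smult_fractions_const[of a s b t] assms by (simp add: rm_simps)
qed

lemmas frac_eqI = F.frac_eqI[unfolded rm_simps]

lemma RS_cring: "cring RS"
proof (rule cringI)
  show "abelian_group RS"
    by (rule abelian_group_cong[OF F.MS_abelian_group RS_simps(4-6)])
  show "comm_monoid RS"
  proof (rule comm_monoidI)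
    show "\<one>\<^bsub>RS\<^esub> \<in> carrier RS" unfolding RS_simps(1-3) using one_S by blast
    fix X1 Y1 Z1 assume "X1 \<in> carrier RS" "Y1 \<in> carrier RS" "Z1 \<in> carrier RS"
    then obtain x s y t z w where
      x: "x \<in> carrier R" "s \<in> S" "X1 = F.fr x s" and y: "y \<in> carrier R" "t \<in> S" "Y1 = F.fr y t" and
      z: "z \<in> carrier R" "w \<in> S" "Z1 = F.fr z w" unfolding RS_simps(1-3) by blast
    note c = x y z F.S_closed[OF x(2)] F.S_closed[OF y(2)] F.S_closed[OF z(2)]
    show "X1 \<otimes>\<^bsub>RS\<^esub> Y1 \<in> carrier RS" unfolding x y RS_mult[OF x(1,2) y(1,2)] RS_simps(1-3) using c mult_S by blast
    show "(X1 \<otimes>\<^bsub>RS\<^esub> Y1) \<otimes>\<^bsub>RS\<^esub> Z1 = X1 \<otimes>\<^bsub>RS\<^esub> (Y1 \<otimes>\<^bsub>RS\<^esub> Z1)"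
      using c mult_S by (simp add: RS_mult m_assoc)
    show "X1 \<otimes>\<^bsub>RS\<^esub> Y1 = Y1 \<otimes>\<^bsub>RS\<^esub> X1" using c by (simp add: RS_mult m_comm)
    show "\<one>\<^bsub>RS\<^esub> \<otimes>\<^bsub>RS\<^esub> X1 = X1" using c one_S by (simp add: RS_mult RS_simps(1-3))
  qed
  fix X1 Y1 Z1 assume "X1 \<in> carrier RS" "Y1 \<in> carrier RS" "Z1 \<in> carrier RS"
  then obtain x s y t z w where
    x: "x \<in> carrier R" "s \<in> S" "X1 = F.fr x s" and y: "y \<in> carrier R" "t \<in> S" "Y1 = F.fr y t" and
    z: "z \<in> carrier R" "w \<in> S" "Z1 = F.fr z w" unfolding RS_simps(1-3) by blast
  note c = x(1) y(1) z(1) F.S_closed[OF x(2)] F.S_closed[OF y(2)] F.S_closed[OF z(2)]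
  have lhs: "(X1 \<oplus>\<^bsub>RS\<^esub> Y1) \<otimes>\<^bsub>RS\<^esub> Z1 = F.fr ((t \<otimes> x \<oplus> s \<otimes> y) \<otimes> z) (s \<otimes> t \<otimes> w)"
    using c x(2) y(2) z(2) mult_S by (simp add: x(3) y(3) z(3) RS_add RS_mult)
  have rhs: "X1 \<otimes>\<^bsub>RS\<^esub> Z1 \<oplus>\<^bsub>RS\<^esub> Y1 \<otimes>\<^bsub>RS\<^esub> Z1 =
      F.fr ((t \<otimes> w) \<otimes> (x \<otimes> z) \<oplus> (s \<otimes> w) \<otimes> (y \<otimes> z)) ((s \<otimes> w) \<otimes> (t \<otimes> w))"
    using c x(2) y(2) z(2) mult_S by (simp add: x(3) y(3) z(3) RS_add RS_mult)
  show "(X1 \<oplus>\<^bsub>RS\<^esub> Y1) \<otimes>\<^bsub>RS\<^esub> Z1 = X1 \<otimes>\<^bsub>RS\<^esub> Z1 \<oplus>\<^bsub>RS\<^esub> Y1 \<otimes>\<^bsub>RS\<^esub> Z1"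
    unfolding lhs rhs
  proof (rule frac_eqI)
    show "(s \<otimes> w) \<otimes> (t \<otimes> w) \<otimes> ((t \<otimes> x \<oplus> s \<otimes> y) \<otimes> z) =
      (s \<otimes> t \<otimes> w) \<otimes> ((t \<otimes> w) \<otimes> (x \<otimes> z) \<oplus> (s \<otimes> w) \<otimes> (y \<otimes> z))" using c by algebra
  qed (use c x(2) y(2) z(2) mult_S in auto)
qed

definition to_frac :: "'a \<Rightarrow> ('a \<times> 'a) set"
  where "to_frac a = F.fr a \<one>"

lemma to_frac_hom: "to_frac \<in> ring_hom R RS"
  by (rule ring_hom_memI)
    (use one_S in \<open>auto simp: to_frac_def RS_simps(1,3) RS_mult RS_add\<close>)

lemma to_frac_eq: "a \<in> carrier R \<Longrightarrow> s \<in> S \<Longrightarrow> to_frac a = F.fr a s \<otimes>\<^bsub>RS\<^esub> to_frac s"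
  unfolding to_frac_def using one_S F.S_closed
  by (simp add: RS_mult) (rule frac_eqI; use F.S_closed in \<open>auto simp: m_comm\<close>)

lemma frac_eq_to_frac: "a \<in> carrier R \<Longrightarrow> s \<in> S \<Longrightarrow> F.fr a s = F.fr \<one> s \<otimes>\<^bsub>RS\<^esub> to_frac a"
  unfolding to_frac_def using one_S F.S_closed by (simp add: RS_mult)

text \<open>A fraction and its numerator differ by a unit of the ring of fractions.\<close>

lemma frac_mem_prime_iff:
  assumes W: "primeideal W RS" and a: "a \<in> carrier R" "s \<in> S"
  shows "F.fr a s \<in> W \<longleftrightarrow> to_frac a \<in> W"
proof -
  have mem: "F.fr \<one> s \<in> carrier RS" "to_frac s \<in> carrier RS"
    using a one_S F.S_closed unfolding to_frac_def RS_simps(1) by blast+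
  show ?thesis
    using to_frac_eq[OF a] frac_eq_to_frac[OF a] primeD(6,7)[OF W] mem by metis
qed

definition contract :: "('a \<times> 'a) set set \<Rightarrow> 'a set"
  where "contract W = {a \<in> carrier R. to_frac a \<in> W}"

definition extend :: "'a set \<Rightarrow> ('a \<times> 'a) set set"
  where "extend p = {F.fr a s | a s. a \<in> p \<and> s \<in> S}"

lemma contract_prime: "primeideal W RS \<Longrightarrow> primeideal (contract W) R"
  unfolding contract_def by (rule preimage_prime[OF to_frac_hom is_cring RS_cring])

lemma contract_disjoint:
  assumes W: "primeideal W RS"
  shows "contract W \<inter> S = {}"
proof (rule ccontr)
  assume "\<not> ?thesis"
  then obtain s where s: "s \<in> S" "to_frac s \<in> W" unfolding contract_def by blast
  then have "F.fr s s \<in> W" using frac_mem_prime_iff[OF W] F.S_closed by blast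
  moreover have "F.fr s s = F.fr \<one> \<one>" using s(1) one_S F.S_closed by (intro frac_eqI) auto
  ultimately show False using primeideal_one_notin[OF W] by (simp add: RS_simps(3))
qed

lemma contract_path: "prime_path RS k U W \<Longrightarrow> prime_path R k (contract U) (contract W)"
proof (induction rule: prime_path.induct)
  case (prime_path_0 U)
  then show ?case using contract_prime prime_path.prime_path_0 by blast
next
  case (prime_path_Suc U Y k Z)
  have Y: "primeideal Y RS" using prime_path_primes[OF prime_path_Suc(3)] by blast
  obtain y where y: "y \<in> Y" "y \<notin> U" using prime_path_Suc(2) by blast
  then obtain a s where as: "a \<in> carrier R" "s \<in> S" "y = F.fr a s"
    using primeideal_subset[OF Y] unfolding RS_simps(1-3) by blast
  then have "a \<in> contract Y" "a \<notin> contract U"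
    using y frac_mem_prime_iff[OF Y as(1,2)] frac_mem_prime_iff[OF prime_path_Suc(1) as(1,2)]
    by (auto simp: contract_def)
  moreover have "contract U \<subseteq> contract Y" using prime_path_Suc(2) by (auto simp: contract_def)
  ultimately show ?case using prime_path_Suc(4) contract_prime[OF prime_path_Suc(1)]
    by (intro prime_path.prime_path_Suc[of _ _ "contract Y"]) auto
qed

text \<open>Equality of fractions is a cross multiplication by elements of \<open>S\<close>, and a
  prime disjoint from \<open>S\<close> allows these factors to be cancelled.\<close>

lemma frac_mem_extend_iff:
  assumes p: "primeideal p R" "p \<inter> S = {}" and a: "a \<in> carrier R" "s \<in> S"
  shows "F.fr a s \<in> extend p \<longleftrightarrow> a \<in> p"
proof
  assume "F.fr a s \<in> extend p"
  then obtain b t where b: "b \<in> p" "t \<in> S" "F.fr a s = F.fr b t" unfolding extend_def by blast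
  have bc: "b \<in> carrier R" using b(1) primeideal_subset[OF p(1)] by blast
  obtain u where u: "u \<in> S" "(u \<otimes> t) \<otimes> a = (u \<otimes> s) \<otimes> b"
    using b(3) F.frac_eq_iff[of a s b t] a b(2) bc by (auto simp: rm_simps)
  have ut: "u \<otimes> t \<in> S" "u \<otimes> s \<in> carrier R" using u(1) b(2) a(2) mult_S F.S_closed by auto
  have "(u \<otimes> t) \<otimes> a \<in> p" unfolding u(2) using primeD(6)[OF p(1) ut(2) b(1)] .
  then show "a \<in> p" using primeideal_multD[OF p(1) F.S_closed[OF ut(1)] a(1)] ut(1) p(2) by blast
qed (use a in \<open>auto simp: extend_def\<close>)

lemma extend_prime:
  assumes p: "primeideal p R" "p \<inter> S = {}"
  shows "primeideal (extend p) RS"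
proof -
  interpret L: cring RS by (rule RS_cring)
  note pc = primeideal_subset[OF p(1), THEN subsetD]
  show ?thesis
  proof (rule L.primeidealI')
    show "ideal (extend p) RS"
    proof (rule L.idealI')
      show "extend p \<subseteq> carrier RS" unfolding extend_def RS_simps(1-3) using pc by blast
      show "\<zero>\<^bsub>RS\<^esub> \<in> extend p" unfolding RS_simps(1-3) extend_def using primeD(2)[OF p(1)] one_S by blast
      show "X1 \<oplus>\<^bsub>RS\<^esub> Y1 \<in> extend p" if XY: "X1 \<in> extend p" "Y1 \<in> extend p" for X1 Y1
      proof -
        obtain a s b t where *: "a \<in> p" "s \<in> S" "b \<in> p" "t \<in> S" "X1 = F.fr a s" "Y1 = F.fr b t"
          using XY unfolding extend_def by blast
        then have "t \<otimes> a \<oplus> s \<otimes> b \<in> p" "s \<otimes> t \<in> S"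
          using primeD(3,6)[OF p(1)] F.S_closed mult_S by auto
        moreover have "X1 \<oplus>\<^bsub>RS\<^esub> Y1 = F.fr (t \<otimes> a \<oplus> s \<otimes> b) (s \<otimes> t)"
          unfolding *(5,6) using * pc by (intro RS_add) auto
        ultimately show ?thesis unfolding extend_def by blast
      qed
      show "X1 \<otimes>\<^bsub>RS\<^esub> Y1 \<in> extend p" if XY: "X1 \<in> carrier RS" "Y1 \<in> extend p" for X1 Y1
      proof -
        obtain a s b t where *: "a \<in> carrier R" "s \<in> S" "b \<in> p" "t \<in> S" "X1 = F.fr a s" "Y1 = F.fr b t"
          using XY unfolding extend_def RS_simps(1-3) by blast
        then have "a \<otimes> b \<in> p" "s \<otimes> t \<in> S" using primeD(6)[OF p(1)] mult_S by auto
        moreover have "X1 \<otimes>\<^bsub>RS\<^esub> Y1 = F.fr (a \<otimes> b) (s \<otimes> t)"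
          unfolding *(5,6) using * pc by (intro RS_mult) auto
        ultimately show ?thesis unfolding extend_def by blast
      qed
    qed
    show "\<one>\<^bsub>RS\<^esub> \<notin> extend p"
      unfolding RS_simps(1-3) using frac_mem_extend_iff[OF p, of \<one> \<one>] one_S primeideal_one_notin[OF p(1)] by simp
    fix X1 Y1 assume X: "X1 \<in> carrier RS" and Y: "Y1 \<in> carrier RS" and XY: "X1 \<otimes>\<^bsub>RS\<^esub> Y1 \<in> extend p"
    obtain a s b t where *: "a \<in> carrier R" "s \<in> S" "b \<in> carrier R" "t \<in> S" "X1 = F.fr a s" "Y1 = F.fr b t"
      using X Y unfolding RS_simps(1-3) by blast
    then have "F.fr (a \<otimes> b) (s \<otimes> t) \<in> extend p" using XY by (simp add: RS_mult)
    then have "a \<otimes> b \<in> p" using frac_mem_extend_iff[OF p, of "a \<otimes> b" "s \<otimes> t"] * mult_S by simp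
    then show "X1 \<in> extend p \<or> Y1 \<in> extend p"
      using primeideal_multD[OF p(1) *(1,3)] frac_mem_extend_iff[OF p] * by auto
  qed
qed

lemma contract_extend: "primeideal p R \<Longrightarrow> p \<inter> S = {} \<Longrightarrow> contract (extend p) = p"
  using frac_mem_extend_iff[OF _ _ _ one_S] primeideal_subset[of p R]
  unfolding contract_def to_frac_def by auto

lemma extend_path:
  assumes "prime_path R k U W" "W \<inter> S = {}"
  shows "prime_path RS k (extend U) (extend W)"
  using assms
proof (induction rule: prime_path.induct)
  case (prime_path_0 U)
  then show ?case using extend_prime prime_path.prime_path_0 by blast
next
  case (prime_path_Suc U Y k Z)
  have Y: "primeideal Y R" "Y \<inter> S = {}" and U: "U \<inter> S = {}"
    using prime_path_primes[OF prime_path_Suc(3)] prime_path_Suc by blast+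
  have "extend U \<subseteq> extend Y" unfolding extend_def using prime_path_Suc(2) by blast
  moreover have "extend U \<noteq> extend Y"
    using contract_extend[OF Y] contract_extend[OF prime_path_Suc(1) U] prime_path_Suc(2) by auto
  ultimately show ?case using prime_path_Suc(4,5) extend_prime[OF prime_path_Suc(1) U]
    by (intro prime_path.prime_path_Suc[of _ _ "extend Y"]) auto
qed

lemma extend_minimal:
  assumes p: "minimal_prime_over R {\<zero>} p" and S: "p \<inter> S = {}"
  shows "minimal_prime_over RS {\<zero>\<^bsub>RS\<^esub>} (extend p)"
  unfolding minimal_prime_over_def
proof (intro conjI allI impI)
  have pp: "primeideal p R" using p by (simp add: minimal_prime_over_def)
  show ext: "primeideal (extend p) RS" using extend_prime[OF pp S] .
  show "{\<zero>\<^bsub>RS\<^esub>} \<subseteq> extend p" using primeD(2)[OF ext] by simp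
  fix W assume W: "primeideal W RS" "W \<subseteq> extend p"
  have "contract W \<subseteq> p" using contract_extend[OF pp S] W(2) by (auto simp: contract_def)
  then have cW: "contract W = p"
    using p contract_prime[OF W(1)] primeD(2)[OF contract_prime[OF W(1)]]
    unfolding minimal_prime_over_def by blast
  have "extend p \<subseteq> W"
  proof
    fix f assume "f \<in> extend p"
    then obtain a s where as: "a \<in> p" "s \<in> S" "f = F.fr a s" unfolding extend_def by blast
    then show "f \<in> W" using frac_mem_prime_iff[OF W(1), of a s] cW by (auto simp: contract_def)
  qed
  then show "W = extend p" using W(2) by blast
qed

end

lemma (in cring) prime_fractions: "primeideal P R \<Longrightarrow> ring_fractions R (carrier R - P)"
  using prime_compl_mult primeideal_one_notin is_cring
  by (simp add: ring_fractions_def ring_fractions_axioms_def)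

text \<open>Any minimal prime below \<open>P\<close> sees the full height of \<open>P\<close>: the
  path is moved to the localization at \<open>P\<close>, replaced there by one from the chosen
  minimal prime, and contracted.\<close>

lemma (in cring) locally_equidimensional_path:
  assumes le: "locally_equidimensional R" and P: "primeideal P R"
    and p: "minimal_prime_over R {\<zero>} p" "p \<subseteq> P" and path: "prime_path R k U P"
  obtains l where "k \<le> l" "prime_path R l p P"
proof -
  interpret L: ring_fractions R "carrier R - P" using prime_fractions[OF P] .
  have pp: "primeideal p R" using p by (simp add: minimal_prime_over_def)
  have "equidimensional L.RS" using le P by (simp add: locally_equidimensional_def localization_at_def)
  moreover have "minimal_prime_over L.RS {\<zero>\<^bsub>L.RS\<^esub>} (L.extend p)" using p by (intro L.extend_minimal) auto
  moreover have "prime_path L.RS k (L.extend U) (L.extend P)" using path by (intro L.extend_path) auto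
  ultimately obtain l V where l: "k \<le> l" "prime_path L.RS l (L.extend p) V"
    using equidimensional_path[OF L.RS_cring] by blast
  have V: "primeideal V L.RS" using prime_path_primes[OF l(2)] by blast
  have "L.contract (L.extend p) = p" using L.contract_extend[OF pp] p(2) by blast
  then have "prime_path R l p (L.contract V)" using L.contract_path[OF l(2)] by metis
  \<comment> \<open>The new path need not end at the extension of \<open>P\<close>, but its end
    contracts into \<open>P\<close>, so it can be prolonged to \<open>P\<close>.\<close>
  moreover have "L.contract V \<subseteq> P"
    using L.contract_disjoint[OF V] primeideal_subset[OF L.contract_prime[OF V]] by blast
  ultimately obtain l' where "l \<le> l'" "prime_path R l' p P"
    using prime_path_widen[of R l p _ p P] pp P by auto
  then show thesis using that[of l'] l(1) by simp
qed

text \<open>The number \<open>\<mu>\<close> enters the estimate through this upper bound: elements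
  that generate up to denominators outside \<open>Q\<close> generate the localization. The family
  \<open>m\<close> need not be injective on \<open>T\<close>.\<close>

lemma local_min_generators_le:
  assumes M: "module R M" and Q: "primeideal Q R" and T: "finite T"
    and m: "\<And>i. i \<in> T \<Longrightarrow> m i \<in> carrier M"
    and gen: "\<And>x. x \<in> carrier M \<Longrightarrow> \<exists>s\<in>carrier R - Q. \<exists>r. (\<forall>i\<in>T. r i \<in> carrier R) \<and>
      s \<odot>\<^bsub>M\<^esub> x = (\<Oplus>\<^bsub>M\<^esub>i\<in>T. r i \<odot>\<^bsub>M\<^esub> m i)"
  shows "local_min_generators R Q M \<le> enat (card T)"
proof -
  interpret module R M by (rule M)
  interpret L: ring_fractions R "carrier R - Q" using R.prime_fractions[OF Q] .
  interpret F: module_fractions R M "carrier R - Q"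
    using L.one_S L.mult_S M by unfold_locales auto
  let ?G = "(\<lambda>i. F.fr (m i) \<one>\<^bsub>R\<^esub>) ` T"
  have one: "\<one>\<^bsub>R\<^esub> \<in> carrier R - Q" by (rule L.one_S)
  have Gc: "?G \<subseteq> carrier F.MS" unfolding F.MS_carrier using m one by blast
  have full: "carrier F.MS \<subseteq> N" if N: "submodule N L.RS F.MS" "?G \<subseteq> N" for N
  proof -
    have Nadd: "x \<oplus>\<^bsub>F.MS\<^esub> y \<in> N" if "x \<in> N" "y \<in> N" for x y
      using subgroup.m_closed[OF submodule.axioms(1)[OF N(1)]] that by simp
    have Nzero: "\<zero>\<^bsub>F.MS\<^esub> \<in> N"
      using subgroup.one_closed[OF submodule.axioms(1)[OF N(1)]] by simp
    have Nsm: "a \<odot>\<^bsub>F.MS\<^esub> y \<in> N" if "a \<in> carrier L.RS" "y \<in> N" for a y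
      using submodule.smult_closed[OF N(1)] that by blast
    have comb: "F.fr (\<Oplus>\<^bsub>M\<^esub>i\<in>T'. r i \<odot>\<^bsub>M\<^esub> m i) \<one>\<^bsub>R\<^esub> \<in> N"
      if r: "\<forall>i\<in>T. r i \<in> carrier R" and T': "T' \<subseteq> T" for r T'
      using finite_subset[OF T' T] T'
    proof (induction T')
      case empty
      then show ?case using Nzero by (simp add: F.MS_zero)
    next
      case (insert i T')
      have i: "i \<in> T" "r i \<in> carrier R" "m i \<in> carrier M" using insert m r by auto
      have cl: "(\<lambda>i. r i \<odot>\<^bsub>M\<^esub> m i) \<in> T' \<rightarrow> carrier M" using insert m r by auto
      then have sc: "(\<Oplus>\<^bsub>M\<^esub>i\<in>T'. r i \<odot>\<^bsub>M\<^esub> m i) \<in> carrier M" by (rule M.finsum_closed)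
      have "F.fr (m i) \<one>\<^bsub>R\<^esub> \<in> N" using N(2) i by blast
      moreover have "L.F.fr (r i) \<one>\<^bsub>R\<^esub> \<in> carrier L.RS" unfolding L.RS_simps(1-3) using i one by blast
      moreover have "L.F.fr (r i) \<one>\<^bsub>R\<^esub> \<odot>\<^bsub>F.MS\<^esub> F.fr (m i) \<one>\<^bsub>R\<^esub> = F.fr (r i \<odot>\<^bsub>M\<^esub> m i) \<one>\<^bsub>R\<^esub>"
        using F.MS_smult[OF i(2) one i(3) one] by simp
      ultimately have "F.fr (r i \<odot>\<^bsub>M\<^esub> m i) \<one>\<^bsub>R\<^esub> \<in> N" using Nsm by metis
      then have "F.fr (r i \<odot>\<^bsub>M\<^esub> m i) \<one>\<^bsub>R\<^esub> \<oplus>\<^bsub>F.MS\<^esub> F.fr (\<Oplus>\<^bsub>M\<^esub>i\<in>T'. r i \<odot>\<^bsub>M\<^esub> m i) \<one>\<^bsub>R\<^esub> \<in> N"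
        using insert Nadd by simp
      then show ?case
        using F.MS_add[OF _ one sc one, of "r i \<odot>\<^bsub>M\<^esub> m i"] insert(1,2) cl i sc by simp
    qed
    show ?thesis
    proof
      fix f assume "f \<in> carrier F.MS"
      then obtain x t where x: "x \<in> carrier M" "t \<in> carrier R - Q" "f = F.fr x t" unfolding F.MS_carrier by blast
      obtain s r where s: "s \<in> carrier R - Q" "\<forall>i\<in>T. r i \<in> carrier R"
        "s \<odot>\<^bsub>M\<^esub> x = (\<Oplus>\<^bsub>M\<^esub>i\<in>T. r i \<odot>\<^bsub>M\<^esub> m i)" using gen[OF x(1)] by blast
      have st: "s \<otimes>\<^bsub>R\<^esub> t \<in> carrier R - Q" using L.mult_S s x by blast
      have "F.fr (s \<odot>\<^bsub>M\<^esub> x) \<one>\<^bsub>R\<^esub> \<in> N" unfolding s(3) by (rule comb[OF s(2)]) simp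
      moreover have "L.F.fr \<one>\<^bsub>R\<^esub> (s \<otimes>\<^bsub>R\<^esub> t) \<in> carrier L.RS" unfolding L.RS_simps(1-3) using st by blast
      moreover have "L.F.fr \<one>\<^bsub>R\<^esub> (s \<otimes>\<^bsub>R\<^esub> t) \<odot>\<^bsub>F.MS\<^esub> F.fr (s \<odot>\<^bsub>M\<^esub> x) \<one>\<^bsub>R\<^esub> = F.fr (s \<odot>\<^bsub>M\<^esub> x) (s \<otimes>\<^bsub>R\<^esub> t)"
        using F.MS_smult[OF _ st _ one, of "\<one>\<^bsub>R\<^esub>" "s \<odot>\<^bsub>M\<^esub> x"] s(1) x by simp
      moreover have "F.fr (s \<odot>\<^bsub>M\<^esub> x) (s \<otimes>\<^bsub>R\<^esub> t) = F.fr x t"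
        using s(1) x st by (intro F.frac_eqI) (auto simp: smult_assoc1[symmetric] R.m_comm)
      ultimately show "f \<in> N" using Nsm x(3) by metis
    qed
  qed
  have "submodule (carrier F.MS) L.RS F.MS"
  proof (intro submodule.intro submodule_axioms.intro)
    interpret A: abelian_group F.MS by (rule F.MS_abelian_group)
    show "subgroup (carrier F.MS) (add_monoid F.MS)"
      using group.subgroup_self[OF A.a_group] by simp
    show "a \<odot>\<^bsub>F.MS\<^esub> x \<in> carrier F.MS" if "a \<in> carrier L.RS" "x \<in> carrier F.MS" for a x
    proof -
      obtain c s y t where *: "c \<in> carrier R" "s \<in> carrier R - Q" "a = L.F.fr c s"
        "y \<in> carrier M" "t \<in> carrier R - Q" "x = F.fr y t"
        using \<open>a \<in> carrier L.RS\<close> \<open>x \<in> carrier F.MS\<close> unfolding L.RS_simps(1-3) F.MS_carrier by blast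
      then show ?thesis using F.MS_smult[OF *(1,2,4,5)] L.mult_S[OF *(2,5)] unfolding F.MS_carrier by auto
    qed
  qed
  then have "generates L.RS F.MS ?G"
    unfolding generates_def generated_submodule_def using Gc full by blast
  then have "min_generators L.RS F.MS \<le> enat (card ?G)"
    unfolding min_generators_def using T by (intro Inf_lower) blast
  also have "\<dots> \<le> enat (card T)" using card_image_le[OF T] by simp
  finally show ?thesis
    by (simp add: local_min_generators_def localization_at_def module_localization_at_def)
qed

section \<open>Symmetric algebras of presented modules\<close>

text \<open>The comparison maps between the two presentations of the symmetric algebra are
  surjective only modulo relations. Surjectivity modulo the smallest prime of the path is enough to
  keep the inclusions strict.\<close>

lemma prime_path_pullback_mod:
  assumes h: "h \<in> ring_hom A B" and A: "cring A" and B: "cring B"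
    and p: "prime_path B k U W"
    and surj: "\<And>b. b \<in> carrier B \<Longrightarrow> \<exists>a\<in>carrier A. h a \<ominus>\<^bsub>B\<^esub> b \<in> U"
  shows "prime_path A k {a \<in> carrier A. h a \<in> U} {a \<in> carrier A. h a \<in> W}"
  using p surj
proof (induction rule: prime_path.induct)
  case (prime_path_0 U)
  then show ?case using preimage_prime[OF h A B] by (intro prime_path.prime_path_0)
next
  case (prime_path_Suc U Y k Z)
  interpret B: cring B by (rule B)
  have Y: "primeideal Y B" using prime_path_primes[OF prime_path_Suc(3)] by blast
  have surjY: "\<exists>a\<in>carrier A. h a \<ominus>\<^bsub>B\<^esub> b \<in> Y" if "b \<in> carrier B" for b
    using prime_path_Suc(5)[OF that] prime_path_Suc(2) by blast
  obtain b where b: "b \<in> Y" "b \<notin> U" using prime_path_Suc(2) by blast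
  have bc: "b \<in> carrier B" using b primeideal_subset[OF Y] by blast
  obtain a where a: "a \<in> carrier A" "h a \<ominus>\<^bsub>B\<^esub> b \<in> U" using prime_path_Suc(5)[OF bc] by blast
  have hc: "h a \<in> carrier B" using ring_hom_closed[OF h a(1)] .
  have "h a = (h a \<ominus>\<^bsub>B\<^esub> b) \<oplus>\<^bsub>B\<^esub> b" using hc bc by algebra
  then have "h a \<in> Y" using primeD(3)[OF Y _ b(1)] a(2) prime_path_Suc(2) by (metis psubsetD)
  moreover have "h a \<notin> U"
  proof
    assume "h a \<in> U"
    then have "h a \<ominus>\<^bsub>B\<^esub> (h a \<ominus>\<^bsub>B\<^esub> b) \<in> U" using primeD(5)[OF prime_path_Suc(1)] a(2) by blast
    moreover have "h a \<ominus>\<^bsub>B\<^esub> (h a \<ominus>\<^bsub>B\<^esub> b) = b" using hc bc by algebra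
    ultimately show False using b(2) by simp
  qed
  ultimately have "{a \<in> carrier A. h a \<in> U} \<subset> {a \<in> carrier A. h a \<in> Y}" using prime_path_Suc(2) a(1) by blast
  then show ?case using prime_path_Suc.IH[OF surjY] preimage_prime[OF h A B prime_path_Suc(1)]
    by (intro prime_path.prime_path_Suc)
qed

text \<open>The ring \<open>S\<close> has one variable for each generator \<open>m i\<close> with
  \<open>i < n\<close>, whereas \<open>sym_algebra\<close> is a quotient of \<open>W\<close>, which
  has a variable for every element of \<open>M\<close>. Coefficient families are total on the
  naturals, and only indices below \<open>n\<close> count.\<close>

locale generated_module = module R M for R (structure) and M (structure) +
  fixes n :: nat and m :: "nat \<Rightarrow> 'c"
  assumes m_closed': "m i \<in> carrier M"
    and gen: "x \<in> carrier M \<Longrightarrow> \<exists>c. (\<forall>i. c i \<in> carrier R) \<and> x = (\<Oplus>\<^bsub>M\<^esub>i\<in>{..<n}. c i \<odot>\<^bsub>M\<^esub> m i)"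
begin

abbreviation "S \<equiv> mpoly_ring R {..<n}"
abbreviation "W \<equiv> mpoly_ring R (carrier M)"
abbreviation "K \<equiv> Idl\<^bsub>W\<^esub> (sym_relations R M)"
abbreviation "coeff_fun c \<equiv> (\<forall>i::nat. c i \<in> carrier R)"

definition lin :: "nat set \<Rightarrow> (nat \<Rightarrow> 'a) \<Rightarrow> nat multiset \<Rightarrow> 'a"
  where "lin F c = (\<Oplus>\<^bsub>S\<^esub>i\<in>F. R.indexed_const (c i) \<otimes>\<^bsub>S\<^esub> R.indexed_var i)"

definition comb :: "nat set \<Rightarrow> (nat \<Rightarrow> 'a) \<Rightarrow> 'c"
  where "comb F c = (\<Oplus>\<^bsub>M\<^esub>i\<in>F. c i \<odot>\<^bsub>M\<^esub> m i)"

definition relations :: "(nat \<Rightarrow> 'a) set"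
  where "relations = {c. coeff_fun c \<and> comb {..<n} c = \<zero>\<^bsub>M\<^esub>}"

text \<open>Generators of the ideal \<open>J\<close>. Since only primes containing \<open>J\<close>
  matter, conditions are stated with this set instead of the ideal.\<close>

definition rel_forms :: "(nat multiset \<Rightarrow> 'a) set"
  where "rel_forms = lin {..<n} ` relations"

sublocale S: cring S by (rule R.mpoly_cring)
sublocale W: cring W by (rule R.mpoly_cring)

lemma const_S: "a \<in> carrier R \<Longrightarrow> R.indexed_const a \<in> carrier S"
  by (rule R.const_closed)

lemma var_S: "i < n \<Longrightarrow> R.indexed_var i \<in> carrier S"
  by (rule R.var_closed) simp

lemma lin_term: "F \<subseteq> {..<n} \<Longrightarrow> coeff_fun c \<Longrightarrow>
    (\<lambda>i. R.indexed_const (c i) \<otimes>\<^bsub>S\<^esub> R.indexed_var i) \<in> F \<rightarrow> carrier S"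
  using const_S var_S by auto

lemma lin_closed: "F \<subseteq> {..<n} \<Longrightarrow> coeff_fun c \<Longrightarrow> lin F c \<in> carrier S"
  unfolding lin_def by (rule S.finsum_closed[OF lin_term])

lemma comb_closed: "coeff_fun c \<Longrightarrow> comb F c \<in> carrier M"
  unfolding comb_def using m_closed' by (intro M.finsum_closed) auto

lemma const_hom_S: "ring_hom_cring R S R.indexed_const"
  using ring_hom_cring'[OF R.const_hom R.is_cring R.mpoly_cring] .

lemma lin_insert:
  assumes "finite F" "i \<notin> F" "insert i F \<subseteq> {..<n}" "coeff_fun c"
  shows "lin (insert i F) c = R.indexed_const (c i) \<otimes>\<^bsub>S\<^esub> R.indexed_var i \<oplus>\<^bsub>S\<^esub> lin F c"
  unfolding lin_def using assms lin_term[of F c] const_S var_S by (intro S.finsum_insert) auto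

lemma comb_insert:
  assumes "finite F" "i \<notin> F" "coeff_fun c"
  shows "comb (insert i F) c = c i \<odot>\<^bsub>M\<^esub> m i \<oplus>\<^bsub>M\<^esub> comb F c"
  unfolding comb_def using assms m_closed' by (intro M.finsum_insert) auto

lemma lin_add:
  assumes "F \<subseteq> {..<n}" "coeff_fun c" "coeff_fun d"
  shows "lin F (\<lambda>i. c i \<oplus> d i) = lin F c \<oplus>\<^bsub>S\<^esub> lin F d"
proof -
  interpret ring_hom_cring R S R.indexed_const by (rule const_hom_S)
  have "lin F (\<lambda>i. c i \<oplus> d i) = (\<Oplus>\<^bsub>S\<^esub>i\<in>F. R.indexed_const (c i) \<otimes>\<^bsub>S\<^esub> R.indexed_var i \<oplus>\<^bsub>S\<^esub>
      R.indexed_const (d i) \<otimes>\<^bsub>S\<^esub> R.indexed_var i)"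
    unfolding lin_def using assms var_S by (intro S.finsum_cong') (auto simp: S.l_distr)
  also have "\<dots> = lin F c \<oplus>\<^bsub>S\<^esub> lin F d"
    unfolding lin_def using assms lin_term by (intro S.finsum_addf) auto
  finally show ?thesis .
qed

lemma comb_add:
  assumes "coeff_fun c" "coeff_fun d"
  shows "comb F (\<lambda>i. c i \<oplus> d i) = comb F c \<oplus>\<^bsub>M\<^esub> comb F d"
proof -
  have "comb F (\<lambda>i. c i \<oplus> d i) = (\<Oplus>\<^bsub>M\<^esub>i\<in>F. c i \<odot>\<^bsub>M\<^esub> m i \<oplus>\<^bsub>M\<^esub> d i \<odot>\<^bsub>M\<^esub> m i)"
    unfolding comb_def using assms m_closed' by (intro M.finsum_cong') (auto simp: smult_l_distr)
  also have "\<dots> = comb F c \<oplus>\<^bsub>M\<^esub> comb F d"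
    unfolding comb_def using assms m_closed' by (intro M.finsum_addf) auto
  finally show ?thesis .
qed

lemma lin_scale:
  assumes "finite F" "F \<subseteq> {..<n}" "coeff_fun c" "r \<in> carrier R"
  shows "lin F (\<lambda>i. r \<otimes> c i) = R.indexed_const r \<otimes>\<^bsub>S\<^esub> lin F c"
proof -
  interpret ring_hom_cring R S R.indexed_const by (rule const_hom_S)
  have "R.indexed_const r \<otimes>\<^bsub>S\<^esub> lin F c =
      (\<Oplus>\<^bsub>S\<^esub>i\<in>F. R.indexed_const r \<otimes>\<^bsub>S\<^esub> (R.indexed_const (c i) \<otimes>\<^bsub>S\<^esub> R.indexed_var i))"
    unfolding lin_def using assms lin_term by (intro S.finsum_rdistr) auto
  also have "\<dots> = lin F (\<lambda>i. r \<otimes> c i)"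
    unfolding lin_def using assms var_S by (intro S.finsum_cong') (auto simp: S.m_assoc subset_iff)
  finally show ?thesis by simp
qed

lemma comb_scale:
  assumes "finite F" "coeff_fun c" "r \<in> carrier R"
  shows "comb F (\<lambda>i. r \<otimes> c i) = r \<odot>\<^bsub>M\<^esub> comb F c"
  using assms(1)
proof (induction F)
  case empty
  then show ?case using assms by (simp add: comb_def)
next
  case (insert i F)
  then show ?case using assms comb_closed[of c F] m_closed'
    by (simp add: comb_insert smult_r_distr smult_assoc1)
qed

lemma lin_diff:
  assumes "F \<subseteq> {..<n}" "finite F" "coeff_fun c" "coeff_fun d"
  shows "lin F (\<lambda>i. c i \<oplus> (\<ominus> \<one>) \<otimes> d i) = lin F c \<ominus>\<^bsub>S\<^esub> lin F d"
proof -
  interpret ring_hom_cring R S R.indexed_const by (rule const_hom_S)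
  have "lin F (\<lambda>i. c i \<oplus> (\<ominus> \<one>) \<otimes> d i) = lin F c \<oplus>\<^bsub>S\<^esub> R.indexed_const (\<ominus> \<one>) \<otimes>\<^bsub>S\<^esub> lin F d"
    using assms lin_add[of F c "\<lambda>i. (\<ominus> \<one>) \<otimes> d i"] lin_scale[of F d "\<ominus> \<one>"] by simp
  then show ?thesis using assms lin_closed by (simp add: S.l_minus a_minus_def)
qed

lemma comb_diff:
  assumes "finite F" "coeff_fun c" "coeff_fun d"
  shows "comb F (\<lambda>i. c i \<oplus> (\<ominus> \<one>) \<otimes> d i) = comb F c \<ominus>\<^bsub>M\<^esub> comb F d"
  using assms comb_add[of c "\<lambda>i. (\<ominus> \<one>) \<otimes> d i" F] comb_scale[of F d "\<ominus> \<one>"] comb_closed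
  by (simp add: smult_l_minus a_minus_def)

lemma diff_mem_rel_forms:
  assumes "coeff_fun c" "coeff_fun d" "comb {..<n} c = comb {..<n} d"
  shows "lin {..<n} c \<ominus>\<^bsub>S\<^esub> lin {..<n} d \<in> rel_forms"
proof -
  have "(\<lambda>i. c i \<oplus> (\<ominus> \<one>) \<otimes> d i) \<in> relations"
    using assms comb_diff[of "{..<n}" c d] comb_closed by (simp add: relations_def a_minus_def M.r_neg)
  then have "lin {..<n} (\<lambda>i. c i \<oplus> (\<ominus> \<one>) \<otimes> d i) \<in> rel_forms" unfolding rel_forms_def by (rule imageI)
  then show ?thesis using lin_diff[of "{..<n}" c d] assms by simp
qed

definition delta :: "nat \<Rightarrow> nat \<Rightarrow> 'a"
  where "delta i = (\<lambda>j. if j = i then \<one> else \<zero>)"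

lemma delta_closed: "coeff_fun (delta i)"
  by (simp add: delta_def)

lemma comb_delta: "finite F \<Longrightarrow> i \<in> F \<Longrightarrow> comb F (delta i) = m i"
proof -
  assume F: "finite F" "i \<in> F"
  have "comb F (delta i) = (\<Oplus>\<^bsub>M\<^esub>j\<in>F. if i = j then m j else \<zero>\<^bsub>M\<^esub>)"
    unfolding comb_def delta_def using m_closed' by (intro M.finsum_cong') auto
  also have "\<dots> = m i" using F m_closed' by (intro M.finsum_singleton) auto
  finally show ?thesis .
qed

lemma lin_delta: "finite F \<Longrightarrow> F \<subseteq> {..<n} \<Longrightarrow> i \<in> F \<Longrightarrow> lin F (delta i) = R.indexed_var i"
proof -
  assume F: "finite F" "F \<subseteq> {..<n}" "i \<in> F"
  interpret ring_hom_cring R S R.indexed_const by (rule const_hom_S)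
  have "lin F (delta i) = (\<Oplus>\<^bsub>S\<^esub>j\<in>F. if i = j then R.indexed_var j else \<zero>\<^bsub>S\<^esub>)"
    unfolding lin_def delta_def using var_S F by (intro S.finsum_cong') auto
  also have "\<dots> = R.indexed_var i" using F var_S by (intro S.finsum_singleton) auto
  finally show ?thesis .
qed

text \<open>A choice of coordinates that need not be additive or homogeneous. Its failure to be
  linear is measured by relations, which is why \<open>to_S\<close> is compatible with
  \<open>K\<close> only modulo \<open>rel_forms\<close>.\<close>

definition coords :: "'c \<Rightarrow> nat \<Rightarrow> 'a"
  where "coords x = (SOME c. coeff_fun c \<and> x = comb {..<n} c)"

lemma coords: "x \<in> carrier M \<Longrightarrow> coeff_fun (coords x)" "x \<in> carrier M \<Longrightarrow> comb {..<n} (coords x) = x"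
proof -
  assume "x \<in> carrier M"
  then have "\<exists>c. coeff_fun c \<and> x = comb {..<n} c" using gen by (simp add: comb_def)
  from someI_ex[OF this] show "coeff_fun (coords x)" "comb {..<n} (coords x) = x"
    unfolding coords_def by auto
qed

text \<open>\<open>to_S\<close> and \<open>to_W\<close> induce mutually inverse isomorphisms between \<open>Sym(M)\<close> and the quotient
  of \<open>S\<close> by the linear forms of the relations.\<close>

definition to_S :: "('c multiset \<Rightarrow> 'a) \<Rightarrow> nat multiset \<Rightarrow> 'a"
  where "to_S = ev R S R.indexed_const (\<lambda>x. if x \<in> carrier M then lin {..<n} (coords x) else \<zero>\<^bsub>S\<^esub>)"

definition to_W :: "(nat multiset \<Rightarrow> 'a) \<Rightarrow> 'c multiset \<Rightarrow> 'a"
  where "to_W = ev R W R.indexed_const (\<lambda>i. R.indexed_var (m i))"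

lemma to_S: "to_S \<in> ring_hom W S" "a \<in> carrier R \<Longrightarrow> to_S (R.indexed_const a) = R.indexed_const a"
  "x \<in> carrier M \<Longrightarrow> to_S (R.indexed_var x) = lin {..<n} (coords x)"
proof -
  let ?g = "\<lambda>x. if x \<in> carrier M then lin {..<n} (coords x) else \<zero>\<^bsub>S\<^esub>"
  have "?g x \<in> carrier S" for x using coords lin_closed by auto
  then interpret E: evaluation R S R.indexed_const ?g
    using R.is_cring S.is_cring R.const_hom by (simp add: evaluation_def evaluation_axioms_def)
  show "to_S \<in> ring_hom W S" unfolding to_S_def by (rule E.ev_hom)
  show "a \<in> carrier R \<Longrightarrow> to_S (R.indexed_const a) = R.indexed_const a"
    unfolding to_S_def by (rule E.ev_const)
  show "x \<in> carrier M \<Longrightarrow> to_S (R.indexed_var x) = lin {..<n} (coords x)"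
    unfolding to_S_def by (simp add: E.ev_var)
qed

lemma to_W: "to_W \<in> ring_hom S W" "a \<in> carrier R \<Longrightarrow> to_W (R.indexed_const a) = R.indexed_const a"
  "to_W (R.indexed_var i) = R.indexed_var (m i)"
proof -
  have "R.indexed_var (m i) \<in> carrier W" for i using m_closed' by (intro R.var_closed)
  then interpret E: evaluation R W R.indexed_const "\<lambda>i. R.indexed_var (m i)"
    using R.is_cring W.is_cring R.const_hom by (simp add: evaluation_def evaluation_axioms_def)
  show "to_W \<in> ring_hom S W" unfolding to_W_def by (rule E.ev_hom)
  show "a \<in> carrier R \<Longrightarrow> to_W (R.indexed_const a) = R.indexed_const a"
    unfolding to_W_def by (rule E.ev_const)
  show "to_W (R.indexed_var i) = R.indexed_var (m i)"
    unfolding to_W_def by (simp add: E.ev_var)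
qed

lemma relations_carrier: "sym_relations R M \<subseteq> carrier W"
  unfolding sym_relations_def Let_def
  using R.var_closed[where V = "carrier M"] R.const_closed[where V = "carrier M"] by auto

lemma K_ideal: "ideal K W"
  by (rule W.genideal_ideal[OF relations_carrier])

lemma K_add:
  "x \<in> carrier M \<Longrightarrow> y \<in> carrier M \<Longrightarrow>
    R.indexed_var (x \<oplus>\<^bsub>M\<^esub> y) \<ominus>\<^bsub>W\<^esub> (R.indexed_var x \<oplus>\<^bsub>W\<^esub> R.indexed_var y) \<in> K"
  using W.genideal_self[OF relations_carrier] unfolding sym_relations_def Let_def by blast

lemma K_smult:
  "r \<in> carrier R \<Longrightarrow> x \<in> carrier M \<Longrightarrow>
    R.indexed_var (r \<odot>\<^bsub>M\<^esub> x) \<ominus>\<^bsub>W\<^esub> (R.indexed_const r \<otimes>\<^bsub>W\<^esub> R.indexed_var x) \<in> K"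
  using W.genideal_self[OF relations_carrier] unfolding sym_relations_def Let_def by blast

lemma var_W: "x \<in> carrier M \<Longrightarrow> R.indexed_var x \<in> carrier W"
  by (rule R.var_closed)

lemma const_W: "a \<in> carrier R \<Longrightarrow> R.indexed_const a \<in> carrier W"
  by (rule R.const_closed)

lemma K_zero: "R.indexed_var \<zero>\<^bsub>M\<^esub> \<in> K"
proof -
  have v: "R.indexed_var \<zero>\<^bsub>M\<^esub> \<in> carrier W" by (rule var_W) simp
  have "\<ominus>\<^bsub>W\<^esub> (R.indexed_var \<zero>\<^bsub>M\<^esub> \<ominus>\<^bsub>W\<^esub> (R.indexed_var \<zero>\<^bsub>M\<^esub> \<oplus>\<^bsub>W\<^esub> R.indexed_var \<zero>\<^bsub>M\<^esub>)) \<in> K"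
    using K_add[of "\<zero>\<^bsub>M\<^esub>" "\<zero>\<^bsub>M\<^esub>"] idealD(4)[OF K_ideal] by simp
  moreover have "\<ominus>\<^bsub>W\<^esub> (y \<ominus>\<^bsub>W\<^esub> (y \<oplus>\<^bsub>W\<^esub> y)) = y" if "y \<in> carrier W" for y
    using that by algebra
  ultimately show ?thesis using v by simp
qed

lemma to_W_lin:
  assumes "finite F" "F \<subseteq> {..<n}" "coeff_fun c"
  shows "to_W (lin F c) \<ominus>\<^bsub>W\<^esub> R.indexed_var (comb F c) \<in> K"
  using assms(1,2)
proof (induction F)
  interpret H: ring_hom_cring S W to_W using ring_hom_cring'[OF to_W(1) S.is_cring W.is_cring] .
  {
    case empty
    have "\<ominus>\<^bsub>W\<^esub> R.indexed_var \<zero>\<^bsub>M\<^esub> \<in> K" using K_zero idealD(4)[OF K_ideal] by blast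
    then show ?case using var_W[of "\<zero>\<^bsub>M\<^esub>"] by (simp add: lin_def comb_def a_minus_def)
  next
    case (insert i F)
    define v where "v = R.indexed_var (c i \<odot>\<^bsub>M\<^esub> m i)"
    define w where "w = R.indexed_var (comb F c)"
    define z where "z = R.indexed_var (c i \<odot>\<^bsub>M\<^esub> m i \<oplus>\<^bsub>M\<^esub> comb F c)"
    define t where "t = R.indexed_const (c i) \<otimes>\<^bsub>W\<^esub> R.indexed_var (m i)"
    define l where "l = to_W (lin F c)"
    have mem: "c i \<odot>\<^bsub>M\<^esub> m i \<in> carrier M" "comb F c \<in> carrier M" using assms m_closed' comb_closed by auto
    have cl: "v \<in> carrier W" "w \<in> carrier W" "z \<in> carrier W" "t \<in> carrier W" "l \<in> carrier W"
      unfolding v_def w_def z_def t_def l_def using mem assms m_closed' insert lin_closed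
      by (auto intro!: var_W const_W)
    have "z \<ominus>\<^bsub>W\<^esub> (v \<oplus>\<^bsub>W\<^esub> w) \<in> K" "v \<ominus>\<^bsub>W\<^esub> t \<in> K" "l \<ominus>\<^bsub>W\<^esub> w \<in> K"
      using K_add[OF mem] K_smult[of "c i" "m i"] insert assms m_closed'
      by (auto simp: z_def v_def w_def t_def l_def)
    then have "(l \<ominus>\<^bsub>W\<^esub> w) \<ominus>\<^bsub>W\<^esub> (v \<ominus>\<^bsub>W\<^esub> t) \<ominus>\<^bsub>W\<^esub> (z \<ominus>\<^bsub>W\<^esub> (v \<oplus>\<^bsub>W\<^esub> w)) \<in> K"
      using idealD(5)[OF K_ideal] by blast
    moreover have "(l \<ominus>\<^bsub>W\<^esub> w) \<ominus>\<^bsub>W\<^esub> (v \<ominus>\<^bsub>W\<^esub> t) \<ominus>\<^bsub>W\<^esub> (z \<ominus>\<^bsub>W\<^esub> (v \<oplus>\<^bsub>W\<^esub> w)) = (t \<oplus>\<^bsub>W\<^esub> l) \<ominus>\<^bsub>W\<^esub> z"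
      using cl by algebra
    moreover have "to_W (lin (insert i F) c) = t \<oplus>\<^bsub>W\<^esub> l"
      using insert assms lin_closed[of F c] const_S var_S
      by (simp add: lin_insert t_def l_def to_W(2,3))
    moreover have "R.indexed_var (comb (insert i F) c) = z"
      using insert assms by (simp add: comb_insert z_def)
    ultimately show ?case by simp
  }
qed

text \<open>Two coefficient vectors of the same element of \<open>M\<close> differ by a relation, so
  the generators of \<open>K\<close> are sent to differences lying in
  \<open>rel_forms\<close>.\<close>

lemma preimage_K:
  assumes N: "ideal N S" "rel_forms \<subseteq> N"
  shows "K \<subseteq> {f \<in> carrier W. to_S f \<in> N}"
proof (rule W.genideal_minimal)
  interpret H: ring_hom_cring W S to_S using ring_hom_cring'[OF to_S(1) W.is_cring S.is_cring] .
  show "ideal {f \<in> carrier W. to_S f \<in> N} W"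
    using idealD(2,3,6)[OF N(1)] by (intro W.idealI') auto
  have "to_S (R.indexed_var (x \<oplus>\<^bsub>M\<^esub> y) \<ominus>\<^bsub>W\<^esub> (R.indexed_var x \<oplus>\<^bsub>W\<^esub> R.indexed_var y)) \<in> N"
    if xy: "x \<in> carrier M" "y \<in> carrier M" for x y
  proof -
    have "lin {..<n} (coords (x \<oplus>\<^bsub>M\<^esub> y)) \<ominus>\<^bsub>S\<^esub> lin {..<n} (\<lambda>i. coords x i \<oplus> coords y i) \<in> N"
      using N(2) xy coords by (intro subsetD[OF N(2)] diff_mem_rel_forms) (auto simp: comb_add)
    then show ?thesis using xy coords var_W lin_closed
      by (simp add: to_S(3) lin_add a_minus_def)
  qed
  moreover have "to_S (R.indexed_var (r \<odot>\<^bsub>M\<^esub> x) \<ominus>\<^bsub>W\<^esub> (R.indexed_const r \<otimes>\<^bsub>W\<^esub> R.indexed_var x)) \<in> N"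
    if xy: "r \<in> carrier R" "x \<in> carrier M" for r x
  proof -
    have "lin {..<n} (coords (r \<odot>\<^bsub>M\<^esub> x)) \<ominus>\<^bsub>S\<^esub> lin {..<n} (\<lambda>i. r \<otimes> coords x i) \<in> N"
      using N(2) xy coords by (intro subsetD[OF N(2)] diff_mem_rel_forms) (auto simp: comb_scale)
    then show ?thesis using xy coords var_W const_W lin_closed
      by (simp add: to_S(2,3) lin_scale a_minus_def)
  qed
  ultimately show "sym_relations R M \<subseteq> {f \<in> carrier W. to_S f \<in> N}"
    using relations_carrier unfolding sym_relations_def Let_def by blast
qed

lemma to_S_to_W:
  assumes N: "ideal N S" "rel_forms \<subseteq> N" and f: "f \<in> carrier S"
  shows "to_S (to_W f) \<ominus>\<^bsub>S\<^esub> f \<in> N"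
proof -
  have "(to_S \<circ> to_W) f \<ominus>\<^bsub>S\<^esub> id f \<in> N"
  proof (rule R.hom_agree_mod[OF S.is_cring ring_hom_trans[OF to_W(1) to_S(1)] id_ring_hom N(1) _ _ f])
    show "(to_S \<circ> to_W) (R.indexed_const a) \<ominus>\<^bsub>S\<^esub> id (R.indexed_const a) \<in> N" if "a \<in> carrier R" for a
      using that const_S idealD(2)[OF N(1)] by (simp add: to_S(2) to_W(2) a_minus_def S.r_neg)
    fix i assume i: "i \<in> {..<n}"
    have "lin {..<n} (coords (m i)) \<ominus>\<^bsub>S\<^esub> lin {..<n} (delta i) \<in> N"
      using i coords[OF m_closed'] delta_closed comb_delta
      by (intro subsetD[OF N(2)] diff_mem_rel_forms) auto
    then show "(to_S \<circ> to_W) (R.indexed_var i) \<ominus>\<^bsub>S\<^esub> id (R.indexed_var i) \<in> N"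
      using i m_closed' by (simp add: to_S(3) to_W(3) lin_delta)
  qed
  then show ?thesis by simp
qed

lemma to_W_to_S:
  assumes f: "f \<in> carrier W"
  shows "to_W (to_S f) \<ominus>\<^bsub>W\<^esub> f \<in> K"
proof -
  have "(to_W \<circ> to_S) f \<ominus>\<^bsub>W\<^esub> id f \<in> K"
  proof (rule R.hom_agree_mod[OF W.is_cring ring_hom_trans[OF to_S(1) to_W(1)] id_ring_hom K_ideal _ _ f])
    show "(to_W \<circ> to_S) (R.indexed_const a) \<ominus>\<^bsub>W\<^esub> id (R.indexed_const a) \<in> K" if "a \<in> carrier R" for a
      using that const_W idealD(2)[OF K_ideal] by (simp add: to_S(2) to_W(2) a_minus_def W.r_neg)
    fix x assume x: "x \<in> carrier M"
    then show "(to_W \<circ> to_S) (R.indexed_var x) \<ominus>\<^bsub>W\<^esub> id (R.indexed_var x) \<in> K"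
      using to_W_lin[of "{..<n}" "coords x"] coords[OF x] by (simp add: to_S(3))
  qed
  then show ?thesis by simp
qed

lemma preimage_rel_forms:
  assumes N: "ideal N W" "K \<subseteq> N"
  shows "rel_forms \<subseteq> {f \<in> carrier S. to_W f \<in> N}"
proof
  fix f assume "f \<in> rel_forms"
  then obtain c where c: "coeff_fun c" "comb {..<n} c = \<zero>\<^bsub>M\<^esub>" "f = lin {..<n} c"
    by (auto simp: rel_forms_def relations_def)
  have fS: "f \<in> carrier S" using c lin_closed by simp
  then have fW: "to_W f \<in> carrier W" using ring_hom_closed[OF to_W(1)] by blast
  have v: "R.indexed_var \<zero>\<^bsub>M\<^esub> \<in> carrier W" by (rule var_W) simp
  have "to_W f \<ominus>\<^bsub>W\<^esub> R.indexed_var \<zero>\<^bsub>M\<^esub> \<in> N"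
    using to_W_lin[of "{..<n}" c] c N(2) by auto
  then have "(to_W f \<ominus>\<^bsub>W\<^esub> R.indexed_var \<zero>\<^bsub>M\<^esub>) \<oplus>\<^bsub>W\<^esub> R.indexed_var \<zero>\<^bsub>M\<^esub> \<in> N"
    using K_zero N idealD(3)[OF N(1)] by blast
  moreover have "(to_W f \<ominus>\<^bsub>W\<^esub> y) \<oplus>\<^bsub>W\<^esub> y = to_W f" if "y \<in> carrier W" for y
    using that fW by algebra
  ultimately show "f \<in> {f \<in> carrier S. to_W f \<in> N}" using fS v by simp
qed

text \<open>The path is pulled back to \<open>W\<close>, pushed to the symmetric algebra, replaced
  there by one from the minimal prime corresponding to \<open>q\<close>, and carried back. Both
  comparison maps are surjective modulo the primes that occur.\<close>

lemma sym_equidimensional_path: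
  assumes eq: "equidimensional (sym_algebra R M)" and q: "minimal_prime_over S rel_forms q"
    and path: "prime_path S k U V" and U: "rel_forms \<subseteq> U"
  obtains l Z where "k \<le> l" "prime_path S l q Z"
proof -
  let ?B = "W Quot K"
  define h where "h = (+>\<^bsub>W\<^esub>) K"
  note qh = quotient_hom[OF W.is_cring K_ideal, folded h_def]
  have qp: "primeideal q S" and qJ: "rel_forms \<subseteq> q" using q by (auto simp: minimal_prime_over_def)
  note qi = primeideal.axioms(1)[OF qp]
  define q' where "q' = {f \<in> carrier W. to_S f \<in> q}"
  have q'p: "primeideal q' W" unfolding q'_def by (rule preimage_prime[OF to_S(1) W.is_cring S.is_cring qp])
  have q'K: "K \<subseteq> q'" unfolding q'_def by (rule preimage_K[OF qi qJ])
  have ker: "a \<in> N" if "K \<subseteq> N" "a \<in> carrier W" "h a = \<zero>\<^bsub>?B\<^esub>" for a N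
    using qh(4)[OF that(2)] that by blast
  have Up: "primeideal U S" using prime_path_primes[OF path] by blast
  note Ui = primeideal.axioms(1)[OF Up]
  have "prime_path W k {f \<in> carrier W. to_S f \<in> U} {f \<in> carrier W. to_S f \<in> V}"
  proof (rule prime_path_pullback_mod[OF to_S(1) W.is_cring S.is_cring path])
    show "\<exists>a\<in>carrier W. to_S a \<ominus>\<^bsub>S\<^esub> b \<in> U" if "b \<in> carrier S" for b
      using to_S_to_W[OF Ui U that] ring_hom_closed[OF to_W(1) that] by blast
  qed
  then have pathB: "prime_path ?B k (h ` {f \<in> carrier W. to_S f \<in> U}) (h ` {f \<in> carrier W. to_S f \<in> V})"
    by (rule prime_path_surj_image[OF qh(2) W.is_cring qh(1,3)]) (rule ker[OF preimage_K[OF Ui U]])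
  note img = image_prime[OF qh(2) W.is_cring qh(1,3) q'p ker[OF q'K]]
  have h_back: "{f \<in> carrier W. h f \<in> h ` q'} = q'"
    using img(2) primeideal_subset[OF q'p] by blast
  have "minimal_prime_over ?B {\<zero>\<^bsub>?B\<^esub>} (h ` q')"
    unfolding minimal_prime_over_def
  proof (intro conjI allI impI)
    show "primeideal (h ` q') ?B" by (rule img(1))
    then show "{\<zero>\<^bsub>?B\<^esub>} \<subseteq> h ` q'" using primeD(2) by blast
    fix p assume p: "primeideal p ?B" "p \<subseteq> h ` q'"
    define p' where "p' = {f \<in> carrier W. h f \<in> p}"
    have p'p: "primeideal p' W" unfolding p'_def by (rule preimage_prime[OF qh(2) W.is_cring qh(1) p(1)])
    note p'i = primeideal.axioms(1)[OF p'p]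
    have p'K: "K \<subseteq> p'"
    proof
      fix f assume f: "f \<in> K"
      then have "f \<in> carrier W" "h f = \<zero>\<^bsub>?B\<^esub>" using idealD(1)[OF K_ideal] qh(4)[of f] by auto
      then show "f \<in> p'" using primeD(2)[OF p(1)] by (simp add: p'_def)
    qed
    have p'q: "p' \<subseteq> q'" unfolding p'_def using p(2) h_back by blast
    \<comment> \<open>Minimality is tested in \<open>S\<close>: the pullback of \<open>p'\<close>
      contains \<open>rel_forms\<close> and is contained in \<open>q\<close>, so it equals
      \<open>q\<close>. The return trip through \<open>to_S\<close> then gives the inclusion of
      \<open>q'\<close> in \<open>p'\<close>.\<close>
    let ?p = "{f \<in> carrier S. to_W f \<in> p'}"
    have pp: "primeideal ?p S" by (rule preimage_prime[OF to_W(1) S.is_cring W.is_cring p'p])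
    have "?p \<subseteq> q"
    proof
      fix f assume f: "f \<in> ?p"
      then have fS: "f \<in> carrier S" "to_S (to_W f) \<in> q" using p'q by (auto simp: q'_def)
      have "to_S (to_W f) \<ominus>\<^bsub>S\<^esub> (to_S (to_W f) \<ominus>\<^bsub>S\<^esub> f) \<in> q"
        using idealD(5)[OF qi fS(2) to_S_to_W[OF qi qJ fS(1)]] .
      moreover have "y \<ominus>\<^bsub>S\<^esub> (y \<ominus>\<^bsub>S\<^esub> f) = f" if "y \<in> carrier S" for y using that fS(1) by algebra
      ultimately show "f \<in> q" using fS(2) primeideal_subset[OF qp] by auto
    qed
    then have eqq: "?p = q" using q pp preimage_rel_forms[OF p'i p'K] unfolding minimal_prime_over_def by blast
    have "q' \<subseteq> p'"
    proof
      fix f assume f: "f \<in> q'"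
      then have fW: "f \<in> carrier W" "to_W (to_S f) \<in> p'" using eqq by (auto simp: q'_def)
      have "to_W (to_S f) \<ominus>\<^bsub>W\<^esub> (to_W (to_S f) \<ominus>\<^bsub>W\<^esub> f) \<in> p'"
        using idealD(5)[OF p'i fW(2)] to_W_to_S[OF fW(1)] p'K by blast
      moreover have "y \<ominus>\<^bsub>W\<^esub> (y \<ominus>\<^bsub>W\<^esub> f) = f" if "y \<in> carrier W" for y using that fW(1) by algebra
      ultimately show "f \<in> p'" using fW(2) primeideal_subset[OF p'p] by auto
    qed
    then show "p = h ` q'" using p(2) unfolding p'_def by blast
  qed
  then obtain l Z where l: "k \<le> l" "prime_path ?B l (h ` q') Z"
    using equidimensional_path[OF qh(1) _ _ pathB] eq unfolding sym_algebra_def by blast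
  have pathW: "prime_path W l q' {f \<in> carrier W. h f \<in> Z}"
    using prime_path_surj_pullback[OF qh(2) W.is_cring qh(1,3) l(2)] h_back by simp
  have "prime_path S l {f \<in> carrier S. to_W f \<in> q'} {f \<in> carrier S. to_W f \<in> {f \<in> carrier W. h f \<in> Z}}"
  proof (rule prime_path_pullback_mod[OF to_W(1) S.is_cring W.is_cring pathW])
    show "\<exists>a\<in>carrier S. to_W a \<ominus>\<^bsub>W\<^esub> b \<in> q'" if "b \<in> carrier W" for b
      using to_W_to_S[OF that] ring_hom_closed[OF to_S(1) that] q'K by blast
  qed
  \<comment> \<open>The round trip through \<open>W\<close> changes \<open>f\<close> by an element
    of \<open>q\<close>.\<close>
  moreover have "{f \<in> carrier S. to_W f \<in> q'} = q"
  proof -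
    have "to_S (to_W f) \<in> q \<longleftrightarrow> f \<in> q" if f: "f \<in> carrier S" for f
    proof -
      define y where "y = to_S (to_W f)"
      have y: "y \<in> carrier S" "to_W f \<in> carrier W" unfolding y_def
        using f ring_hom_closed[OF to_W(1)] ring_hom_closed[OF to_S(1)] by auto
      have d: "y \<ominus>\<^bsub>S\<^esub> f \<in> q" unfolding y_def using to_S_to_W[OF qi qJ f] .
      have "y = (y \<ominus>\<^bsub>S\<^esub> f) \<oplus>\<^bsub>S\<^esub> f" "f = y \<ominus>\<^bsub>S\<^esub> (y \<ominus>\<^bsub>S\<^esub> f)" using y f by algebra+
      then show ?thesis unfolding y_def[symmetric] using idealD(3)[OF qi d] idealD(5)[OF qi _ d] by metis
    qed
    then show ?thesis unfolding q'_def
      using primeideal_subset[OF qp] ring_hom_closed[OF to_W(1)] by auto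
  qed
  ultimately show thesis using that l(1) by simp
qed

end

section \<open>Height estimate\<close>

lemma (in cring) coeff_const_mult_var:
  assumes "a \<in> carrier R"
  shows "(indexed_const a \<otimes>\<^bsub>PR V\<^esub> indexed_var i) {#i#} = a"
  using assms pmul_const[of a "indexed_var i"]
  by (simp add: mpoly_simps indexed_var_def indexed_pmult_def indexed_const_def)

context generated_module
begin

abbreviation "sprime \<equiv> subst_prime R {..<n}"
abbreviation "sev \<equiv> subst_ev R {..<n}"
abbreviation "substitution g \<equiv> (\<forall>i::nat. g i \<in> carrier S)"

lemma sev_hom: "substitution g \<Longrightarrow> ring_hom_cring S S (sev g)"
  using ring_hom_cring'[OF R.subst_ev_simps(1) S.is_cring S.is_cring] by blast

lemma sev_lin:
  assumes "substitution g" "finite F" "F \<subseteq> {..<n}" "coeff_fun c"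
  shows "sev g (lin F c) = (\<Oplus>\<^bsub>S\<^esub>i\<in>F. R.indexed_const (c i) \<otimes>\<^bsub>S\<^esub> g i)"
  using assms(2,3)
proof (induction F)
  interpret H: ring_hom_cring S S "sev g" using sev_hom[OF assms(1)] .
  {
    case empty
    then show ?case by (simp add: lin_def)
  next
    case (insert i F)
    have g: "\<And>i. g i \<in> carrier S" using assms(1) by blast
    show ?case
      using insert assms lin_closed[of F c] const_S var_S R.subst_ev_simps(2,3)[OF g]
      by (simp add: lin_insert)
  }
qed

text \<open>Constants detect strictness: a constant lies in the substituted prime exactly if it lies
  in the original prime of \<open>R\<close>.\<close>

lemma sprime_path:
  assumes g: "substitution g" and path: "prime_path R k U V"
  shows "prime_path S k (sprime g U) (sprime g V)"
  using path
proof (induction rule: prime_path.induct)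
  case (prime_path_0 U)
  then show ?case using R.subst_prime_prime g by (intro prime_path.prime_path_0) blast
next
  case (prime_path_Suc U Y k Z)
  have g': "\<And>i. g i \<in> carrier S" using g by blast
  have Y: "primeideal Y R" using prime_path_primes[OF prime_path_Suc(3)] by blast
  obtain y where y: "y \<in> Y" "y \<notin> U" using prime_path_Suc(2) by blast
  have yc: "y \<in> carrier R" using y primeideal_subset[OF Y] by blast
  have "R.indexed_const y \<in> sprime g Y" "R.indexed_const y \<notin> sprime g U"
    using R.subst_prime_contract[OF g' primeideal.axioms(1)[OF Y] yc] y
      R.subst_prime_contract[OF g' primeideal.axioms(1)[OF prime_path_Suc(1)] yc] by auto
  moreover have "sprime g U \<subseteq> sprime g Y"
    using prime_path_Suc(2) unfolding subst_prime_def R.coeffs_in_def by blast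
  ultimately have "sprime g U \<subset> sprime g Y" by blast
  then show ?case using prime_path_Suc R.subst_prime_prime[OF g' prime_path_Suc(1)]
    by (intro prime_path.prime_path_Suc)
qed

lemma contraction_sprime:
  assumes "substitution g" "primeideal Q R"
  shows "R.contraction (sprime g Q) = Q"
proof -
  have g: "\<And>i. g i \<in> carrier S" using assms(1) by blast
  show ?thesis
    using R.subst_prime_contract[OF g primeideal.axioms(1)[OF assms(2)]] primeideal_subset[OF assms(2)]
    unfolding R.contraction_def by auto
qed

lemma sprime_prime: "substitution g \<Longrightarrow> primeideal Q R \<Longrightarrow> primeideal (sprime g Q) S"
  by (rule R.subst_prime_prime) auto

text \<open>Setting the variables equal to constants one at a time gives a strictly increasing chain.\<close>

lemma path_to_point:
  assumes Q: "primeideal Q R" and b: "coeff_fun b" and U: "finite U" "U \<subseteq> {..<n}"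
  shows "prime_path S (card U) (sprime (\<lambda>i. if i \<in> U then R.indexed_var i else R.indexed_const (b i)) Q)
    (sprime (\<lambda>i. R.indexed_const (b i)) Q)"
  using U
proof (induction U)
  case empty
  then show ?case using sprime_prime[OF _ Q] b const_S by (simp add: prime_path_0)
next
  case (insert j U)
  define g where "g = (\<lambda>i. if i \<in> insert j U then R.indexed_var i else R.indexed_const (b i))"
  define g' where "g' = (\<lambda>i. if i \<in> U then R.indexed_var i else R.indexed_const (b i))"
  \<comment> \<open>The specialisation of the single variable \<open>X_j\<close> to
    \<open>b j\<close>; composing it with \<open>g\<close> gives \<open>g'\<close>. At indices from
    \<open>n\<close> on the value is only a default.\<close>
  define t where "t = (\<lambda>i. if i < n \<and> i \<noteq> j then R.indexed_var i else R.indexed_const (b i))"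
  have g: "substitution g" and g': "substitution g'" and t: "substitution t"
    using insert b const_S var_S by (auto simp: g_def g'_def t_def)
  have gs: "\<And>i. g i \<in> carrier S" "\<And>i. g' i \<in> carrier S" "\<And>i. t i \<in> carrier S" using g g' t by auto
  have sub: "sprime g Q \<subseteq> sprime g' Q"
  proof (rule R.subst_prime_mono[OF gs(1,3,2) _ primeideal.axioms(1)[OF Q]])
    show "sev t (g i) = g' i" if "i \<in> {..<n}" for i
      using insert b R.subst_ev_simps(2,3)[OF gs(3)] that by (auto simp: g_def g'_def t_def)
  qed
  \<comment> \<open>The witness for strictness: \<open>X_j - b_j\<close> vanishes after
    specialisation, but before it has coefficient one at \<open>X_j\<close>.\<close>
  define f where "f = R.indexed_var j \<ominus>\<^bsub>S\<^esub> R.indexed_const (b j)"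
  have j: "j < n" using insert by auto
  have cl: "R.indexed_var j \<in> carrier S" "R.indexed_const (b j) \<in> carrier S" using j b const_S var_S by auto
  have evf: "sev h f = h j \<ominus>\<^bsub>S\<^esub> R.indexed_const (b j)" if h: "substitution h" for h
  proof -
    interpret H: ring_hom_cring S S "sev h" using sev_hom[OF h] .
    have h': "\<And>i. h i \<in> carrier S" using h by blast
    show ?thesis unfolding f_def a_minus_def using cl b R.subst_ev_simps(2,3)[OF h'] by simp
  qed
  have fS: "f \<in> carrier S" unfolding f_def using cl by simp
  have "sev g' f = \<zero>\<^bsub>S\<^esub>" unfolding evf[OF g'] using insert cl by (simp add: g'_def a_minus_def S.r_neg)
  then have "f \<in> sprime g' Q"
    using fS idealD(2)[OF R.coeffs_in_ideal[OF primeideal.axioms(1)[OF Q]], of "{..<n}"]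
    by (simp add: subst_prime_def)
  moreover have "f \<notin> sprime g Q"
  proof
    assume "f \<in> sprime g Q"
    then have "f \<in> R.coeffs_in {..<n} Q" using evf[OF g] by (simp add: subst_prime_def g_def f_def)
    then have "f {#j#} \<in> Q" by (simp add: R.coeffs_in_def)
    moreover have "R.indexed_var j = f \<oplus>\<^bsub>S\<^esub> R.indexed_const (b j)" unfolding f_def using cl by algebra
    then have "R.indexed_var j {#j#} = f {#j#} \<oplus> R.indexed_const (b j) {#j#}"
      by (simp add: R.mpoly_simps R.indexed_padd_def)
    then have "f {#j#} = \<one>"
      using R.mpoly_coeffs[OF fS] by (simp add: R.indexed_var_def R.indexed_pmult_def R.indexed_const_def)
    ultimately show False using primeideal_one_notin[OF Q] by simp
  qed
  ultimately have "sprime g Q \<subset> sprime g' Q" using sub by blast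
  moreover have "prime_path S (card U) (sprime g' Q) (sprime (\<lambda>i. R.indexed_const (b i)) Q)"
    using insert by (simp add: g'_def)
  ultimately have "prime_path S (Suc (card U)) (sprime g Q) (sprime (\<lambda>i. R.indexed_const (b i)) Q)"
    using sprime_prime[OF g Q] by (intro prime_path_Suc)
  then show ?case using insert by (simp add: g_def)
qed

lemma zero_substitution: "(\<lambda>i. R.indexed_const \<zero>) = (\<lambda>i. \<zero>\<^bsub>S\<^esub>)"
  by (simp add: R.mpoly_simps)

text \<open>This is the lower bound for heights in the polynomial ring: the path of \<open>R\<close>
  is lifted coefficientwise, and \<open>n\<close> further steps come from specialising the variables
  to \<open>b\<close>.\<close>

lemma path_from_extension:
  assumes U: "primeideal U R" and b: "coeff_fun b" and path: "prime_path R k U Q"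
  shows "prime_path S (k + n) (R.coeffs_in {..<n} U) (sprime (\<lambda>i. R.indexed_const (b i)) Q)"
proof -
  let ?g = "\<lambda>i. if i \<in> {..<n} then R.indexed_var i else R.indexed_const (b i)"
  have g: "substitution ?g" using b const_S var_S by auto
  have "sev ?g f = f" if "f \<in> carrier S" for f
    by (rule R.subst_ev_id[OF _ _ that]) (use g in auto)
  then have "sprime ?g U = R.coeffs_in {..<n} U"
    by (auto simp: subst_prime_def R.coeffs_in_def)
  then have "prime_path S k (R.coeffs_in {..<n} U) (sprime ?g Q)" using sprime_path[OF g path] by simp
  moreover have "primeideal Q R" using prime_path_primes[OF path] by blast
  ultimately show ?thesis using path_to_point[OF _ b, of Q "{..<n}"] prime_path_trans by fastforce
qed

section \<open>Minimal local generators and the fibre over Q\<close>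

definition generates_at :: "'a set \<Rightarrow> nat set \<Rightarrow> bool"
  where "generates_at Q T \<longleftrightarrow>
    (\<forall>x\<in>carrier M. \<exists>s\<in>carrier R - Q. \<exists>r. coeff_fun r \<and> s \<odot>\<^bsub>M\<^esub> x = comb T r)"

text \<open>A relation with coefficient \<open>d k\<close> outside \<open>Q\<close> would express
  \<open>m k\<close> through the others up to a denominator, so \<open>k\<close> could be dropped
  from \<open>T\<close>.\<close>

lemma minimal_generating_independent:
  assumes Q: "primeideal Q R" and T: "finite T" "generates_at Q T"
    and min: "\<And>T'. T' \<subset> T \<Longrightarrow> \<not> generates_at Q T'"
    and d: "coeff_fun d" "comb T d = \<zero>\<^bsub>M\<^esub>" and k: "k \<in> T"
  shows "d k \<in> Q"
proof (rule ccontr)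
  assume dk: "d k \<notin> Q"
  let ?T = "T - {k}"
  have split: "comb T c = c k \<odot>\<^bsub>M\<^esub> m k \<oplus>\<^bsub>M\<^esub> comb ?T c" if "coeff_fun c" for c
    using comb_insert[of ?T k c] that T(1) k by (simp add: insert_absorb)
  have "generates_at Q ?T"
    unfolding generates_at_def
  proof
    fix x assume x: "x \<in> carrier M"
    then obtain s r where s: "s \<in> carrier R - Q" "coeff_fun r" "s \<odot>\<^bsub>M\<^esub> x = comb T r"
      using T(2) unfolding generates_at_def by blast
    \<comment> \<open>This combination has zero entry at \<open>k\<close>. Since \<open>d\<close> is
      a relation, it still represents \<open>d k\<close> times the element represented by
      \<open>r\<close>.\<close>
    define e where "e = (\<lambda>i. d k \<otimes> r i \<oplus> (\<ominus> \<one>) \<otimes> (r k \<otimes> d i))"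
    have e: "coeff_fun e" using d s by (simp add: e_def)
    have ek: "e k = \<zero>" using d s by (simp add: e_def R.l_minus R.m_comm R.r_neg)
    have "comb T e = comb T (\<lambda>i. d k \<otimes> r i) \<ominus>\<^bsub>M\<^esub> comb T (\<lambda>i. r k \<otimes> d i)"
      unfolding e_def using d s T(1) comb_diff[of T "\<lambda>i. d k \<otimes> r i" "\<lambda>i. r k \<otimes> d i"] by simp
    also have "\<dots> = d k \<odot>\<^bsub>M\<^esub> (s \<odot>\<^bsub>M\<^esub> x)"
      using d s T(1) x comb_closed[OF s(2), of T] by (simp add: comb_scale a_minus_def)
    also have "\<dots> = (d k \<otimes> s) \<odot>\<^bsub>M\<^esub> x" using d s x by (simp add: smult_assoc1)
    finally have "(d k \<otimes> s) \<odot>\<^bsub>M\<^esub> x = comb ?T e"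
      using split[OF e] ek m_closed' comb_closed[OF e] by simp
    moreover have "d k \<otimes> s \<in> carrier R - Q" using R.prime_compl_mult[OF Q, of "d k" s] d s dk by blast
    ultimately show "\<exists>s\<in>carrier R - Q. \<exists>r. coeff_fun r \<and> s \<odot>\<^bsub>M\<^esub> x = comb ?T r" using e by blast
  qed
  then show False using min[of ?T] k by blast
qed

text \<open>The denominators of the individual generators are multiplied together one by one, and
  the coefficients found earlier are rescaled.\<close>

lemma common_denominator:
  assumes Q: "primeideal Q R" and T: "finite T" "generates_at Q T"
  obtains u c where "u \<in> carrier R - Q" "\<And>i. coeff_fun (c i)" "\<And>i. i < k \<Longrightarrow> u \<odot>\<^bsub>M\<^esub> m i = comb T (c i)"
proof -
  have "\<exists>u c. u \<in> carrier R - Q \<and> (\<forall>i. coeff_fun (c i)) \<and> (\<forall>i<k. u \<odot>\<^bsub>M\<^esub> m i = comb T (c i))" for k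
  proof (induction k)
    case 0
    have "\<one> \<in> carrier R - Q" using primeideal_one_notin[OF Q] by simp
    then show ?case by (intro exI[of _ \<one>] exI[of _ "\<lambda>_ _. \<zero>"]) auto
  next
    case (Suc k)
    then obtain u c where u: "u \<in> carrier R - Q" "\<forall>i. coeff_fun (c i)" "\<forall>i<k. u \<odot>\<^bsub>M\<^esub> m i = comb T (c i)" by blast
    obtain s r where s: "s \<in> carrier R - Q" "coeff_fun r" "s \<odot>\<^bsub>M\<^esub> m k = comb T r"
      using T(2) m_closed' unfolding generates_at_def by blast
    define e where "e = (\<lambda>i j. if i = k then u \<otimes> r j else s \<otimes> c i j)"
    have "coeff_fun (e i)" for i using u s by (auto simp: e_def)
    moreover have "(u \<otimes> s) \<odot>\<^bsub>M\<^esub> m i = comb T (e i)" if "i < Suc k" for i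
    proof (cases "i = k")
      case True
      then have "comb T (e i) = u \<odot>\<^bsub>M\<^esub> comb T r" using comb_scale[OF T(1) s(2), of u] u(1) by (simp add: e_def)
      also have "\<dots> = (u \<otimes> s) \<odot>\<^bsub>M\<^esub> m k" unfolding s(3)[symmetric] using u(1) s(1) m_closed' by (simp add: smult_assoc1)
      finally show ?thesis using True by simp
    next
      case False
      then have "comb T (e i) = s \<odot>\<^bsub>M\<^esub> comb T (c i)" using comb_scale[OF T(1), of "c i" s] u(2) s(1) by (simp add: e_def)
      moreover have "comb T (c i) = u \<odot>\<^bsub>M\<^esub> m i" using False that u by simp
      ultimately show ?thesis using u(1) s(1) m_closed' by (simp add: smult_assoc1[symmetric] R.m_comm)
    qed
    ultimately show ?case using R.prime_compl_mult[OF Q u(1) s(1)] by blast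
  qed
  then show thesis using that by blast
qed

text \<open>Replacing \<open>X_i\<close> by the form in \<open>T\<close> that represents
  \<open>u m_i\<close> turns a linear form into one representing \<open>u\<close> times the original
  combination. Relations thus become relations among the members of \<open>T\<close>.\<close>

lemma lin_combination:
  assumes T: "finite T" "T \<subseteq> {..<n}" and c: "\<And>i. coeff_fun (c i)"
    and u: "u \<in> carrier R" "\<And>i. i < n \<Longrightarrow> u \<odot>\<^bsub>M\<^esub> m i = comb T (c i)"
    and a: "coeff_fun a" and F: "finite F" "F \<subseteq> {..<n}"
  shows "\<exists>d. coeff_fun d \<and> (\<Oplus>\<^bsub>S\<^esub>i\<in>F. R.indexed_const (a i) \<otimes>\<^bsub>S\<^esub> lin T (c i)) = lin T d \<and>
    u \<odot>\<^bsub>M\<^esub> comb F a = comb T d"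
  using F
proof (induction F)
  case empty
  have "lin T (\<lambda>_. \<zero>) = R.indexed_const \<zero> \<otimes>\<^bsub>S\<^esub> lin T (\<lambda>_. \<zero>)"
    using lin_scale[OF T, of "\<lambda>_. \<zero>" \<zero>] by simp
  moreover have "R.indexed_const \<zero> = \<zero>\<^bsub>S\<^esub>" by (simp add: R.mpoly_simps)
  ultimately have "lin T (\<lambda>_. \<zero>) = \<zero>\<^bsub>S\<^esub>" using lin_closed[OF T(2), of "\<lambda>_. \<zero>"] S.l_null by fastforce
  moreover have "comb T (\<lambda>_. \<zero>) = \<zero>\<^bsub>M\<^esub>"
    using comb_scale[OF T(1), of "\<lambda>_. \<zero>" \<zero>] comb_closed[of "\<lambda>_. \<zero>" T] by simp
  ultimately show ?case using u by (intro exI[of _ "\<lambda>_. \<zero>"]) (simp add: comb_def[of "{}"])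
next
  case (insert i F)
  then obtain d where d: "coeff_fun d"
    "(\<Oplus>\<^bsub>S\<^esub>i\<in>F. R.indexed_const (a i) \<otimes>\<^bsub>S\<^esub> lin T (c i)) = lin T d" "u \<odot>\<^bsub>M\<^esub> comb F a = comb T d" by auto
  have cl: "(\<lambda>i. R.indexed_const (a i) \<otimes>\<^bsub>S\<^esub> lin T (c i)) \<in> insert i F \<rightarrow> carrier S"
    using a c const_S lin_closed[OF T(2)] by auto
  have ac: "coeff_fun (\<lambda>j. a i \<otimes> c i j)" using a c by simp
  have "(\<Oplus>\<^bsub>S\<^esub>i\<in>insert i F. R.indexed_const (a i) \<otimes>\<^bsub>S\<^esub> lin T (c i)) =
      R.indexed_const (a i) \<otimes>\<^bsub>S\<^esub> lin T (c i) \<oplus>\<^bsub>S\<^esub> lin T d"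
    using S.finsum_insert[of F i] insert cl d(2) by auto
  also have "\<dots> = lin T (\<lambda>j. a i \<otimes> c i j \<oplus> d j)"
    using lin_scale[OF T c, of "a i" i] lin_add[OF T(2) ac d(1)] a by simp
  finally have 1: "(\<Oplus>\<^bsub>S\<^esub>i\<in>insert i F. R.indexed_const (a i) \<otimes>\<^bsub>S\<^esub> lin T (c i)) = lin T (\<lambda>j. a i \<otimes> c i j \<oplus> d j)" .
  have "u \<odot>\<^bsub>M\<^esub> comb (insert i F) a = u \<odot>\<^bsub>M\<^esub> (a i \<odot>\<^bsub>M\<^esub> m i) \<oplus>\<^bsub>M\<^esub> u \<odot>\<^bsub>M\<^esub> comb F a"
    using insert a u comb_closed[OF a] m_closed' by (simp add: comb_insert smult_r_distr)
  also have "u \<odot>\<^bsub>M\<^esub> (a i \<odot>\<^bsub>M\<^esub> m i) = a i \<odot>\<^bsub>M\<^esub> (u \<odot>\<^bsub>M\<^esub> m i)"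
    using a u m_closed' by (simp add: smult_assoc1[symmetric] R.m_comm)
  also have "\<dots> = comb T (\<lambda>j. a i \<otimes> c i j)" using insert u(2)[of i] comb_scale[OF T(1) c, of "a i" i] a by simp
  finally have "u \<odot>\<^bsub>M\<^esub> comb (insert i F) a = comb T (\<lambda>j. a i \<otimes> c i j \<oplus> d j)"
    using d(3) comb_add[OF ac d(1)] by simp
  then show ?case using 1 ac d(1) by (intro exI[of _ "\<lambda>j. a i \<otimes> c i j \<oplus> d j"]) simp
qed

text \<open>Over \<open>Q\<close> the symmetric algebra becomes a polynomial ring over the residue field in the
  variables of a minimal local generating set \<open>T\<close>. Multiplying by a common denominator \<open>u\<close>
  realises the quotient map by a substitution with values in \<open>R[X]\<close>.\<close>

lemma fibre_path:
  assumes Q: "primeideal Q R"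
  obtains t U where "local_min_generators R Q M \<le> enat t" "rel_forms \<subseteq> U"
    "prime_path S t U (sprime (\<lambda>i. \<zero>\<^bsub>S\<^esub>) Q)"
proof -
  have "generates_at Q {..<n}"
    unfolding generates_at_def
  proof
    fix x assume x: "x \<in> carrier M"
    then have "\<one> \<odot>\<^bsub>M\<^esub> x = comb {..<n} (coords x)" using coords by simp
    moreover have "\<one> \<in> carrier R - Q" using primeideal_one_notin[OF Q] by simp
    ultimately show "\<exists>s\<in>carrier R - Q. \<exists>r. coeff_fun r \<and> s \<odot>\<^bsub>M\<^esub> x = comb {..<n} r"
      using coords(1)[OF x] by blast
  qed
  then have "{T. T \<subseteq> {..<n} \<and> generates_at Q T} \<noteq> {}" by blast
  moreover have "finite {T. T \<subseteq> {..<n} \<and> generates_at Q T}" by simp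
  ultimately obtain T where "T \<in> {T. T \<subseteq> {..<n} \<and> generates_at Q T}"
    and Tmin: "\<And>T'. T' \<in> {T. T \<subseteq> {..<n} \<and> generates_at Q T} \<Longrightarrow> T' \<subseteq> T \<Longrightarrow> T = T'"
    using finite_has_minimal[of "{T. T \<subseteq> {..<n} \<and> generates_at Q T}"] by metis
  then have T: "T \<subseteq> {..<n}" "generates_at Q T" by auto
  have fin: "finite T" using T finite_subset by blast
  have min: "\<not> generates_at Q T'" if "T' \<subset> T" for T' using Tmin[of T'] that T(1) by blast
  have le: "local_min_generators R Q M \<le> enat (card T)"
  proof (rule local_min_generators_le[OF module_axioms Q fin m_closed'])
    show "\<exists>s\<in>carrier R - Q. \<exists>r. (\<forall>i\<in>T. r i \<in> carrier R) \<and> s \<odot>\<^bsub>M\<^esub> x = (\<Oplus>\<^bsub>M\<^esub>i\<in>T. r i \<odot>\<^bsub>M\<^esub> m i)"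
      if "x \<in> carrier M" for x
      using T(2) that unfolding generates_at_def comb_def by blast
  qed
  obtain u c0 where u: "u \<in> carrier R - Q" and c0: "\<And>i. coeff_fun (c0 i)"
    "\<And>i. i < n \<Longrightarrow> u \<odot>\<^bsub>M\<^esub> m i = comb T (c0 i)"
    using common_denominator[OF Q fin T(2)] by blast
  have uc: "u \<in> carrier R" using u by blast
  \<comment> \<open>For \<open>i\<close> in \<open>T\<close> the coordinates of \<open>u m_i\<close>
    are taken to be \<open>u\<close> times the unit vector, so that the substitution multiplies
    these variables by \<open>u\<close>.\<close>
  define c where "c = (\<lambda>i. if i \<in> T then (\<lambda>j. u \<otimes> delta i j) else c0 i)"
  have c: "coeff_fun (c i)" for i using c0 uc delta_closed by (auto simp: c_def)
  have uc_eq: "u \<odot>\<^bsub>M\<^esub> m i = comb T (c i)" if "i < n" for i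
    using c0(2)[OF that] comb_scale[OF fin delta_closed[of i] uc] comb_delta[OF fin] by (auto simp: c_def)
  \<comment> \<open>For \<open>U = T\<close> this substitution kills the relations modulo
    \<open>Q\<close>; shrinking \<open>U\<close> drops variables until all \<open>X_i\<close> go to
    zero.\<close>
  define g where "g = (\<lambda>U i. lin U (c i))"
  have gs: "g U i \<in> carrier S" if "U \<subseteq> T" for U i unfolding g_def using c T that by (intro lin_closed) auto
  have rel: "rel_forms \<subseteq> sprime (g T) Q"
  proof
    fix f assume "f \<in> rel_forms"
    then obtain a where a: "coeff_fun a" "comb {..<n} a = \<zero>\<^bsub>M\<^esub>" "f = lin {..<n} a"
      by (auto simp: rel_forms_def relations_def)
    obtain d where d: "coeff_fun d"
      "(\<Oplus>\<^bsub>S\<^esub>i\<in>{..<n}. R.indexed_const (a i) \<otimes>\<^bsub>S\<^esub> lin T (c i)) = lin T d" "u \<odot>\<^bsub>M\<^esub> comb {..<n} a = comb T d"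
      using lin_combination[OF fin T(1) c uc uc_eq a(1), of "{..<n}"] by auto
    have "comb T d = \<zero>\<^bsub>M\<^esub>" using d(3) a(2) uc by simp
    \<comment> \<open>Minimality of \<open>T\<close> puts the coefficients of the rewritten relation
      into \<open>Q\<close>, so its form vanishes modulo \<open>Q\<close>.\<close>
    then have dQ: "d k \<in> Q" if "k \<in> T" for k
      using minimal_generating_independent[OF Q fin T(2) min d(1) _ that] by blast
    have ci: "ideal (R.coeffs_in {..<n} Q) S" by (rule R.coeffs_in_ideal[OF primeideal.axioms(1)[OF Q]])
    have "lin T d \<in> R.coeffs_in {..<n} Q" unfolding lin_def
    proof (rule S.finsum_in_ideal[OF ci])
      fix k assume k: "k \<in> T"
      then have "R.indexed_const (d k) \<in> R.coeffs_in {..<n} Q"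
        using R.const_in_coeffs_in[OF primeideal.axioms(1)[OF Q] dQ] by blast
      then show "R.indexed_const (d k) \<otimes>\<^bsub>S\<^esub> R.indexed_var k \<in> R.coeffs_in {..<n} Q"
        using idealD(7)[OF ci] var_S k T(1) by blast
    qed
    moreover have "sev (g T) f = lin T d"
      using sev_lin[of "g T" "{..<n}" a] gs a d(2) by (simp add: g_def)
    moreover have "f \<in> carrier S" using a lin_closed by simp
    ultimately show "f \<in> sprime (g T) Q" by (simp add: subst_prime_def)
  qed
  have path: "prime_path S (card U) (sprime (g U) Q) (sprime (g {}) Q)" if "finite U" "U \<subseteq> T" for U
    using that
  proof (induction U)
    case empty
    then show ?case using sprime_prime[OF _ Q] gs[of "{}"] by (simp add: prime_path_0)
  next
    case (insert j U)
    have j: "j \<in> T" "j < n" and UT: "U \<subseteq> T" "insert j U \<subseteq> T" "U \<subseteq> {..<n}" "insert j U \<subseteq> {..<n}"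
      using insert T by auto
    \<comment> \<open>Setting \<open>X_j\<close> to zero turns the substitution for
      \<open>insert j U\<close> into the one for \<open>U\<close>.\<close>
    define t where "t = (\<lambda>i. if i < n \<and> i \<noteq> j then R.indexed_var i else \<zero>\<^bsub>S\<^esub>)"
    have t: "substitution t" using var_S by (auto simp: t_def)
    have ts: "\<And>i. t i \<in> carrier S" using t by blast
    have sub: "sprime (g (insert j U)) Q \<subseteq> sprime (g U) Q"
    proof (rule R.subst_prime_mono[OF gs[OF UT(2)] ts gs[OF UT(1)] _ primeideal.axioms(1)[OF Q]])
      fix i assume i: "i \<in> {..<n}"
      have "sev t (g (insert j U) i) = (\<Oplus>\<^bsub>S\<^esub>k\<in>insert j U. R.indexed_const (c i k) \<otimes>\<^bsub>S\<^esub> t k)"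
        unfolding g_def using insert UT(4) c by (intro sev_lin[OF t]) auto
      also have "\<dots> = R.indexed_const (c i j) \<otimes>\<^bsub>S\<^esub> t j \<oplus>\<^bsub>S\<^esub> (\<Oplus>\<^bsub>S\<^esub>k\<in>U. R.indexed_const (c i k) \<otimes>\<^bsub>S\<^esub> t k)"
        using insert c const_S t by (intro S.finsum_insert) auto
      also have "(\<Oplus>\<^bsub>S\<^esub>k\<in>U. R.indexed_const (c i k) \<otimes>\<^bsub>S\<^esub> t k) = g U i"
        unfolding g_def lin_def using insert UT(3) c const_S var_S
        by (intro S.finsum_cong') (auto simp: t_def)
      also have "R.indexed_const (c i j) \<otimes>\<^bsub>S\<^esub> t j \<oplus>\<^bsub>S\<^esub> g U i = g U i"
        using c const_S gs[OF UT(1)] by (simp add: t_def)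
      finally show "sev t (g (insert j U) i) = g U i" .
    qed
    have zero: "g U j = \<zero>\<^bsub>S\<^esub>"
    proof -
      have "g U j = (\<Oplus>\<^bsub>S\<^esub>k\<in>U. \<zero>\<^bsub>S\<^esub>)" unfolding g_def lin_def
      proof (rule S.finsum_cong')
        fix k assume k: "k \<in> U"
        then have "k \<noteq> j" using insert by blast
        then have "c j k = \<zero>" using j uc by (simp add: c_def delta_def)
        moreover have "R.indexed_const \<zero> = \<zero>\<^bsub>S\<^esub>" by (simp add: R.mpoly_simps)
        moreover have "R.indexed_var k \<in> carrier S" using k UT var_S by auto
        ultimately show "R.indexed_const (c j k) \<otimes>\<^bsub>S\<^esub> R.indexed_var k = \<zero>\<^bsub>S\<^esub>" by simp
      qed auto
      then show ?thesis by simp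
    qed
    have gj: "g (insert j U) j = R.indexed_const u \<otimes>\<^bsub>S\<^esub> R.indexed_var j"
    proof -
      have "g (insert j U) j = R.indexed_const (c j j) \<otimes>\<^bsub>S\<^esub> R.indexed_var j \<oplus>\<^bsub>S\<^esub> g U j"
        unfolding g_def using insert UT(4) c by (intro lin_insert) auto
      moreover have "c j j = u" using j uc by (simp add: c_def delta_def)
      ultimately show ?thesis using zero uc const_S var_S j by simp
    qed
    \<comment> \<open>The variable \<open>X_j\<close> separates the two primes: it is sent to zero
      by \<open>g U\<close> and to \<open>u X_j\<close>, with \<open>u\<close> outside
      \<open>Q\<close>, by \<open>g (insert j U)\<close>.\<close>
    have "R.indexed_var j \<in> sprime (g U) Q"
      using R.var_mem_subst_prime[OF gs[OF UT(1)], of j] j zero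
        idealD(2)[OF R.coeffs_in_ideal[OF primeideal.axioms(1)[OF Q]], of "{..<n}"] by simp
    moreover have "R.indexed_var j \<notin> sprime (g (insert j U)) Q"
    proof
      assume "R.indexed_var j \<in> sprime (g (insert j U)) Q"
      then have "R.indexed_const u \<otimes>\<^bsub>S\<^esub> R.indexed_var j \<in> R.coeffs_in {..<n} Q"
        using R.var_mem_subst_prime[OF gs[OF UT(2)], of j] j gj by simp
      then have "(R.indexed_const u \<otimes>\<^bsub>S\<^esub> R.indexed_var j) {#j#} \<in> Q" unfolding R.coeffs_in_def by blast
      then show False using R.coeff_const_mult_var[OF uc, of "{..<n}" j] u by simp
    qed
    ultimately have "sprime (g (insert j U)) Q \<subset> sprime (g U) Q" using sub by blast
    moreover have "primeideal (sprime (g (insert j U)) Q) S" using gs[OF UT(2)] by (intro sprime_prime Q) blast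
    ultimately have "prime_path S (Suc (card U)) (sprime (g (insert j U)) Q) (sprime (g {}) Q)"
      using insert UT(1) by (intro prime_path_Suc) auto
    then show ?case using insert by simp
  qed
  have "g {} = (\<lambda>i. \<zero>\<^bsub>S\<^esub>)" by (simp add: g_def lin_def)
  then show thesis using that[OF le rel] path[OF fin] by simp
qed

end

lemma (in noetherian_cring) maximal_ideal_exists:
  assumes P: "primeideal P R"
  obtains I where "maximalideal I R" "P \<subseteq> I"
proof -
  define F where "F = {I. ideal I R \<and> P \<subseteq> I \<and> \<one> \<notin> I}"
  have "P \<in> F" using primeideal.axioms(1)[OF P] primeideal_one_notin[OF P] by (simp add: F_def)
  then have ne: "F \<noteq> {}" by blast
  have Fi: "ideal I R" if "I \<in> F" for I using that by (simp add: F_def)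
  obtain I where I: "I \<in> F" and Imax: "\<And>L. L \<in> F \<Longrightarrow> I \<subseteq> L \<Longrightarrow> L = I"
    by (rule maximal_ideal_in_family[OF ne Fi], assumption, rule that; assumption)
  have "maximalideal I R"
  proof (rule maximalidealI)
    show "ideal I R" "carrier R \<noteq> I" using I by (auto simp: F_def)
    fix J assume J: "ideal J R" "I \<subseteq> J" "J \<subseteq> carrier R"
    show "J = I \<or> J = carrier R"
    proof (cases "\<one> \<in> J")
      case True
      then show ?thesis using ideal.one_imp_carrier[OF J(1)] by blast
    next
      case False
      then have "J \<in> F" using J I by (auto simp: F_def)
      then show ?thesis using Imax J by blast
    qed
  qed
  then show thesis using that I by (auto simp: F_def)
qed

lemma height_mono:
  assumes "primeideal P A" "primeideal Q A" "P \<subseteq> Q"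
  shows "height A P \<le> height A Q"
proof (rule height_le)
  fix k U assume "prime_path A k U P"
  then obtain l where "k \<le> l" "prime_path A l U Q"
    using prime_path_widen[of A k U P U Q] prime_path_primes assms by blast
  then show "enat k \<le> height A Q" using height_path_le[of A l U Q] by (meson enat_ord_simps(1) order_trans)
qed

section \<open>The estimate for a module with chosen generators\<close>

context generated_module
begin

lemma contraction_path_height:
  assumes "noetherian_ring R" "prime_path S k U V"
  shows "enat k \<le> height R (R.contraction V) + enat n"
proof -
  obtain l where l: "k \<le> l + n" "prime_path R l (R.contraction U) (R.contraction V)"
    using R.contraction_path[OF assms] by blast
  have "enat k \<le> enat l + enat n" using l(1) by simp
  also have "\<dots> \<le> height R (R.contraction V) + enat n" using height_path_le[OF l(2)] by (rule add_right_mono)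
  finally show ?thesis .
qed

lemma coeffs_in_contraction_subset:
  assumes N: "primeideal N S" and p: "p \<subseteq> R.contraction N"
  shows "R.coeffs_in {..<n} p \<subseteq> N"
  using p by (intro R.coeffs_in_subset primeideal.axioms(1)[OF N]) (auto simp: R.contraction_def)

text \<open>Heights are replaced by the lengths of two chains of inclusions: \<open>p1[X]\<close> in
  \<open>q\<close> in \<open>P'\<close>, with lengths \<open>e\<close> and \<open>k\<close>, and
  \<open>p2[X]\<close> in \<open>Q'\<close> in \<open>I'\<close>, with lengths \<open>e'\<close> and
  \<open>h\<close>. The cancellation then takes place among natural numbers.\<close>

theorem height_bound:
  assumes noeth: "noetherian_ring R" and ucat: "universally_catenary R"
    and leq: "locally_equidimensional R"
    and max_height: "\<And>I J. maximalideal I R \<Longrightarrow> maximalideal J R \<Longrightarrow> height R I = height R J"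
    and sym: "equidimensional (sym_algebra R M)"
    and b: "coeff_fun b"
    and P: "minimal_prime_over R {(\<Oplus>i\<in>{..<n}. c i \<otimes> b i) | c. c \<in> relations} P"
    and Q: "primeideal Q R"
  shows "height R P + local_min_generators R Q M \<le> enat n + height R Q"
proof -
  have Rn: "noetherian_cring R" using noeth R.is_cring by (simp add: noetherian_cring_def)
  interpret Sn: noetherian_cring S
    using R.mpoly_noetherian[OF noeth] S.is_cring by (simp add: noetherian_cring_def)
  have cat: "catenary S"
  proof (rule catenary_if_quotient_zero[OF S.is_cring])
    show "catenary (S Quot {\<zero>\<^bsub>S\<^esub>})"
      using ucat S.zeroideal unfolding universally_catenary_def by blast
  qed
  have Pp: "primeideal P R" using P by (simp add: minimal_prime_over_def)
  define g :: "nat \<Rightarrow> nat multiset \<Rightarrow> 'a" where "g = (\<lambda>i. R.indexed_const (b i))"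
  have g: "substitution g" and gs: "\<And>i. g i \<in> carrier S" using b const_S by (auto simp: g_def)
  define P' where "P' = sprime g P"
  have P'p: "primeideal P' S" unfolding P'_def by (rule sprime_prime[OF g Pp])
  have conP': "R.contraction P' = P" unfolding P'_def by (rule contraction_sprime[OF g Pp])
  \<comment> \<open>Evaluating the linear form of a relation at \<open>b\<close> gives the
    corresponding generator of the ideal over which \<open>P\<close> is minimal.\<close>
  have ev_form: "sev g (lin {..<n} c) = R.indexed_const (\<Oplus>i\<in>{..<n}. c i \<otimes> b i)"
    and sum_closed: "(\<Oplus>i\<in>{..<n}. c i \<otimes> b i) \<in> carrier R" if c: "coeff_fun c" for c
  proof -
    interpret ring_hom_cring R S R.indexed_const by (rule const_hom_S)
    have cl: "(\<lambda>i. c i \<otimes> b i) \<in> {..<n} \<rightarrow> carrier R" using b c by auto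
    show "(\<Oplus>i\<in>{..<n}. c i \<otimes> b i) \<in> carrier R" using R.finsum_closed[OF cl] .
    have "R.indexed_const (\<Oplus>i\<in>{..<n}. c i \<otimes> b i) = (\<Oplus>\<^bsub>S\<^esub>i\<in>{..<n}. R.indexed_const (c i \<otimes> b i))"
      using hom_finsum[OF cl] by (simp add: comp_def)
    also have "\<dots> = (\<Oplus>\<^bsub>S\<^esub>i\<in>{..<n}. R.indexed_const (c i) \<otimes>\<^bsub>S\<^esub> g i)"
      using b c const_S by (intro S.finsum_cong') (auto simp: g_def)
    finally show "sev g (lin {..<n} c) = R.indexed_const (\<Oplus>i\<in>{..<n}. c i \<otimes> b i)"
      using sev_lin[OF g, of "{..<n}" c] c by simp
  qed
  have "rel_forms \<subseteq> P'"
  proof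
    fix f assume "f \<in> rel_forms"
    then obtain c where c: "c \<in> relations" "f = lin {..<n} c" by (auto simp: rel_forms_def)
    have cf: "coeff_fun c" using c(1) by (simp add: relations_def)
    have "(\<Oplus>i\<in>{..<n}. c i \<otimes> b i) \<in> P" using P c(1) unfolding minimal_prime_over_def by blast
    then have "sev g f \<in> R.coeffs_in {..<n} P"
      unfolding c(2) ev_form[OF cf] by (rule R.const_in_coeffs_in[OF primeideal.axioms(1)[OF Pp]])
    then show "f \<in> P'" using c(2) lin_closed[OF _ cf, of "{..<n}"] by (simp add: P'_def subst_prime_def)
  qed
  then obtain q where q: "minimal_prime_over S rel_forms q" "q \<subseteq> P'"
    using S.minimal_prime_exists[OF P'p] by blast
  have qp: "primeideal q S" and qJ: "rel_forms \<subseteq> q" using q by (auto simp: minimal_prime_over_def)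
  have krull: "k \<le> n" if k: "prime_path S k q P'" for k
  proof -
    \<comment> \<open>Up to sign these are the \<open>X_i - b_i\<close>. Their number is the bound
      in the height theorem.\<close>
    define xs where "xs = map (\<lambda>i. g i \<ominus>\<^bsub>S\<^esub> R.indexed_var i) [0..<n]"
    have "k \<le> length xs"
    proof (rule Sn.height_theorem[OF k])
      have "g i \<ominus>\<^bsub>S\<^esub> R.indexed_var i \<in> P'" if i: "i < n" for i
      proof -
        interpret H: ring_hom_cring S S "sev g" using sev_hom[OF g] .
        have "sev g (g i \<ominus>\<^bsub>S\<^esub> R.indexed_var i) = \<zero>\<^bsub>S\<^esub>"
          using i gs var_S R.subst_ev_simps(2,3)[OF gs] b
          by (simp add: a_minus_def S.r_neg) (simp add: g_def S.r_neg const_S)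
        then have "sev g (g i \<ominus>\<^bsub>S\<^esub> R.indexed_var i) \<in> R.coeffs_in {..<n} P"
          using idealD(2)[OF R.coeffs_in_ideal[OF primeideal.axioms(1)[OF Pp]], of "{..<n}"] by metis
        moreover have "g i \<ominus>\<^bsub>S\<^esub> R.indexed_var i \<in> carrier S" using gs[of i] var_S[OF i] by simp
        ultimately show ?thesis unfolding P'_def subst_prime_def by blast
      qed
      then show "set xs \<subseteq> P'" by (auto simp: xs_def)
      fix N assume N: "primeideal N S" "q \<subseteq> N" "set xs \<subseteq> N" "N \<subseteq> P'"
      note Ni = primeideal.axioms(1)[OF N(1)]
      have agree: "sev g f \<ominus>\<^bsub>S\<^esub> f \<in> N" if f: "f \<in> carrier S" for f
      proof -
        have "sev g f \<ominus>\<^bsub>S\<^esub> id f \<in> N"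
        proof (rule R.hom_agree_mod[OF S.is_cring R.subst_ev_simps(1)[OF gs] id_ring_hom Ni _ _ f])
          show "sev g (R.indexed_const a) \<ominus>\<^bsub>S\<^esub> id (R.indexed_const a) \<in> N" if "a \<in> carrier R" for a
            using that R.subst_ev_simps(2)[OF gs that] const_S[OF that] idealD(2)[OF Ni]
            by (simp add: a_minus_def S.r_neg)
          show "sev g (R.indexed_var i) \<ominus>\<^bsub>S\<^esub> id (R.indexed_var i) \<in> N" if "i \<in> {..<n}" for i
            using that N(3) R.subst_ev_simps(3)[OF gs] by (auto simp: xs_def)
        qed
        then show ?thesis by simp
      qed
      \<comment> \<open>Modulo \<open>N\<close> a relation form equals its value at
        \<open>b\<close>, so the contraction of \<open>N\<close> contains all these values;
        minimality of \<open>P\<close> leaves no other choice.\<close>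
      have conN: "R.contraction N = P"
      proof -
        have "R.contraction N \<subseteq> P" using N(4) conP' by (auto simp: R.contraction_def)
        moreover have "{(\<Oplus>i\<in>{..<n}. c i \<otimes> b i) | c. c \<in> relations} \<subseteq> R.contraction N"
        proof
          fix a assume "a \<in> {(\<Oplus>i\<in>{..<n}. c i \<otimes> b i) | c. c \<in> relations}"
          then obtain c where c: "c \<in> relations" "a = (\<Oplus>i\<in>{..<n}. c i \<otimes> b i)" by blast
          have cf: "coeff_fun c" using c(1) by (simp add: relations_def)
          have lN: "lin {..<n} c \<in> N" using c(1) qJ N(2) by (auto simp: rel_forms_def)
          define l where "l = lin {..<n} c"
          have l: "l \<in> carrier S" "l \<in> N" using lN lin_closed[OF _ cf] by (auto simp: l_def)
          have e: "sev g l = R.indexed_const a" unfolding l_def c(2) by (rule ev_form[OF cf])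
          have ac: "a \<in> carrier R" using sum_closed[OF cf] c(2) by simp
          have "(R.indexed_const a \<ominus>\<^bsub>S\<^esub> l) \<oplus>\<^bsub>S\<^esub> l \<in> N"
            using agree[OF l(1)] l(2) idealD(3)[OF Ni] unfolding e by blast
          moreover have "(y \<ominus>\<^bsub>S\<^esub> l) \<oplus>\<^bsub>S\<^esub> l = y" if "y \<in> carrier S" for y using that l(1) by algebra
          ultimately have "R.indexed_const a \<in> N" using const_S[OF ac] by simp
          then show "a \<in> R.contraction N" using ac by (simp add: R.contraction_def)
        qed
        ultimately show ?thesis
          using P R.contraction_prime[OF N(1)] unfolding minimal_prime_over_def by blast
      qed
      \<comment> \<open>Modulo \<open>N\<close> every \<open>f\<close> agrees with its value at
        \<open>b\<close>. For \<open>f\<close> in \<open>P'\<close> the coefficients of that value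
        lie in \<open>P\<close>, the contraction of \<open>N\<close>.\<close>
      have "P' \<subseteq> N"
      proof
        fix f assume f: "f \<in> P'"
        then have fS: "f \<in> carrier S" and evf: "sev g f \<in> R.coeffs_in {..<n} P" by (auto simp: P'_def subst_prime_def)
        have e: "sev g f \<in> N" using evf coeffs_in_contraction_subset[OF N(1), of P] conN by blast
        then have "sev g f \<ominus>\<^bsub>S\<^esub> (sev g f \<ominus>\<^bsub>S\<^esub> f) \<in> N" using agree[OF fS] idealD(5)[OF Ni] by blast
        moreover have "y \<ominus>\<^bsub>S\<^esub> (y \<ominus>\<^bsub>S\<^esub> f) = f" if "y \<in> carrier S" for y using that fS by algebra
        ultimately show "f \<in> N" using e idealD(1)[OF Ni] by auto
      qed
      then show "N = P'" using N(4) by blast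
    qed
    then show ?thesis by (simp add: xs_def)
  qed

  \<comment> \<open>Choosing \<open>p1\<close> below the contraction of \<open>q\<close>, and not
    merely below \<open>P\<close>, ensures that \<open>q\<close> lies between \<open>p1[X]\<close>
    and \<open>P'\<close>.\<close>
  obtain p1 where p1: "minimal_prime_over R {\<zero>} p1" "p1 \<subseteq> R.contraction q"
    using R.minimal_prime_exists[OF R.contraction_prime[OF qp], of "{\<zero>}"]
      primeD(2)[OF R.contraction_prime[OF qp]] by blast
  have p1p: "primeideal p1 R" using p1 by (simp add: minimal_prime_over_def)
  have p1P: "p1 \<subseteq> P" using p1(2) q(2) conP' by (auto simp: R.contraction_def)
  obtain e k where e: "prime_path S e (R.coeffs_in {..<n} p1) q" and k: "prime_path S k q P'"
    and ek: "\<And>l. prime_path S l (R.coeffs_in {..<n} p1) P' \<Longrightarrow> l \<le> e + k"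
    using catenary_paths[OF cat R.coeffs_in_prime[OF p1p] qp P'p coeffs_in_contraction_subset[OF qp p1(2)] q(2)]
    by blast
  \<comment> \<open>A path of length \<open>a\<close> to \<open>P\<close> yields one of length at
    least \<open>a + n\<close> from \<open>p1[X]\<close> to \<open>P'\<close>. Catenarity bounds
    that by \<open>e + k\<close>, and Krull's bound on \<open>k\<close> absorbs the
    \<open>n\<close>.\<close>
  have htP: "height R P \<le> enat e"
  proof (rule height_le)
    fix a U assume "prime_path R a U P"
    then obtain l where l: "a \<le> l" "prime_path R l p1 P"
      using R.locally_equidimensional_path[OF leq Pp p1(1) p1P] by blast
    have "prime_path S (l + n) (R.coeffs_in {..<n} p1) P'"
      unfolding P'_def g_def by (rule path_from_extension[OF p1p b l(2)])
    then have "l + n \<le> e + k" using ek by blast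
    then show "enat a \<le> enat e" using krull[OF k] l(1) by simp
  qed

  obtain I where I: "maximalideal I R" "Q \<subseteq> I" using noetherian_cring.maximal_ideal_exists[OF Rn Q] by blast
  have Ip: "primeideal I R" using R.maximalideal_prime[OF I(1)] .
  \<comment> \<open>This prime may differ from \<open>p1\<close>. Since it lies below
    \<open>Q\<close>, chains from \<open>p2[X]\<close> can pass through \<open>Q'\<close>.\<close>
  obtain p2 where p2: "minimal_prime_over R {\<zero>} p2" "p2 \<subseteq> Q"
    using R.minimal_prime_exists[OF Q, of "{\<zero>}"] primeD(2)[OF Q] by blast
  have p2p: "primeideal p2 R" using p2 by (simp add: minimal_prime_over_def)
  have z: "substitution (\<lambda>i. \<zero>\<^bsub>S\<^esub>)" by simp
  define Q' where "Q' = sprime (\<lambda>i. \<zero>\<^bsub>S\<^esub>) Q"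
  define I' where "I' = sprime (\<lambda>i. \<zero>\<^bsub>S\<^esub>) I"
  have Q'p: "primeideal Q' S" and I'p: "primeideal I' S"
    unfolding Q'_def I'_def using sprime_prime[OF z] Q Ip by auto
  have conQ': "R.contraction Q' = Q" unfolding Q'_def by (rule contraction_sprime[OF z Q])
  have QI: "Q' \<subseteq> I'" using I(2) unfolding Q'_def I'_def subst_prime_def R.coeffs_in_def by blast
  have p2Q: "R.coeffs_in {..<n} p2 \<subseteq> Q'" using coeffs_in_contraction_subset[OF Q'p] p2(2) conQ' by blast
  obtain e' h where e': "prime_path S e' (R.coeffs_in {..<n} p2) Q'" and h: "prime_path S h Q' I'"
    and eh: "\<And>l. prime_path S l (R.coeffs_in {..<n} p2) I' \<Longrightarrow> l \<le> e' + h"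
    using catenary_paths[OF cat R.coeffs_in_prime[OF p2p] Q'p I'p p2Q QI] by blast
  have htI: "height R I + enat n \<le> enat (e' + h)"
  proof -
    have le: "a + n \<le> e' + h" if a: "prime_path R a U I" for a U
    proof -
      obtain l where l: "a \<le> l" "prime_path R l p2 I"
        using R.locally_equidimensional_path[OF leq Ip p2(1) _ a] p2(2) I(2) by blast
      have "prime_path S (l + n) (R.coeffs_in {..<n} p2) I'"
        using path_from_extension[OF p2p _ l(2), of "\<lambda>_. \<zero>"] by (simp add: I'_def zero_substitution)
      then show ?thesis using eh l(1) by fastforce
    qed
    \<comment> \<open>The trivial path at \<open>I\<close> shows that the truncated subtraction in
      the next line loses nothing.\<close>
    have n_le: "n \<le> e' + h" using le[OF prime_path_0[OF Ip]] by simp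
    have "height R I \<le> enat (e' + h - n)"
      by (rule height_le) (use le in fastforce)
    then have "height R I + enat n \<le> enat (e' + h - n) + enat n" by (rule add_right_mono)
    then show ?thesis using n_le by simp
  qed
  obtain t U where t: "local_min_generators R Q M \<le> enat t" and U: "rel_forms \<subseteq> U"
    and tU: "prime_path S t U Q'" unfolding Q'_def using fibre_path[OF Q] by blast
  \<comment> \<open>The path through the fibre over \<open>Q\<close> and on to \<open>I'\<close>
    lies above the relations. Equidimensionality makes it start at \<open>q\<close>, with no control
    over its end \<open>Z\<close>.\<close>
  obtain l Z where l: "t + h \<le> l" "prime_path S l q Z"
    using sym_equidimensional_path[OF sym q(1) prime_path_trans[OF tU h] U] by blast
  have Zp: "primeideal Z S" using prime_path_primes[OF l(2)] by blast
  note cZ = R.contraction_prime[OF Zp]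
  \<comment> \<open>The end \<open>Z\<close> is unrelated to \<open>I\<close>; a maximal ideal above
    its contraction has the same height as \<open>I\<close>, which allows the comparison.\<close>
  obtain L where L: "maximalideal L R" "R.contraction Z \<subseteq> L"
    using noetherian_cring.maximal_ideal_exists[OF Rn cZ] by blast
  have "enat (e + l) \<le> height R (R.contraction Z) + enat n"
    by (rule contraction_path_height[OF noeth prime_path_trans[OF e l(2)]])
  also have "\<dots> \<le> height R L + enat n"
    by (intro add_right_mono height_mono[OF cZ R.maximalideal_prime[OF L(1)] L(2)])
  also have "\<dots> = height R I + enat n" using max_height[OF L(1) I(1)] by simp
  also have "\<dots> \<le> enat (e' + h)" by (rule htI)
  finally have "e + l \<le> e' + h" by simp
  \<comment> \<open>The length \<open>h\<close> occurs inside \<open>l\<close> and on the right;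
    cancelling it removes the contribution of the maximal ideals.\<close>
  then have et: "e + t \<le> e'" using l(1) by simp
  have "height R P + local_min_generators R Q M \<le> enat e + enat t" using htP t by (rule add_mono)
  also have "\<dots> \<le> enat e'" using et by simp
  also have "\<dots> \<le> height R Q + enat n" using contraction_path_height[OF noeth e'] unfolding conQ' .
  finally show ?thesis by (simp add: add.commute)
qed

end

lemma linear_map_finsum:
  assumes M: "module R M" and N: "module R N" and f: "f \<in> linear_maps R M N"
    and F: "finite F" and x: "\<And>i. i \<in> F \<Longrightarrow> x i \<in> carrier M" and c: "\<And>i. i \<in> F \<Longrightarrow> c i \<in> carrier R"
  shows "f (\<Oplus>\<^bsub>M\<^esub>i\<in>F. c i \<odot>\<^bsub>M\<^esub> x i) = (\<Oplus>\<^bsub>N\<^esub>i\<in>F. c i \<odot>\<^bsub>N\<^esub> f (x i))"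
proof -
  interpret M: module R M by (rule M)
  interpret N: module R N by (rule N)
  have fc: "f y \<in> carrier N" if "y \<in> carrier M" for y using f that by (auto simp: linear_maps_def)
  have fadd: "f (y \<oplus>\<^bsub>M\<^esub> z) = f y \<oplus>\<^bsub>N\<^esub> f z" if "y \<in> carrier M" "z \<in> carrier M" for y z
    using f that by (simp add: linear_maps_def)
  have fs: "f (r \<odot>\<^bsub>M\<^esub> y) = r \<odot>\<^bsub>N\<^esub> f y" if "r \<in> carrier R" "y \<in> carrier M" for r y
    using f that by (simp add: linear_maps_def)
  show ?thesis using F x c
  proof (induction F)
    case empty
    have "f (\<zero>\<^bsub>R\<^esub> \<odot>\<^bsub>M\<^esub> \<zero>\<^bsub>M\<^esub>) = \<zero>\<^bsub>R\<^esub> \<odot>\<^bsub>N\<^esub> f \<zero>\<^bsub>M\<^esub>" by (rule fs) auto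
    then show ?case using fc[of "\<zero>\<^bsub>M\<^esub>"] by simp
  next
    case (insert i F)
    have a: "(\<lambda>i. c i \<odot>\<^bsub>M\<^esub> x i) \<in> F \<rightarrow> carrier M" "(\<lambda>i. c i \<odot>\<^bsub>N\<^esub> f (x i)) \<in> F \<rightarrow> carrier N"
      using insert fc by auto
    have i: "c i \<in> carrier R" "x i \<in> carrier M" using insert by auto
    show ?case
      using insert a i fc M.finsum_closed[OF a(1)] by (simp add: fadd fs)
  qed
qed

text \<open>A basis of \<open>F0\<close> provides the generators \<open>\<pi> (e i)\<close> of
  \<open>M\<close> and the scalars \<open>b (e i)\<close>. What remains is to recognise the
  generalized row ideal as the set of values of the relations at these scalars.\<close>

theorem theorem3p1:
  fixes R :: "('a, 'r) ring_scheme"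
    and M :: "('a, 'm, 's) module_scheme"
    and F1 :: "('a, 'x, 't) module_scheme"
    and F0 :: "('a, 'y, 'u) module_scheme"
    and n :: nat
    and \<phi> :: "'x \<Rightarrow> 'y" and \<pi> :: "'y \<Rightarrow> 'm" and b :: "'y \<Rightarrow> 'a"
    and P Q :: "'a set"
  assumes "cring R"
    and "noetherian_ring R"
    and "universally_catenary R"
    and "locally_equidimensional R"
    and "\<And>I J. maximalideal I R \<Longrightarrow> maximalideal J R \<Longrightarrow> height R I = height R J"
    and "module R M"
    and "finitely_generated R M"
    and "equidimensional (sym_algebra R M)"
    and "free_presentation R F1 F0 n M \<phi> \<pi>"
    and "b \<in> linear_maps R F0 (ring_as_module R)"
    and "minimal_prime_over R ((b \<circ> \<phi>) ` carrier F1) P"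
    and "primeideal Q R"
    and "Q \<subseteq> P"
  shows "height R P + local_min_generators R Q M \<le> enat n + height R Q"
proof -
  interpret R: cring R by (rule assms(1))
  interpret M: module R M by (rule assms(6))
  have F0: "module R F0" and pi: "\<pi> \<in> linear_maps R F0 M" and phi: "\<phi> \<in> linear_maps R F1 F0"
    and ker: "\<phi> ` carrier F1 = {y \<in> carrier F0. \<pi> y = \<zero>\<^bsub>M\<^esub>}" and surj: "\<pi> ` carrier F0 = carrier M"
    using assms(9) by (auto simp: free_presentation_def free_module_of_rank_def)
  interpret F0: module R F0 by (rule F0)
  interpret RM: module R "ring_as_module R" by (rule R.ring_as_module)
  obtain B where B: "module_basis R F0 B" "finite B" "card B = n"
    using assms(9) by (auto simp: free_presentation_def free_module_of_rank_def)
  have BF: "B \<subseteq> carrier F0" using B by (simp add: module_basis_def)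
  obtain e where e: "bij_betw e {..<n} B" using ex_bij_betw_nat_finite[OF B(2)] B(3) by (auto simp: atLeast0LessThan)
  have eB: "e i \<in> B" if "i < n" for i using bij_betwE[OF e] that by auto
  then have eF: "e i \<in> carrier F0" if "i < n" for i using BF that by blast
  define m where "m = (\<lambda>i. if i < n then \<pi> (e i) else \<zero>\<^bsub>M\<^esub>)"
  define b' where "b' = (\<lambda>i. if i < n then b (e i) else \<zero>\<^bsub>R\<^esub>)"
  have piM: "\<pi> y \<in> carrier M" if "y \<in> carrier F0" for y using surj that by blast
  have bR: "b y \<in> carrier R" if "y \<in> carrier F0" for y
    using assms(10) that by (auto simp: linear_maps_def ring_as_module_def)
  have b': "\<forall>i. b' i \<in> carrier R" using bR eF by (auto simp: b'_def)
  define vec where "vec = (\<lambda>c. \<Oplus>\<^bsub>F0\<^esub>i\<in>{..<n}. c i \<odot>\<^bsub>F0\<^esub> e i)"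
  have vec_closed: "vec c \<in> carrier F0" if "\<forall>i. c i \<in> carrier R" for c
    unfolding vec_def using eF that by (intro F0.finsum_closed) auto
  have coordinates: "\<exists>c. (\<forall>i. c i \<in> carrier R) \<and> y = vec c" if y: "y \<in> carrier F0" for y
  proof -
    obtain c where c: "c \<in> B \<rightarrow> carrier R" "\<forall>x. x \<notin> B \<longrightarrow> c x = \<zero>\<^bsub>R\<^esub>"
      "y = (\<Oplus>\<^bsub>F0\<^esub>x \<in> {x. c x \<noteq> \<zero>\<^bsub>R\<^esub>}. c x \<odot>\<^bsub>F0\<^esub> x)"
      using B(1) y unfolding module_basis_def by blast
    have cc: "c x \<in> carrier R" for x using c(1,2) by (cases "x \<in> B") auto
    have "y = (\<Oplus>\<^bsub>F0\<^esub>x \<in> B. c x \<odot>\<^bsub>F0\<^esub> x)"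
      unfolding c(3) by (rule F0.add.finprod_mono_neutral_cong_left) (use B(2) c cc BF in auto)
    also have "\<dots> = (\<Oplus>\<^bsub>F0\<^esub>x \<in> e ` {..<n}. c x \<odot>\<^bsub>F0\<^esub> x)" using e by (simp add: bij_betw_def)
    also have "\<dots> = vec (c \<circ> e)"
      unfolding vec_def comp_def using e eF cc
      by (intro F0.finsum_reindex) (auto simp: bij_betw_def)
    finally show ?thesis using cc by (intro exI[of _ "c \<circ> e"]) simp
  qed
  have pi_vec: "\<pi> (vec c) = (\<Oplus>\<^bsub>M\<^esub>i\<in>{..<n}. c i \<odot>\<^bsub>M\<^esub> m i)" if c: "\<forall>i. c i \<in> carrier R" for c
  proof -
    have "\<pi> (vec c) = (\<Oplus>\<^bsub>M\<^esub>i\<in>{..<n}. c i \<odot>\<^bsub>M\<^esub> \<pi> (e i))"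
      unfolding vec_def using c eF by (intro linear_map_finsum[OF F0 assms(6) pi]) auto
    also have "\<dots> = (\<Oplus>\<^bsub>M\<^esub>i\<in>{..<n}. c i \<odot>\<^bsub>M\<^esub> m i)"
      using c eF piM by (intro M.finsum_cong') (auto simp: m_def)
    finally show ?thesis .
  qed
  have b_vec: "b (vec c) = (\<Oplus>\<^bsub>R\<^esub>i\<in>{..<n}. c i \<otimes>\<^bsub>R\<^esub> b' i)" if c: "\<forall>i. c i \<in> carrier R" for c
  proof -
    \<comment> \<open>Addition and zero agree in \<open>R\<close> and in
      \<open>ring_as_module R\<close>, but the sums are formed in different records and have to be
      compared by induction.\<close>
    have fin: "finsum (ring_as_module R) f F = finsum R f F" if "finite F" "f \<in> F \<rightarrow> carrier R" for f and F :: "nat set"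
      using that
    proof (induction F)
      case empty
      then show ?case by simp (simp add: ring_as_module_def)
    next
      case (insert i F)
      then have "f \<in> F \<rightarrow> carrier (ring_as_module R)" "f i \<in> carrier (ring_as_module R)"
        by (auto simp: ring_as_module_def)
      then have "finsum (ring_as_module R) f (insert i F) = f i \<oplus>\<^bsub>ring_as_module R\<^esub> finsum (ring_as_module R) f F"
        using insert by (intro RM.finsum_insert) auto
      moreover have "finsum R f (insert i F) = f i \<oplus>\<^bsub>R\<^esub> finsum R f F"
        using insert by (intro R.finsum_insert) auto
      moreover have "finsum (ring_as_module R) f F = finsum R f F" using insert by auto
      ultimately show ?case by (simp only:) (simp add: ring_as_module_def)
    qed
    have "b (vec c) = (\<Oplus>\<^bsub>ring_as_module R\<^esub>i\<in>{..<n}. c i \<odot>\<^bsub>ring_as_module R\<^esub> b (e i))"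
      unfolding vec_def using c eF by (intro linear_map_finsum[OF F0 R.ring_as_module assms(10)]) auto
    also have "\<dots> = (\<Oplus>\<^bsub>ring_as_module R\<^esub>i\<in>{..<n}. c i \<otimes>\<^bsub>R\<^esub> b' i)"
      using c eF bR by (intro RM.finsum_cong') (auto simp: b'_def ring_as_module_def)
    also have "\<dots> = (\<Oplus>\<^bsub>R\<^esub>i\<in>{..<n}. c i \<otimes>\<^bsub>R\<^esub> b' i)" using c b' by (intro fin) auto
    finally show ?thesis .
  qed
  interpret G: generated_module R M n m
  proof unfold_locales
    show "m i \<in> carrier M" for i using piM eF by (simp add: m_def)
    fix x assume "x \<in> carrier M"
    then obtain y where y: "y \<in> carrier F0" "x = \<pi> y" using surj by blast
    then show "\<exists>c. (\<forall>i. c i \<in> carrier R) \<and> x = (\<Oplus>\<^bsub>M\<^esub>i\<in>{..<n}. c i \<odot>\<^bsub>M\<^esub> m i)"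
      using coordinates[OF y(1)] pi_vec by blast
  qed
  have rel: "c \<in> G.relations \<longleftrightarrow> (\<forall>i. c i \<in> carrier R) \<and> \<pi> (vec c) = \<zero>\<^bsub>M\<^esub>" for c
    using pi_vec by (auto simp: G.relations_def G.comb_def)
  \<comment> \<open>By exactness the image of \<open>\<phi>\<close> is the kernel of
    \<open>\<pi>\<close>, whose coordinate vectors are the relations. The module \<open>F1\<close>
    enters only through this image.\<close>
  have "(b \<circ> \<phi>) ` carrier F1 = b ` {y \<in> carrier F0. \<pi> y = \<zero>\<^bsub>M\<^esub>}"
    unfolding image_comp[symmetric] ker ..
  also have "\<dots> = {(\<Oplus>\<^bsub>R\<^esub>i\<in>{..<n}. c i \<otimes>\<^bsub>R\<^esub> b' i) | c. c \<in> G.relations}"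
  proof (intro equalityI subsetI)
    fix a assume "a \<in> b ` {y \<in> carrier F0. \<pi> y = \<zero>\<^bsub>M\<^esub>}"
    then obtain y where y: "y \<in> carrier F0" "\<pi> y = \<zero>\<^bsub>M\<^esub>" "a = b y" by blast
    then obtain c where c: "\<forall>i. c i \<in> carrier R" "y = vec c" using coordinates by blast
    then have "c \<in> G.relations" "a = (\<Oplus>\<^bsub>R\<^esub>i\<in>{..<n}. c i \<otimes>\<^bsub>R\<^esub> b' i)" using y rel b_vec by auto
    then show "a \<in> {(\<Oplus>\<^bsub>R\<^esub>i\<in>{..<n}. c i \<otimes>\<^bsub>R\<^esub> b' i) | c. c \<in> G.relations}" by blast
  next
    fix a assume "a \<in> {(\<Oplus>\<^bsub>R\<^esub>i\<in>{..<n}. c i \<otimes>\<^bsub>R\<^esub> b' i) | c. c \<in> G.relations}"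
    then obtain c where c: "c \<in> G.relations" "a = (\<Oplus>\<^bsub>R\<^esub>i\<in>{..<n}. c i \<otimes>\<^bsub>R\<^esub> b' i)" by blast
    then have "vec c \<in> {y \<in> carrier F0. \<pi> y = \<zero>\<^bsub>M\<^esub>}" "a = b (vec c)"
      using rel vec_closed b_vec by auto
    then show "a \<in> b ` {y \<in> carrier F0. \<pi> y = \<zero>\<^bsub>M\<^esub>}" by blast
  qed
  finally have "minimal_prime_over R {(\<Oplus>\<^bsub>R\<^esub>i\<in>{..<n}. c i \<otimes>\<^bsub>R\<^esub> b' i) | c. c \<in> G.relations} P"
    using assms(11) by simp
  then show ?thesis
    using G.height_bound[OF assms(2,3,4,5,8) b' _ assms(12)] by blast
qed

end
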